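(* Let $d\ge 2$ be an integer and let $\delta\in\mathcal D_0$ be such that $\Sigma_\delta=\{t\in I:\delta(t)=t\}=\{0,1\}$. For $r\in I$ define $$h(r)=r-\delta(r),\qquad F(r)=\frac{d-1}{d}\int_{1/2}^r\frac{1}{h(s)}\,ds,$$ $$a(r)=\frac{d-\delta'(r)}{d}\,h(r)^{-1+1/d}\,e^{F(r)},\qquad b(r)=\frac{\delta'(r)}{d}\,h(r)^{-1+1/d}\,e^{-(d-1)F(r)}.$$ Then the function $c_\delta$ defined for almost every $x=(x_1,\dots,x_d)\in I^d$ by $$c_\delta(x)=b(\max(x))\prod_{x_i\ne\max(x)}a(x_i)$$ is the density of a symmetric copula $C_\delta$ (that is, invariant under permutations of the variables) with diagonal section $\delta$. Furthermore, $$\mathcal I(C_\delta)=(d-1)\,\mathcal J(\delta)+\mathcal G(\delta).$$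
   Context: Notation: $I=[0,1]$, and $\max(x)=\max_{1\le i\le d}x_i$ for $x\in\mathbb R^d$. A $d$-dimensional copula is a function $C$ on $I^d$ of the form $C(u)=\mathbb P(U_1\le u_1,\dots,U_d\le u_d)$, where $U=(U_1,\dots,U_d)$ is a random vector with each $U_i$ uniform on $I$; $C$ is absolutely continuous if $U$ has a density with respect to Lebesgue measure, called the density of $C$. The diagonal section of $C$ is $\delta_C(t)=C(t,\dots,t)$, $t\in I$. $\mathcal D_0$ is the set of diagonal sections of absolutely continuous $d$-dimensional copulas. Any $\delta\in\mathcal D_0$ is non-decreasing and $d$-Lipschitz with $\delta(0)=0$, $\delta(1)=1$, $\delta(t)\le t$; so $\delta'$ exists a.e. and $0\le\delta'\le d$ a.e. For a non-negative measurable function $f$ on $I^k$, $\mathcal I_k(f)=\int_{I^k}f(x)\log(f(x))\,dx$ (with $0\log 0=0$). For a copula $C$, $\mathcal I(C)=\mathcal I_d(c)\in(-\infty,+\infty]$ if $C$ is absolutely continuous with density $c$, and $\mathcal I(C)=+\infty$ otherwise. Also $$\mathcal J(\delta)=\int_I|\log(t-\delta(t))|\,dt\in[0,+\infty],\qquad \mathcal G(\delta)=\mathcal I_1(\delta')+\mathcal I_1(d-\delta')-d\log(d)-(d-1).$$ The identity for $\mathcal I(C_\delta)$ is in $(-\infty,+\infty]$ (both sides may be $+\infty$). *)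

theory Defs
  imports "HOL-Probability.Probability"
begin

text \<open>
  Points of \<open>R^d\<close> are extensional functions on the index set \<open>{..<d}\<close>, so that Lebesgue measure
  on \<open>R^d\<close> is the library product of \<open>d\<close> copies of \<^term>\<open>lborel\<close>. A function on \<open>I^d\<close>
  (or on \<open>I\<close>) is a total function of which only the values on the cube (or on \<open>I\<close>) matter.
\<close>

definition lebesgue_pow :: "nat \<Rightarrow> (nat \<Rightarrow> real) measure" where
  "lebesgue_pow d = (\<Pi>\<^sub>M i\<in>{..<d}. lborel)"

definition unit_cube :: "nat \<Rightarrow> (nat \<Rightarrow> real) set" where
  "unit_cube d = (\<Pi>\<^sub>E i\<in>{..<d}. {0..1})"

definition diag_point :: "nat \<Rightarrow> real \<Rightarrow> nat \<Rightarrow> real" where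
  "diag_point d t = (\<lambda>i\<in>{..<d}. t)"

definition max_coord :: "nat \<Rightarrow> (nat \<Rightarrow> real) \<Rightarrow> real" where
  "max_coord d x = Max (x ` {..<d})"


subsection \<open>Copulas\<close>

definition represents_copula ::
    "nat \<Rightarrow> 'a measure \<Rightarrow> (nat \<Rightarrow> 'a \<Rightarrow> real) \<Rightarrow> ((nat \<Rightarrow> real) \<Rightarrow> real) \<Rightarrow> bool" where
  "represents_copula d M U C \<longleftrightarrow>
     prob_space M \<and>
     (\<forall>i<d. U i \<in> borel_measurable M \<and> distr M lborel (U i) = uniform_measure lborel {0..1}) \<and>
     (\<forall>u\<in>unit_cube d. C u = measure M {\<omega> \<in> space M. \<forall>i<d. U i \<omega> \<le> u i})"

text \<open>
  HOL cannot quantify over the type of the sample space. Taking \<^typ>\<open>nat \<Rightarrow> real\<close> loses no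
  generality: the random vector may be replaced by the identity on \<open>R^d\<close> under its law.
\<close>

definition copula :: "nat \<Rightarrow> ((nat \<Rightarrow> real) \<Rightarrow> real) \<Rightarrow> bool" where
  "copula d C \<longleftrightarrow> (\<exists>(M :: (nat \<Rightarrow> real) measure) U. represents_copula d M U C)"

text \<open>
  Here \<open>c\<close> only has to be determined almost everywhere on the cube: it has to agree there with a
  measurable density \<open>f\<close> of the random vector. The function \<open>f\<close> vanishes almost everywhere outside
  the cube, because the marginals are uniform on \<open>I\<close>.
\<close>

definition copula_density ::
    "nat \<Rightarrow> ((nat \<Rightarrow> real) \<Rightarrow> real) \<Rightarrow> ((nat \<Rightarrow> real) \<Rightarrow> real) \<Rightarrow> bool" where
  "copula_density d C c \<longleftrightarrow>
     (\<exists>(M :: (nat \<Rightarrow> real) measure) U f.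
        represents_copula d M U C \<and>
        distributed M (lebesgue_pow d) (\<lambda>\<omega>. \<lambda>i\<in>{..<d}. U i \<omega>) f \<and>
        (AE x in lebesgue_pow d. x \<in> unit_cube d \<longrightarrow> 0 \<le> c x \<and> f x = ennreal (c x)))"

definition abs_cont_copula :: "nat \<Rightarrow> ((nat \<Rightarrow> real) \<Rightarrow> real) \<Rightarrow> bool" where
  "abs_cont_copula d C \<longleftrightarrow> (\<exists>c. copula_density d C c)"

definition symmetric_copula :: "nat \<Rightarrow> ((nat \<Rightarrow> real) \<Rightarrow> real) \<Rightarrow> bool" where
  "symmetric_copula d C \<longleftrightarrow>
     copula d C \<and> (\<forall>\<sigma>. \<sigma> permutes {..<d} \<longrightarrow> (\<forall>u\<in>unit_cube d. C (u \<circ> \<sigma>) = C u))"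

definition has_diagonal_section ::
    "nat \<Rightarrow> ((nat \<Rightarrow> real) \<Rightarrow> real) \<Rightarrow> (real \<Rightarrow> real) \<Rightarrow> bool" where
  "has_diagonal_section d C \<delta> \<longleftrightarrow> (\<forall>t\<in>{0..1}. \<delta> t = C (diag_point d t))"

definition D0 :: "nat \<Rightarrow> (real \<Rightarrow> real) set" where
  "D0 d = {\<delta>. \<exists>C. abs_cont_copula d C \<and> has_diagonal_section d C \<delta>}"


subsection \<open>Information functionals\<close>

text \<open>
  For \<open>f \<ge> 0\<close> the negative part of \<open>f log f\<close> is at most \<open>1/e\<close>, so on a set of finite measure the
  second integral is finite and the difference below is the integral of \<open>f log f\<close> in
  \<open>(-\<infinity>, +\<infinity>]\<close>. Note that \<^const>\<open>ennreal\<close> truncates negative numbers to \<open>0\<close>, which is what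
  picks out the positive and the negative part.
\<close>

definition xlogx_integral :: "'a measure \<Rightarrow> 'a set \<Rightarrow> ('a \<Rightarrow> real) \<Rightarrow> ereal" where
  "xlogx_integral M A f =
     enn2ereal (\<integral>\<^sup>+x\<in>A. ennreal (f x * ln (f x)) \<partial>M) -
     enn2ereal (\<integral>\<^sup>+x\<in>A. ennreal (- (f x * ln (f x))) \<partial>M)"

definition info1 :: "(real \<Rightarrow> real) \<Rightarrow> ereal" where
  "info1 f = xlogx_integral lborel {0..1} f"

definition info_pow :: "nat \<Rightarrow> ((nat \<Rightarrow> real) \<Rightarrow> real) \<Rightarrow> ereal" where
  "info_pow k f = xlogx_integral (lebesgue_pow k) (unit_cube k) f"

text \<open>The choice of the density is immaterial, since any two densities agree almost everywhere.\<close>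

definition copula_info :: "nat \<Rightarrow> ((nat \<Rightarrow> real) \<Rightarrow> real) \<Rightarrow> ereal" where
  "copula_info d C =
     (if abs_cont_copula d C then info_pow d (SOME c. copula_density d C c) else \<infinity>)"

text \<open>In HOL \<open>ln 0 = 0\<close>, so the value \<open>|log 0| = \<infinity>\<close> has to be given explicitly.\<close>

definition J_fun :: "(real \<Rightarrow> real) \<Rightarrow> ennreal" where
  "J_fun \<delta> = (\<integral>\<^sup>+t\<in>{0..1}. (if \<delta> t = t then \<infinity> else ennreal \<bar>ln (t - \<delta> t)\<bar>) \<partial>lborel)"

definition G_fun :: "nat \<Rightarrow> (real \<Rightarrow> real) \<Rightarrow> ereal" where
  "G_fun d \<delta> = info1 (deriv \<delta>) + info1 (\<lambda>t. real d - deriv \<delta> t)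
     - ereal (real d * ln (real d)) - ereal (real d - 1)"


subsection \<open>The function \<open>c\<^sub>\<delta>\<close>\<close>

definition h_fun :: "(real \<Rightarrow> real) \<Rightarrow> real \<Rightarrow> real" where
  "h_fun \<delta> r = r - \<delta> r"

definition F_fun :: "nat \<Rightarrow> (real \<Rightarrow> real) \<Rightarrow> real \<Rightarrow> real" where
  "F_fun d \<delta> r = (real d - 1) / real d * (LBINT s=ereal (1/2)..ereal r. 1 / h_fun \<delta> s)"

definition a_fun :: "nat \<Rightarrow> (real \<Rightarrow> real) \<Rightarrow> real \<Rightarrow> real" where
  "a_fun d \<delta> r = (real d - deriv \<delta> r) / real d
     * h_fun \<delta> r powr (- 1 + 1 / real d) * exp (F_fun d \<delta> r)"

definition b_fun :: "nat \<Rightarrow> (real \<Rightarrow> real) \<Rightarrow> real \<Rightarrow> real" where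
  "b_fun d \<delta> r = deriv \<delta> r / real d
     * h_fun \<delta> r powr (- 1 + 1 / real d) * exp (- (real d - 1) * F_fun d \<delta> r)"

definition c_fun :: "nat \<Rightarrow> (real \<Rightarrow> real) \<Rightarrow> (nat \<Rightarrow> real) \<Rightarrow> real" where
  "c_fun d \<delta> x = b_fun d \<delta> (max_coord d x)
     * (\<Prod>i\<in>{i. i < d \<and> x i \<noteq> max_coord d x}. a_fun d \<delta> (x i))"

end

(* Writing h for t - \<delta>(t), the functions A = h^(1/d) e^F and K = h^(1-1/d) e^(-F) are primitives of
   a and of -(d-1) b A^(d-2), they vanish at 0 and at 1 respectively, and b A^(d-1) = \<delta>'/d, A K = h.
   Integrating c_\<delta> over the part of the cube where the k-th coordinate is the largest therefore gives
   all that is needed: the maximum has density \<delta>', the i-th coordinate contributes \<delta>'/d when it is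
   the maximum and (d-\<delta>')/d when it is not, so it is uniform.  For the entropy, log c_\<delta>(U) is the sum
   of (1-1/d) \<Sum> |log h(U_i)|, of logarithms of \<delta>'(max)/d and (d-\<delta>'(U_i))/d, and of
   -\<Sum> (F(max) - F(U_i)).  The last sum has mean d-1, since F(max) - F(U_i) is the integral of F' over
   [U_i, max] and P(U_i < s \<le> max) = h(s).  Only the first part, which is nonnegative, can have
   infinite mean. *)
theory Submission
  imports Defs
begin

text \<open>The derivative of \<delta> exists only almost everywhere, so the computations use a
  Borel function \<open>g\<close> with values in [0,d] everywhere. The law of the largest component
  of the given vector is at most d times Lebesgue measure by a union bound, \<delta> is its
  distribution function on [0,1], and \<open>g\<close> is its Radon-Nikodym density. That
  \<open>g\<close> is \<delta>' almost everywhere is the Lebesgue differentiation theorem. The way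
  back, from a derivative known almost everywhere to an integral, is made through Lipschitz
  functions; the primitives are shown Lipschitz only on compact subintervals of (0,1), whence the
  limits at 0 and 1.

  The entropy is not computed by adding expectations, because \<open>J_fun \<delta>\<close> may be
  infinite. Where c is positive, ln c is written as X - Z with X and Z nonnegative, and the
  subtraction-free identity (c ln c)^+ + c Z = c X + (c ln c)^- is integrated in [0,\<infinity>];
  only Z must have finite mean. The divisions by d in a and b, together with 0 <= \<delta>' <= d,
  are what give the logarithms in Z a constant sign.\<close>

subsection \<open>Differentiation of indefinite integrals and of Lipschitz functions\<close>

text \<open>The exceptional set is Vitali covered by intervals on which the mean of \<open>g\<close> exceeds \<open>q\<close>, inside
  an open set that is hardly larger than \<open>{g < p}\<close>. Disjoint such intervals have small total length.\<close>

lemma upper_derivative_le_density_aux: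
  fixes g G :: "real \<Rightarrow> real"
  assumes g [measurable]: "g \<in> borel_measurable borel"
    and bounds: "\<And>x. 0 \<le> g x" "\<And>x. g x \<le> K"
    and G: "\<And>s t. s \<le> t \<Longrightarrow> (\<integral>\<^sup>+x\<in>{s..t}. ennreal (g x) \<partial>lborel) = ennreal (G t - G s)"
    and "p < q"
  shows "negligible {x \<in> ball 0 (real n). g x < p \<and>
           (\<forall>e>0. \<exists>s t. s \<le> x \<and> x \<le> t \<and> 0 < t - s \<and> t - s < e \<and> q * (t - s) < G t - G s)}"
    (is "negligible ?E")
proof (cases "0 < p")
  case False
  have "\<not> g x < p" for x using bounds(1)[of x] False by linarith
  then have "?E = {}" by simp
  then show ?thesis by (metis negligible_empty)
next
  case True
  show ?thesis
    unfolding negligible_outer_le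
  proof (intro allI impI)
    fix e :: real assume "0 < e"
    define A where "A = {x \<in> ball 0 (real n). g x < p}"
    have A [measurable]: "A \<in> sets borel" unfolding A_def by measurable
    have "K \<ge> 0" using bounds by (meson order_trans)
    \<comment> \<open>The estimate below ends in (q - p) m <= K \<epsilon>, so this choice yields m
      <= e; the summand 1 covers K = 0.\<close>
    define \<epsilon> where "\<epsilon> = e * (q - p) / (K + 1)"
    have "\<epsilon> > 0" using \<open>e > 0\<close> \<open>p < q\<close> \<open>K \<ge> 0\<close> by (auto simp: \<epsilon>_def)
    obtain T where T: "open T" "A \<subseteq> T" "T - A \<in> lmeasurable" "emeasure lebesgue (T - A) < ennreal \<epsilon>"
      using sets_lebesgue_outer_open[of A \<epsilon>] \<open>\<epsilon> > 0\<close> A by (auto intro: sets_completionI_sets)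
    have [measurable]: "T \<in> sets borel" using T(1) by auto
    define I where "I = {(s, t). s < t \<and> {s..t} \<subseteq> T \<and> q * (t - s) < G t - G s}"
    \<comment> \<open>Vitali's theorem is used for balls, so [s,t] is read as the ball of radius (t
      - s)/2 about its midpoint.\<close>
    have cb: "cball ((fst i + snd i) / 2) ((snd i - fst i) / 2) = {fst i..snd i}" for i :: "real \<times> real"
      by (auto simp: cball_eq_atLeastAtMost field_simps)
    obtain C where C: "countable C" "C \<subseteq> I"
       "pairwise (\<lambda>i j. disjnt (cball ((fst i + snd i) / 2) ((snd i - fst i) / 2))
                             (cball ((fst j + snd j) / 2) ((snd j - fst j) / 2))) C"
       "negligible (?E - (\<Union>i\<in>C. cball ((fst i + snd i) / 2) ((snd i - fst i) / 2)))"
    proof (rule Vitali_covering_theorem_cballs[of I "\<lambda>i. (snd i - fst i) / 2" ?E "\<lambda>i. (fst i + snd i) / 2"])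
      show "0 < (snd i - fst i) / 2" if "i \<in> I" for i using that by (auto simp: I_def)
      fix x r :: real assume x: "x \<in> ?E" and "0 < r"
      then have "x \<in> T" using T by (auto simp: A_def)
      then obtain u where u: "u > 0" "ball x u \<subseteq> T" using T(1) by (auto simp: open_contains_ball)
      then obtain s t where st: "s \<le> x" "x \<le> t" "0 < t - s" "t - s < min u r" "q * (t - s) < G t - G s"
        using x[unfolded mem_Collect_eq, THEN conjunct2, THEN conjunct2, rule_format, of "min u r"] \<open>0 < r\<close> by auto
      have "{s..t} \<subseteq> ball x u" using st by (auto simp: dist_real_def)
      then have "(s, t) \<in> I" using st u by (auto simp: I_def)
      moreover have "x \<in> cball ((s + t) / 2) ((t - s) / 2)" using st cb[of "(s, t)"] by auto
      ultimately show "\<exists>i. i \<in> I \<and> x \<in> cball ((fst i + snd i) / 2) ((snd i - fst i) / 2)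
          \<and> (snd i - fst i) / 2 < r"
        using st by (intro exI[of _ "(s, t)"]) auto
    qed (use that in blast)
    define V where "V = (\<Union>i\<in>C. {fst i..snd i})"
    have [measurable]: "V \<in> sets borel" unfolding V_def using C(1) by (intro sets.countable_UN') auto
    have V: "negligible (?E - V)" using C(4) unfolding cb V_def .
    have disj: "disjoint_family_on (\<lambda>i. {fst i..snd i}) C"
      using C(3) unfolding cb by (auto simp: pairwise_def disjnt_def disjoint_family_on_def)
    have "V \<subseteq> T"
      unfolding V_def
    proof (rule UN_least)
      fix i assume "i \<in> C"
      then have "i \<in> I" using C(2) by auto
      then show "{fst i..snd i} \<subseteq> T" by (cases i) (simp add: I_def)
    qed
    have TA: "emeasure lborel (T - A) \<le> ennreal \<epsilon>" using T(4) by simp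
    have "emeasure lborel V \<le> emeasure lborel T" using \<open>V \<subseteq> T\<close> by (intro emeasure_mono) auto
    also have "\<dots> \<le> emeasure lborel (A \<union> (T - A))" by (intro emeasure_mono) auto
    also have "\<dots> \<le> emeasure lborel A + emeasure lborel (T - A)" by (rule emeasure_subadditive) auto
    also have "\<dots> < \<infinity>"
    proof -
      have "emeasure lborel A \<le> emeasure lborel (ball 0 (real n) :: real set)"
        by (intro emeasure_mono) (auto simp: A_def)
      also have "\<dots> < \<infinity>" using emeasure_bounded_finite[of "ball 0 (real n) :: real set"] by simp
      finally show ?thesis using le_less_trans[OF TA ennreal_less_top] by simp
    qed
    finally obtain m where m: "emeasure lborel V = ennreal m" "0 \<le> m"
      by (cases "emeasure lborel V") auto
    \<comment> \<open>The chain that follows: the disjoint intervals give q m <= (integral of g over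
      V), while V lies in T, where g <= p on A and g <= K on the small rest.\<close>
    have "ennreal (q * m) = ennreal q * emeasure lborel V"
      using True \<open>p < q\<close> m by (simp add: ennreal_mult)
    also have "\<dots> = (\<integral>\<^sup>+i. ennreal q * emeasure lborel {fst i..snd i} \<partial>count_space C)"
      unfolding V_def using C(1) disj
      by (subst emeasure_UN_countable) (auto simp: nn_integral_cmult)
    also have "\<dots> \<le> (\<integral>\<^sup>+i. emeasure (density lborel (\<lambda>x. ennreal (g x))) {fst i..snd i} \<partial>count_space C)"
    proof (rule nn_integral_mono)
      fix i assume "i \<in> space (count_space C)"
      then have i: "i \<in> I" using C by auto
      then show "ennreal q * emeasure lborel {fst i..snd i} \<le> emeasure (density lborel (\<lambda>x. ennreal (g x))) {fst i..snd i}"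
        using True \<open>p < q\<close> by (auto simp: emeasure_density G I_def ennreal_mult[symmetric] intro!: ennreal_leI)
    qed
    also have "\<dots> = emeasure (density lborel (\<lambda>x. ennreal (g x))) V"
      unfolding V_def using C(1) disj by (subst emeasure_UN_countable) auto
    also have "\<dots> = (\<integral>\<^sup>+x. ennreal (g x) * indicator V x \<partial>lborel)" by (simp add: emeasure_density)
    also have "\<dots> \<le> (\<integral>\<^sup>+x. ennreal p * indicator V x + ennreal K * indicator (T - A) x \<partial>lborel)"
    proof (rule nn_integral_mono)
      fix x
      have "x \<in> V \<Longrightarrow> x \<in> T" using \<open>V \<subseteq> T\<close> by auto
      moreover have "x \<in> A \<Longrightarrow> g x \<le> p" by (simp add: A_def)
      ultimately show "ennreal (g x) * indicator V x \<le> ennreal p * indicator V x + ennreal K * indicator (T - A) x"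
        using bounds[of x] by (auto simp: indicator_def intro!: ennreal_leI add_increasing)
    qed
    also have "\<dots> = ennreal p * emeasure lborel V + ennreal K * emeasure lborel (T - A)"
      by (subst nn_integral_add) (auto simp: nn_integral_cmult)
    also have "\<dots> \<le> ennreal p * ennreal m + ennreal K * ennreal \<epsilon>"
      using TA m by (intro add_mono mult_left_mono) auto
    also have "\<dots> = ennreal (p * m + K * \<epsilon>)"
      using True m \<open>K \<ge> 0\<close> \<open>\<epsilon> > 0\<close> by (simp add: ennreal_mult ennreal_plus)
    finally have "q * m \<le> p * m + K * \<epsilon>"
      using True m \<open>K \<ge> 0\<close> \<open>\<epsilon> > 0\<close> by (subst (asm) ennreal_le_iff) auto
    then have "(q - p) * m \<le> K * \<epsilon>" by (simp add: algebra_simps)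
    also have "\<dots> \<le> (K + 1) * \<epsilon>" using \<open>\<epsilon> > 0\<close> by simp
    also have "\<dots> = (q - p) * e" using \<open>K \<ge> 0\<close> by (simp add: \<epsilon>_def)
    finally have "m \<le> e" using \<open>p < q\<close> by simp
    have Vm: "V \<in> lmeasurable" "measure lebesgue V = m"
      using m by (auto simp: fmeasurable_def measure_def)
    \<comment> \<open>\<open>?E\<close> itself is not known to be measurable; it is covered by V and
      a negligible remainder.\<close>
    have "(?E - V) \<union> V \<in> lmeasurable"
      using V Vm by (intro fmeasurable.Un) (auto simp: negligible_iff_measure)
    moreover have "measure lebesgue ((?E - V) \<union> V) = m"
      using V Vm by (subst Un_commute, subst measure_Un_null_set) (auto simp: negligible_iff_null_sets)
    moreover have "?E \<subseteq> (?E - V) \<union> V" by auto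
    ultimately show "\<exists>T. ?E \<subseteq> T \<and> T \<in> lmeasurable \<and> measure lebesgue T \<le> e"
      using \<open>m \<le> e\<close> by blast
  qed
qed

text \<open>Rationals p < q between g x and r, and balls of integer radius, reduce the exceptional
  points to countably many of the negligible sets above.\<close>

lemma upper_derivative_le_density:
  fixes g G :: "real \<Rightarrow> real"
  assumes g [measurable]: "g \<in> borel_measurable borel"
    and bounds: "\<And>x. 0 \<le> g x" "\<And>x. g x \<le> K"
    and G: "\<And>s t. s \<le> t \<Longrightarrow> (\<integral>\<^sup>+x\<in>{s..t}. ennreal (g x) \<partial>lborel) = ennreal (G t - G s)"
  shows "AE x in lborel. \<forall>r>g x. \<exists>e>0. \<forall>s t. s \<le> x \<and> x \<le> t \<and> 0 < t - s \<and> t - s < e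
           \<longrightarrow> G t - G s \<le> r * (t - s)"
proof -
  define E where "E n p q = {x \<in> ball 0 (real n). g x < p \<and>
           (\<forall>e>0. \<exists>s t. s \<le> x \<and> x \<le> t \<and> 0 < t - s \<and> t - s < e \<and> q * (t - s) < G t - G s)}" for n p q
  have "AE x in lborel. \<forall>n. \<forall>p\<in>\<rat>. \<forall>q\<in>\<rat>. p < q \<longrightarrow> x \<notin> E n p q"
  proof (subst AE_all_countable, intro allI, subst AE_ball_countable, goal_cases)
    case (2 n)
    show ?case
    proof (intro ballI, subst AE_ball_countable, goal_cases)
      case (2 p)
      show ?case
      proof
        fix q :: real assume "q \<in> \<rat>"
        show "AE x in lborel. p < q \<longrightarrow> x \<notin> E n p q"
        proof (cases "p < q")
          case True
          have "E n p q \<in> null_sets lebesgue"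
            using upper_derivative_le_density_aux[OF g bounds G True, of n]
            unfolding E_def negligible_iff_null_sets by simp
          then have "AE x in lebesgue. x \<notin> E n p q" by (rule AE_not_in)
          then show ?thesis by (simp add: AE_completion_iff)
        qed auto
      qed
    qed (auto simp: countable_rat)
  qed (auto simp: countable_rat)
  then show ?thesis
  proof eventually_elim
    fix x assume x: "\<forall>n. \<forall>p\<in>\<rat>. \<forall>q\<in>\<rat>. p < q \<longrightarrow> x \<notin> E n p q"
    show "\<forall>r>g x. \<exists>e>0. \<forall>s t. s \<le> x \<and> x \<le> t \<and> 0 < t - s \<and> t - s < e \<longrightarrow> G t - G s \<le> r * (t - s)"
    proof (intro allI impI)
      fix r assume "g x < r"
      obtain q where q: "q \<in> \<rat>" "g x < q" "q < r" using Rats_dense_in_real[OF \<open>g x < r\<close>] by auto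
      obtain p where p: "p \<in> \<rat>" "g x < p" "p < q" using Rats_dense_in_real[OF q(2)] by auto
      obtain n where n: "\<bar>x\<bar> < real n" using reals_Archimedean2 by blast
      have "x \<notin> E n p q" using x p q by auto
      then obtain e where e: "e > 0" "\<forall>s t. s \<le> x \<and> x \<le> t \<and> 0 < t - s \<and> t - s < e \<longrightarrow> G t - G s \<le> q * (t - s)"
        using n p unfolding E_def mem_Collect_eq mem_ball dist_real_def not_le[symmetric] by auto
      moreover have "q * (t - s) \<le> r * (t - s)" if "0 < t - s" for s t using q that by (intro mult_right_mono) auto
      ultimately show "\<exists>e>0. \<forall>s t. s \<le> x \<and> x \<le> t \<and> 0 < t - s \<and> t - s < e \<longrightarrow> G t - G s \<le> r * (t - s)"
        by (metis order_trans)
    qed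
  qed
qed

text \<open>The one-sided estimate is applied to g and to K - g, whose indefinite integral is K t -
  G t. Together they bound the difference quotients of G from above and from below.\<close>

theorem AE_has_real_derivative_indefinite_integral:
  fixes g G :: "real \<Rightarrow> real"
  assumes g [measurable]: "g \<in> borel_measurable borel"
    and bounds: "\<And>x. 0 \<le> g x" "\<And>x. g x \<le> K"
    and "mono G"
    and G: "\<And>s t. s \<le> t \<Longrightarrow> (\<integral>\<^sup>+x\<in>{s..t}. ennreal (g x) \<partial>lborel) = ennreal (G t - G s)"
  shows "AE x in lborel. (G has_real_derivative g x) (at x)"
proof -
  have G': "(\<integral>\<^sup>+x\<in>{s..t}. ennreal (K - g x) \<partial>lborel) = ennreal ((K * t - G t) - (K * s - G s))"
    if "s \<le> t" for s t
  proof -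
    have "0 \<le> G t - G s" using monoD[OF \<open>mono G\<close> that] by simp
    have "K \<ge> 0" using bounds by (meson order_trans)
    have "(\<integral>\<^sup>+x\<in>{s..t}. ennreal (K - g x) \<partial>lborel) + ennreal (G t - G s)
        = (\<integral>\<^sup>+x. (ennreal (K - g x) * indicator {s..t} x + ennreal (g x) * indicator {s..t} x) \<partial>lborel)"
      by (subst nn_integral_add) (auto simp: G[OF that])
    also have "\<dots> = (\<integral>\<^sup>+x. ennreal K * indicator {s..t} x \<partial>lborel)"
      by (intro nn_integral_cong) (auto simp: indicator_def ennreal_plus[symmetric] bounds simp del: ennreal_plus)
    also have "\<dots> = ennreal (K * (t - s))"
      using that \<open>K \<ge> 0\<close> by (simp add: nn_integral_cmult ennreal_mult)
    finally have eq: "(\<integral>\<^sup>+x\<in>{s..t}. ennreal (K - g x) \<partial>lborel) + ennreal (G t - G s) = ennreal (K * (t - s))" .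
    then have "(\<integral>\<^sup>+x\<in>{s..t}. ennreal (K - g x) \<partial>lborel) = ennreal (K * (t - s)) - ennreal (G t - G s)"
      by (metis ennreal_add_diff_cancel_right ennreal_neq_top)
    also have "\<dots> = ennreal (K * (t - s) - (G t - G s))"
      using \<open>0 \<le> G t - G s\<close> by (rule ennreal_minus)
    finally show ?thesis by (simp add: algebra_simps)
  qed
  have "AE x in lborel. \<forall>r>g x. \<exists>e>0. \<forall>s t. s \<le> x \<and> x \<le> t \<and> 0 < t - s \<and> t - s < e
           \<longrightarrow> G t - G s \<le> r * (t - s)"
    by (rule upper_derivative_le_density[OF g bounds G])
  moreover have "AE x in lborel. \<forall>r>K - g x. \<exists>e>0. \<forall>s t. s \<le> x \<and> x \<le> t \<and> 0 < t - s \<and> t - s < e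
           \<longrightarrow> (K * t - G t) - (K * s - G s) \<le> r * (t - s)"
    by (rule upper_derivative_le_density[where K = K, OF _ _ _ G']) (use bounds in auto)
  ultimately show ?thesis
  proof eventually_elim
    fix x
    assume U: "\<forall>r>g x. \<exists>e>0. \<forall>s t. s \<le> x \<and> x \<le> t \<and> 0 < t - s \<and> t - s < e
           \<longrightarrow> G t - G s \<le> r * (t - s)"
      and L: "\<forall>r>K - g x. \<exists>e>0. \<forall>s t. s \<le> x \<and> x \<le> t \<and> 0 < t - s \<and> t - s < e
           \<longrightarrow> (K * t - G t) - (K * s - G s) \<le> r * (t - s)"
    show "(G has_real_derivative g x) (at x)"
      unfolding has_field_derivative_iff LIM_eq
    proof (intro allI impI)
      fix r :: real assume "0 < r"
      obtain e1 where e1: "e1 > 0" "\<And>s t. s \<le> x \<Longrightarrow> x \<le> t \<Longrightarrow> 0 < t - s \<Longrightarrow> t - s < e1 \<Longrightarrow> G t - G s \<le> (g x + r / 2) * (t - s)"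
        using U[rule_format, of "g x + r / 2"] \<open>0 < r\<close> by auto
      obtain e2 where e2: "e2 > 0" "\<And>s t. s \<le> x \<Longrightarrow> x \<le> t \<Longrightarrow> 0 < t - s \<Longrightarrow> t - s < e2 \<Longrightarrow>
          (K * t - G t) - (K * s - G s) \<le> (K - g x + r / 2) * (t - s)"
        using L[rule_format, of "K - g x + r / 2"] \<open>0 < r\<close> by auto
      have main: "\<bar>(G t - G s) / (t - s) - g x\<bar> < r" if "s \<le> x" "x \<le> t" "0 < t - s" "t - s < min e1 e2" for s t
      proof -
        have "(G t - G s) / (t - s) \<le> g x + r / 2" using e1(2)[of s t] that by (simp add: divide_le_eq)
        moreover have "g x - r / 2 \<le> (G t - G s) / (t - s)" using e2(2)[of s t] that
          by (simp add: le_divide_eq algebra_simps)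
        ultimately show ?thesis using \<open>0 < r\<close> by auto
      qed
      have "norm ((G y - G x) / (y - x) - g x) < r" if "y \<noteq> x" "norm (y - x) < min e1 e2" for y
      proof (cases "y > x")
        case True then show ?thesis using main[of x y] that by auto
      next
        case False
        then have "norm ((G x - G y) / (x - y) - g x) < r" using main[of y x] that by auto
        moreover have "(G x - G y) / (x - y) = (G y - G x) / (y - x)" using minus_divide_divide[of "G y - G x" "y - x"] by simp
        ultimately show ?thesis by simp
      qed
      then show "\<exists>s>0. \<forall>y. y \<noteq> x \<and> norm (y - x) < s \<longrightarrow> norm ((G y - G x) / (y - x) - g x) < r"
        using e1(1) e2(1) by (intro exI[of _ "min e1 e2"]) auto
    qed
  qed
qed

text \<open>Difference quotients of f are bounded by L and converge to f' almost everywhere, so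
  dominated convergence applies; their integrals telescope to averages of f just to the right of t
  and of s, which tend to f t and f s.\<close>

lemma nn_integral_FTC_lipschitz:
  fixes f f' :: "real \<Rightarrow> real"
  assumes "s < t" and lip: "L-lipschitz_on {s..t} f"
    and f' [measurable]: "f' \<in> borel_measurable borel"
    and deriv: "AE x in lborel. x \<in> {s<..<t} \<longrightarrow> (f has_real_derivative f' x) (at x)"
    and nonneg: "\<And>x. x \<in> {s<..<t} \<Longrightarrow> 0 \<le> f' x"
  shows "(\<integral>\<^sup>+x\<in>{s..t}. ennreal (f' x) \<partial>lborel) = ennreal (f t - f s)"
proof -
  \<comment> \<open>Clamping the argument to [s,t] extends f to a Lipschitz function on the line, so
    that the quotients with step \<eta> may reach beyond t.\<close>
  define fc where "fc x = f (max s (min t x))" for x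
  have "L \<ge> 0" using lip by (rule lipschitz_on_nonneg)
  have lipc: "\<bar>fc x - fc y\<bar> \<le> L * \<bar>x - y\<bar>" for x y
  proof -
    have "\<bar>fc x - fc y\<bar> \<le> L * \<bar>max s (min t x) - max s (min t y)\<bar>"
      using lipschitz_onD[OF lip, of "max s (min t x)" "max s (min t y)"] \<open>s < t\<close>
      by (auto simp: fc_def dist_real_def)
    also have "\<dots> \<le> L * \<bar>x - y\<bar>" using \<open>L \<ge> 0\<close> by (intro mult_left_mono) auto
    finally show ?thesis .
  qed
  have cont: "continuous_on UNIV fc"
    by (rule lipschitz_on_continuous_on[of L], rule lipschitz_onI) (use lipc \<open>L \<ge> 0\<close> in \<open>auto simp: dist_real_def\<close>)
  then have [measurable]: "fc \<in> borel_measurable borel" by (rule borel_measurable_continuous_onI)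
  \<comment> \<open>An antiderivative of the continuous \<open>fc\<close> turns the integral of a
    difference quotient into difference quotients of \<Phi> at t and at s.\<close>
  have "\<exists>\<Phi>. \<forall>x. -\<infinity> < ereal x \<longrightarrow> ereal x < \<infinity> \<longrightarrow> (\<Phi> has_vector_derivative fc x) (at x)"
    by (rule einterval_antiderivative) (use cont in \<open>auto simp: continuous_on_eq_continuous_at\<close>)
  then obtain \<Phi> where \<Phi>: "(\<Phi> has_real_derivative fc x) (at x)" for x
    by (auto simp: has_real_derivative_iff_has_vector_derivative)
  define \<eta> where "\<eta> n = 1 / (real n + 1)" for n
  have \<eta>: "\<eta> n > 0" for n by (simp add: \<eta>_def)
  have \<eta>0: "\<eta> \<longlonglongrightarrow> 0" unfolding \<eta>_def by (rule LIMSEQ_inverse_real_of_nat[unfolded inverse_eq_divide of_nat_Suc add.commute[of 1]]) 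
  have \<eta>at: "filterlim \<eta> (at 0) sequentially" using \<eta>0 \<eta> by (auto simp: filterlim_at intro!: always_eventually less_imp_neq[symmetric])
  have quot: "(\<lambda>n. (u (x + \<eta> n) - u x) / \<eta> n) \<longlonglongrightarrow> u'" if "(u has_real_derivative u') (at x)" for u u' and x :: real
    using that unfolding DERIV_def by (rule filterlim_compose[OF _ \<eta>at])
  define D where "D n x = (fc (x + \<eta> n) - fc x) / \<eta> n" for n x
  have D_bound: "\<bar>D n x\<bar> \<le> L" for n x
    using lipc[of "x + \<eta> n" x] \<eta>[of n] by (simp add: D_def abs_divide divide_le_eq)
  have D_lim: "AE x in lborel. (\<lambda>n. indicator {s<..<t} x * D n x) \<longlonglongrightarrow> indicator {s<..<t} x * f' x"
    using deriv
  proof eventually_elim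
    case (elim x)
    show ?case
    proof (cases "x \<in> {s<..<t}")
      case True
      have "eventually (\<lambda>y. y \<in> {s<..<t}) (nhds x)" using True by (intro eventually_nhds_in_open) auto
      then have "eventually (\<lambda>y. f y = fc y) (nhds x)" by eventually_elim (auto simp: fc_def)
      then have "(fc has_real_derivative f' x) (at x)"
        using elim True by (subst DERIV_cong_ev[of x x fc f, OF refl _ refl]) (auto simp: eq_commute)
      then show ?thesis using True unfolding D_def by (auto dest: quot)
    qed auto
  qed
  have D_int: "(LINT x|lborel. indicator {s<..<t} x * D n x)
      = (\<Phi> (t + \<eta> n) - \<Phi> t) / \<eta> n - (\<Phi> (s + \<eta> n) - \<Phi> s) / \<eta> n" for n
  proof -
    have "(LINT x|lborel. indicator {s<..<t} x * D n x) = (LINT x|lborel. indicator {s..t} x *\<^sub>R D n x)"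
    proof (rule integral_cong_AE)
      show "AE x in lborel. indicator {s<..<t} x * D n x = indicator {s..t} x *\<^sub>R D n x"
        using AE_lborel_singleton[of s] AE_lborel_singleton[of t] by eventually_elim (auto simp: indicator_def)
    qed (auto simp: D_def)
    also have "\<dots> = (\<Phi> (t + \<eta> n) - \<Phi> t) / \<eta> n - (\<Phi> (s + \<eta> n) - \<Phi> s) / \<eta> n"
    proof (rule trans[OF integral_FTC_atLeastAtMost[where F = "\<lambda>x. (\<Phi> (x + \<eta> n) - \<Phi> x) / \<eta> n"]])
      show "((\<lambda>x. (\<Phi> (x + \<eta> n) - \<Phi> x) / \<eta> n) has_vector_derivative D n x) (at x within {s..t})" for x
        unfolding has_real_derivative_iff_has_vector_derivative[symmetric] D_def
        by (rule DERIV_subset[OF _ subset_UNIV], intro DERIV_cdivide DERIV_diff \<Phi>)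
           (use \<Phi>[of "x + \<eta> n"] in \<open>simp add: DERIV_shift add.commute\<close>)
      show "continuous_on {s..t} (D n)" unfolding D_def
        by (intro continuous_intros continuous_on_compose2[OF cont]) (use \<eta>[of n] in auto)
    qed (use \<open>s < t\<close> in auto)
    finally show ?thesis .
  qed
  have dom: "integrable lborel (\<lambda>x. L * indicator {s<..<t} x :: real)"
    using \<open>s < t\<close> by (intro integrable_mult_right integrable_real_indicator) auto
  have "integrable lborel (\<lambda>x. indicator {s<..<t} x * f' x)"
    by (rule integrable_dominated_convergence[OF _ _ dom D_lim])
       (use D_bound in \<open>auto simp: D_def indicator_def\<close>)
  moreover have "(\<lambda>n. LINT x|lborel. indicator {s<..<t} x * D n x) \<longlonglongrightarrow> (LINT x|lborel. indicator {s<..<t} x * f' x)"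
    by (rule integral_dominated_convergence[OF _ _ dom D_lim])
       (use D_bound in \<open>auto simp: D_def indicator_def\<close>)
  moreover have "(\<lambda>n. LINT x|lborel. indicator {s<..<t} x * D n x) \<longlonglongrightarrow> fc t - fc s"
    unfolding D_int by (intro tendsto_diff quot \<Phi>)
  ultimately have "(\<integral>\<^sup>+x. ennreal (indicator {s<..<t} x * f' x) \<partial>lborel) = ennreal (fc t - fc s)"
    using nonneg by (subst nn_integral_eq_integral) (auto simp: indicator_def dest: LIMSEQ_unique)
  also have "(\<integral>\<^sup>+x. ennreal (indicator {s<..<t} x * f' x) \<partial>lborel) = (\<integral>\<^sup>+x\<in>{s..t}. ennreal (f' x) \<partial>lborel)"
  proof (rule nn_integral_cong_AE)
    show "AE x in lborel. ennreal (indicator {s<..<t} x * f' x) = ennreal (f' x) * indicator {s..t} x"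
      using AE_lborel_singleton[of s] AE_lborel_singleton[of t] by eventually_elim (auto simp: indicator_def)
  qed
  finally show ?thesis using \<open>s < t\<close> by (simp add: fc_def)
qed

subsection \<open>Primitives of \<open>a\<close> and \<open>b\<close>\<close>

text \<open>Continuity from below of the measure with density \<phi>. It admits an endpoint near
  which the integrand may be unbounded and the primitive has only a limit.\<close>

lemma nn_integral_improper_left:
  fixes A :: "real \<Rightarrow> real" and \<phi> :: "real \<Rightarrow> ennreal"
  assumes [measurable]: "\<phi> \<in> borel_measurable borel" and "c < t"
    and int: "\<And>s. c < s \<Longrightarrow> s < t \<Longrightarrow> (\<integral>\<^sup>+x\<in>{s..t}. \<phi> x \<partial>lborel) = ennreal (A t - A s)"
    and lim: "(A \<longlongrightarrow> l) (at_right c)"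
  shows "(\<integral>\<^sup>+x\<in>{c<..t}. \<phi> x \<partial>lborel) = ennreal (A t - l)"
proof -
  \<comment> \<open>The factor 1/(n + 2) is at most 1/2, which keeps x n strictly between c and t
    from n = 0 on.\<close>
  define x where "x n = c + (t - c) * inverse (real (Suc (Suc n)))" for n
  have inv: "inverse (real (Suc (Suc n))) < 1" for n by (simp add: divide_simps)
  have "0 < (t - c) * inverse (real (Suc (Suc n)))" "(t - c) * inverse (real (Suc (Suc n))) < t - c" for n
    using mult_strict_left_mono[OF inv, of "t - c" n] \<open>c < t\<close> by simp_all
  then have x: "c < x n" "x n < t" for n
    unfolding x_def by (smt (verit))+
  have "x \<longlonglongrightarrow> c + (t - c) * 0"
    unfolding x_def by (intro tendsto_intros LIMSEQ_Suc[OF LIMSEQ_inverse_real_of_nat])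
  then have x_lim: "x \<longlonglongrightarrow> c" by simp
  then have "filterlim x (at_right c) sequentially"
    using x by (auto simp: filterlim_at intro!: always_eventually less_imp_neq[symmetric])
  then have "(\<lambda>n. A (x n)) \<longlonglongrightarrow> l" by (rule filterlim_compose[OF lim])
  then have "(\<lambda>n. ennreal (A t - A (x n))) \<longlonglongrightarrow> ennreal (A t - l)"
    by (intro tendsto_ennrealI tendsto_intros)
  moreover have "(\<lambda>n. emeasure (density lborel \<phi>) {x n..t}) \<longlonglongrightarrow> emeasure (density lborel \<phi>) (\<Union>n. {x n..t})"
  proof (rule Lim_emeasure_incseq)
    have "x n \<le> x m" if "m \<le> n" for m n
      using that \<open>c < t\<close> unfolding x_def by (intro add_left_mono mult_left_mono le_imp_inverse_le) auto
    then show "incseq (\<lambda>n. {x n..t})" by (intro monoI) auto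
  qed auto
  moreover have "(\<Union>n. {x n..t}) = {c<..t}"
  proof (intro equalityI subsetI)
    fix y assume y: "y \<in> {c<..t}"
    then have "\<forall>\<^sub>F n in sequentially. x n < y" using x_lim by (intro order_tendstoD) auto
    then obtain n where "x n < y" by (auto simp: eventually_sequentially)
    then show "y \<in> (\<Union>n. {x n..t})" using y by (auto intro!: exI[of _ n])
  qed (use x in \<open>auto dest: less_le_trans\<close>)
  ultimately show ?thesis using x by (auto simp: emeasure_density int dest: LIMSEQ_unique)
qed

lemma nn_integral_improper_right:
  fixes A :: "real \<Rightarrow> real" and \<phi> :: "real \<Rightarrow> ennreal"
  assumes [measurable]: "\<phi> \<in> borel_measurable borel" and "s < c"
    and int: "\<And>t. s < t \<Longrightarrow> t < c \<Longrightarrow> (\<integral>\<^sup>+x\<in>{s..t}. \<phi> x \<partial>lborel) = ennreal (A t - A s)"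
    and lim: "(A \<longlongrightarrow> l) (at_left c)"
  shows "(\<integral>\<^sup>+x\<in>{s..<c}. \<phi> x \<partial>lborel) = ennreal (l - A s)"
proof -
  define x where "x n = c - (c - s) * inverse (real (Suc (Suc n)))" for n
  have inv: "inverse (real (Suc (Suc n))) < 1" for n by (simp add: divide_simps)
  have "0 < (c - s) * inverse (real (Suc (Suc n)))" "(c - s) * inverse (real (Suc (Suc n))) < c - s" for n
    using mult_strict_left_mono[OF inv, of "c - s" n] \<open>s < c\<close> by simp_all
  then have x: "s < x n" "x n < c" for n
    unfolding x_def by (smt (verit))+
  have "x \<longlonglongrightarrow> c - (c - s) * 0"
    unfolding x_def by (intro tendsto_intros LIMSEQ_Suc[OF LIMSEQ_inverse_real_of_nat])
  then have x_lim: "x \<longlonglongrightarrow> c" by simp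
  then have "filterlim x (at_left c) sequentially"
    using x by (auto simp: filterlim_at intro!: always_eventually less_imp_neq)
  then have "(\<lambda>n. A (x n)) \<longlonglongrightarrow> l" by (rule filterlim_compose[OF lim])
  then have "(\<lambda>n. ennreal (A (x n) - A s)) \<longlonglongrightarrow> ennreal (l - A s)"
    by (intro tendsto_ennrealI tendsto_intros)
  moreover have "(\<lambda>n. emeasure (density lborel \<phi>) {s..x n}) \<longlonglongrightarrow> emeasure (density lborel \<phi>) (\<Union>n. {s..x n})"
  proof (rule Lim_emeasure_incseq)
    have "x m \<le> x n" if "m \<le> n" for m n
      using that \<open>s < c\<close> unfolding x_def by (intro diff_left_mono mult_left_mono le_imp_inverse_le) auto
    then show "incseq (\<lambda>n. {s..x n})" by (intro monoI) auto
  qed auto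
  moreover have "(\<Union>n. {s..x n}) = {s..<c}"
  proof (intro equalityI subsetI)
    fix y assume y: "y \<in> {s..<c}"
    then have "\<forall>\<^sub>F n in sequentially. y < x n" using x_lim by (intro order_tendstoD) auto
    then obtain n where "y < x n" by (auto simp: eventually_sequentially)
    then show "y \<in> (\<Union>n. {s..x n})" using y by (auto intro!: exI[of _ n])
  qed (use x in \<open>auto dest: le_less_trans\<close>)
  ultimately show ?thesis using x by (auto simp: emeasure_density int dest: LIMSEQ_unique)
qed

lemma C1_imp_lipschitz_on:
  fixes f :: "real \<Rightarrow> real"
  assumes "\<And>x. x \<in> {a..b} \<Longrightarrow> (f has_real_derivative f' x) (at x)" "continuous_on {a..b} f'"
  obtains L where "L-lipschitz_on {a..b} f"
proof -
  have "bounded (f' ` {a..b})" using assms(2) by (intro compact_imp_bounded compact_continuous_image) auto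
  then obtain B where B: "B > 0" "\<And>x. x \<in> {a..b} \<Longrightarrow> \<bar>f' x\<bar> \<le> B" by (auto simp: bounded_pos)
  have "B-lipschitz_on {a..b} f"
  proof (rule bounded_derivative_imp_lipschitz)
    show "(f has_derivative (\<lambda>h. f' x * h)) (at x within {a..b})" if "x \<in> {a..b}" for x
      using assms(1)[OF that] by (auto simp: has_field_derivative_def intro: has_derivative_at_withinI)
    show "onorm (\<lambda>h. f' x * h) \<le> B" if "x \<in> {a..b}" for x
      by (rule onorm_le) (use B(2)[OF that] in \<open>auto simp: abs_mult intro!: mult_right_mono\<close>)
  qed (use B in auto)
  then show ?thesis by (rule that)
qed

text \<open>What the construction uses of a diagonal section in \<open>D0 d\<close> that meets the
  identity only at 0 and 1. The function \<open>g\<close> is a representative of \<delta>' that is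
  Borel and bounded at every point, unlike \<open>deriv \<delta>\<close>, which is unspecified where
  \<delta> has no derivative.\<close>

locale diagonal_section =
  fixes d :: nat and \<delta> g :: "real \<Rightarrow> real"
  assumes d: "2 \<le> d"
    and \<delta>_0: "\<delta> 0 = 0" and \<delta>_1: "\<delta> 1 = 1"
    and \<delta>_less: "\<And>t. 0 < t \<Longrightarrow> t < 1 \<Longrightarrow> \<delta> t < t"
    and \<delta>_mono: "\<And>s t. 0 \<le> s \<Longrightarrow> s \<le> t \<Longrightarrow> t \<le> 1 \<Longrightarrow> \<delta> s \<le> \<delta> t"
    and \<delta>_lipschitz: "(real d)-lipschitz_on {0..1} \<delta>"
    and g_measurable [measurable]: "g \<in> borel_measurable borel"
    and g_nonneg: "\<And>x. 0 \<le> g x" and g_le: "\<And>x. g x \<le> real d"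
    and g_integral: "\<And>t. 0 \<le> t \<Longrightarrow> t \<le> 1 \<Longrightarrow> (\<integral>\<^sup>+x\<in>{0..t}. ennreal (g x) \<partial>lborel) = ennreal (\<delta> t)"
    and \<delta>_deriv: "AE x in lborel. x \<in> {0<..<1} \<longrightarrow> (\<delta> has_real_derivative g x) (at x)"
begin

abbreviation "h \<equiv> h_fun \<delta>"
abbreviation "F \<equiv> F_fun d \<delta>"

text \<open>The paper's \<open>a\<close> and \<open>b\<close>, with the measurable version \<open>g\<close> in place of \<open>\<delta>'\<close>.\<close>

definition "a x = (real d - g x) / real d * h x powr (- 1 + 1 / real d) * exp (F x)"
definition "b x = g x / real d * h x powr (- 1 + 1 / real d) * exp (- (real d - 1) * F x)"

section \<open>Elementary properties of h and F\<close>

lemma d_pos: "0 < real d" "1 < real d"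
  using d by auto

lemma h_pos: "0 < x \<Longrightarrow> x < 1 \<Longrightarrow> 0 < h x"
  using \<delta>_less by (simp add: h_fun_def)

lemma h_le: "0 \<le> x \<Longrightarrow> x \<le> 1 \<Longrightarrow> h x \<le> x"
  using \<delta>_mono[of 0 x] \<delta>_0 by (simp add: h_fun_def)

lemma h_lipschitz: "(1 + real d)-lipschitz_on {0..1} h"
  unfolding h_fun_def by (intro lipschitz_intros \<delta>_lipschitz)

lemma h_continuous: "continuous_on {0..1} h"
  by (rule lipschitz_on_continuous_on[OF h_lipschitz])

lemma F_deriv:
  assumes "0 < r" "r < 1"
  shows "(F has_real_derivative (real d - 1) / (real d * h r)) (at r)"
proof -
  \<comment> \<open>[s,t] is a compact part of (0,1) with both r and the base point 1/2 in its
    interior.\<close>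
  define s where "s = min r (1/2) / 2"
  define t where "t = (max r (1/2) + 1) / 2"
  have st: "0 < s" "s < r" "s < 1/2" "r < t" "1/2 < t" "t < 1" using assms by (auto simp: s_def t_def)
  have "continuous_on {s..t} (\<lambda>x. 1 / h x)"
    using st h_pos by (intro continuous_intros continuous_on_subset[OF h_continuous]) (auto simp: less_imp_neq[symmetric])
  then have "((\<lambda>u. LBINT y=ereal (1/2)..ereal u. 1 / h y) has_vector_derivative 1 / h r) (at r within {s..t})"
    using st by (intro interval_integral_FTC2) auto
  then have "((\<lambda>u. LBINT y=ereal (1/2)..ereal u. 1 / h y) has_real_derivative 1 / h r) (at r)"
    using st by (simp add: has_real_derivative_iff_has_vector_derivative at_within_Icc_at)
  from DERIV_cmult[OF this, of "(real d - 1) / real d"] show ?thesis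
    unfolding F_fun_def[abs_def] by (simp add: mult.commute)
qed

lemma F_continuous: "continuous_on {0<..<1} F"
  by (intro continuous_at_imp_continuous_on ballI DERIV_isCont[OF F_deriv]) auto

lemma F_mono: "0 < s \<Longrightarrow> s \<le> t \<Longrightarrow> t < 1 \<Longrightarrow> F s \<le> F t"
  by (rule DERIV_nonneg_imp_nondecreasing) (use F_deriv h_pos d_pos in \<open>force intro!: divide_nonneg_nonneg mult_nonneg_nonneg less_imp_le\<close>)+

lemma F_half: "F (1/2) = 0"
  by (simp add: F_fun_def)

text \<open>This is h^\<alpha> e^(\<beta> F), written as one exponential so that exponents add
  without conditions on h. The A and K of the overview are \<open>E (1 / real d) 1\<close> and
  \<open>E (1 - 1 / real d) (- 1)\<close>.\<close>

definition "E \<alpha> \<beta> x = exp (\<alpha> * ln (h x) + \<beta> * F x)"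

lemma E_pos: "0 < E \<alpha> \<beta> x"
  by (simp add: E_def)

lemma E_mult: "E \<alpha> \<beta> x * E \<alpha>' \<beta>' x = E (\<alpha> + \<alpha>') (\<beta> + \<beta>') x"
  by (simp add: E_def algebra_simps flip: exp_add)

lemma E_power: "E \<alpha> \<beta> x ^ n = E (real n * \<alpha>) (real n * \<beta>) x"
  by (simp add: E_def algebra_simps flip: exp_of_nat_mult)

lemma E_divide_h: "0 < x \<Longrightarrow> x < 1 \<Longrightarrow> E \<alpha> \<beta> x / h x = E (\<alpha> - 1) \<beta> x"
  using h_pos by (simp add: E_def algebra_simps exp_diff)

lemma E_eq_powr: "0 < x \<Longrightarrow> x < 1 \<Longrightarrow> E \<alpha> \<beta> x = h x powr \<alpha> * exp (\<beta> * F x)"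
  using h_pos[of x] by (simp add: E_def powr_def exp_add)

lemma a_eq: "0 < x \<Longrightarrow> x < 1 \<Longrightarrow> a x = (real d - g x) / real d * E (1 / real d - 1) 1 x"
  by (simp add: a_def E_eq_powr)

lemma b_eq: "0 < x \<Longrightarrow> x < 1 \<Longrightarrow> b x = g x / real d * E (1 / real d - 1) (1 - real d) x"
  by (simp add: b_def E_eq_powr algebra_simps)

text \<open>Logarithmic differentiation, with h' = 1 - g and F' = (d - 1)/(d h); the common
  denominator h lowers \<alpha> by 1. The coefficient becomes (d - g)/d for A and -(d - 1) g/d for
  K.\<close>

lemma E_deriv:
  assumes "0 < x" "x < 1" "(\<delta> has_real_derivative g x) (at x)"
  shows "(E \<alpha> \<beta> has_real_derivative (\<alpha> * (1 - g x) + \<beta> * (real d - 1) / real d) * E (\<alpha> - 1) \<beta> x) (at x)"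
proof -
  have h: "(h has_real_derivative 1 - g x) (at x)"
    unfolding h_fun_def[abs_def] by (intro DERIV_diff DERIV_ident assms)
  have "(E \<alpha> \<beta> has_real_derivative E \<alpha> \<beta> x * (\<alpha> * ((1 - g x) / h x) + \<beta> * ((real d - 1) / (real d * h x)))) (at x)"
    unfolding E_def[abs_def]
    by (rule derivative_eq_intros h F_deriv refl assms h_pos | simp add: mult.commute)+
  also have "E \<alpha> \<beta> x * (\<alpha> * ((1 - g x) / h x) + \<beta> * ((real d - 1) / (real d * h x)))
      = (\<alpha> * (1 - g x) + \<beta> * (real d - 1) / real d) * (E \<alpha> \<beta> x / h x)"
  proof -
    have "\<alpha> * ((1 - g x) / h x) + \<beta> * ((real d - 1) / (real d * h x))
        = (\<alpha> * (1 - g x) + \<beta> * (real d - 1) / real d) / h x"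
      by (simp add: add_divide_distrib)
    then show ?thesis by simp
  qed
  finally show ?thesis using assms by (simp add: E_divide_h)
qed

text \<open>On a compact part of (0,1) the function h is bounded away from 0, so ln and exp are
  applied on compact ranges where they are Lipschitz.\<close>

lemma E_lipschitz:
  assumes "0 < s" "t < 1"
  obtains L where "L-lipschitz_on {s..t} (E \<alpha> \<beta>)"
proof (cases "s \<le> t")
  case False
  then show ?thesis using that[of 0] by simp
next
  case True
  have sub: "{s..t} \<subseteq> {0..1}" using assms by auto
  note h_lip = lipschitz_on_subset[OF h_lipschitz sub]
  have h_cont: "continuous_on {s..t} h" by (rule continuous_on_subset[OF h_continuous sub])
  obtain x where x: "x \<in> {s..t}" "\<And>y. y \<in> {s..t} \<Longrightarrow> h x \<le> h y"
    using continuous_attains_inf[OF _ _ h_cont] True by auto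
  have hx: "h x > 0" using x(1) assms by (intro h_pos) auto
  have h_img: "h ` {s..t} \<subseteq> {h x..1}"
  proof (intro image_subsetI)
    fix y assume "y \<in> {s..t}"
    then show "h y \<in> {h x..1}" using x(2)[of y] h_le[of y] assms by auto
  qed
  obtain L1 where L1: "L1-lipschitz_on {h x..1} ln"
    by (rule C1_imp_lipschitz_on[of "h x" 1 ln "\<lambda>y. 1 / y"])
       (use hx in \<open>auto intro!: derivative_eq_intros continuous_intros\<close>)
  have ln_lip: "(L1 * (1 + real d))-lipschitz_on {s..t} (\<lambda>y. ln (h y))"
    by (rule lipschitz_on_compose2[OF h_lip lipschitz_on_subset[OF L1 h_img]])
  obtain L2 where L2: "L2-lipschitz_on {s..t} F"
    by (rule C1_imp_lipschitz_on[of s t F "\<lambda>r. (real d - 1) / (real d * h r)"])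
       (use assms h_pos d_pos in \<open>fastforce intro!: F_deriv continuous_intros h_cont simp: less_imp_neq[symmetric]\<close>)+
  define u where "u y = \<alpha> * ln (h y) + \<beta> * F y" for y
  have u_lip: "(\<bar>\<alpha>\<bar> * (L1 * (1 + real d)) + \<bar>\<beta>\<bar> * L2)-lipschitz_on {s..t} u"
    unfolding u_def by (intro lipschitz_intros ln_lip L2)
  then have "bounded (u ` {s..t})"
    by (intro compact_imp_bounded compact_continuous_image lipschitz_on_continuous_on) auto
  then obtain B where B: "\<forall>y\<in>{s..t}. \<bar>u y\<bar> \<le> B" by (auto simp: bounded_iff)
  obtain L3 where L3: "L3-lipschitz_on {-B..B} (exp :: real \<Rightarrow> real)"
    by (rule C1_imp_lipschitz_on[of "-B" B exp exp]) (auto intro!: derivative_eq_intros continuous_intros)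
  have "u ` {s..t} \<subseteq> {-B..B}" using B by (force simp: abs_le_iff)
  from lipschitz_on_compose2[OF u_lip lipschitz_on_subset[OF L3 this]] show ?thesis
    by (intro that) (simp add: E_def[abs_def] u_def)
qed

lemma h_tendsto_0: "(h \<longlongrightarrow> 0) (at_right 0)" "(h \<longlongrightarrow> 0) (at_left 1)"
proof -
  have "(h \<longlongrightarrow> h 0) (at 0 within {0..1})" "(h \<longlongrightarrow> h 1) (at 1 within {0..1})"
    using h_continuous by (auto simp: continuous_on_def)
  then show "(h \<longlongrightarrow> 0) (at_right 0)" "(h \<longlongrightarrow> 0) (at_left 1)"
    by (simp_all add: h_fun_def \<delta>_0 \<delta>_1 at_within_Icc_at_right at_within_Icc_at_left)
qed

text \<open>F is nonpositive to the left of its base point 1/2, so with \<beta> >= 0 the exponential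
  factor is at most 1 and h^\<alpha> dominates.\<close>

lemma E_tendsto_0_left:
  assumes "0 < \<alpha>" "0 \<le> \<beta>"
  shows "(E \<alpha> \<beta> \<longlongrightarrow> 0) (at_right 0)"
proof (rule tendsto_sandwich[OF _ _ tendsto_const])
  have ev: "\<forall>\<^sub>F x in at_right 0. 0 < x \<and> x < (1/2::real)"
    by (auto simp: eventually_at_right[of 0 1] intro!: exI[of _ "1/2"])
  then show "\<forall>\<^sub>F x in at_right 0. E \<alpha> \<beta> x \<le> h x powr \<alpha>"
  proof eventually_elim
    case (elim x)
    then have "F x \<le> 0" using F_mono[of x "1/2"] F_half by simp
    then show ?case using elim assms
      by (auto simp: E_eq_powr mult_nonneg_nonpos intro!: mult_left_le)
  qed
  show "((\<lambda>x. h x powr \<alpha>) \<longlongrightarrow> 0) (at_right 0)"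
  proof -
    have "((\<lambda>x. h x powr \<alpha>) \<longlongrightarrow> 0 powr \<alpha>) (at_right 0)"
      by (rule tendsto_powr'[OF h_tendsto_0(1) tendsto_const])
         (use ev assms h_pos in \<open>force elim!: eventually_mono intro: less_imp_le\<close>)
    then show ?thesis by simp
  qed
qed (simp add: E_pos less_imp_le)

text \<open>To the right of 1/2 the sign of F is reversed, and so is the sign required of
  \<beta>.\<close>

lemma E_tendsto_0_right:
  assumes "0 < \<alpha>" "\<beta> \<le> 0"
  shows "(E \<alpha> \<beta> \<longlongrightarrow> 0) (at_left 1)"
proof (rule tendsto_sandwich[OF _ _ tendsto_const])
  have ev: "\<forall>\<^sub>F x in at_left 1. (1/2::real) < x \<and> x < 1"
    by (auto simp: eventually_at_left[of 0 1] intro!: exI[of _ "1/2"])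
  then show "\<forall>\<^sub>F x in at_left 1. E \<alpha> \<beta> x \<le> h x powr \<alpha>"
  proof eventually_elim
    case (elim x)
    then have "0 \<le> F x" using F_mono[of "1/2" x] F_half by simp
    then show ?case using elim assms
      by (auto simp: E_eq_powr mult_nonpos_nonneg intro!: mult_left_le)
  qed
  show "((\<lambda>x. h x powr \<alpha>) \<longlongrightarrow> 0) (at_left 1)"
  proof -
    have "((\<lambda>x. h x powr \<alpha>) \<longlongrightarrow> 0 powr \<alpha>) (at_left 1)"
      by (rule tendsto_powr'[OF h_tendsto_0(2) tendsto_const])
         (use ev assms h_pos in \<open>force elim!: eventually_mono intro: less_imp_le\<close>)
    then show ?thesis by simp
  qed
qed (simp add: E_pos less_imp_le)

end

subsection \<open>Integration over the region where a given coordinate is the largest\<close>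

interpretation lborel_product: product_sigma_finite "\<lambda>_::nat. lborel :: real measure"
  by unfold_locales

lemma sets_lebesgue_pow [measurable_cong]: "sets (lebesgue_pow d) = sets (\<Pi>\<^sub>M i\<in>{..<d}. borel)"
  unfolding lebesgue_pow_def by (rule sets_PiM_cong) auto

lemma space_lebesgue_pow: "space (lebesgue_pow d) = extensional {..<d}"
  by (auto simp: lebesgue_pow_def space_PiM PiE_def)

lemma measurable_component_lebesgue_pow:
  "i < d \<Longrightarrow> (\<lambda>x. x i) \<in> borel_measurable (lebesgue_pow d)"
  by (subst measurable_cong_sets[OF sets_lebesgue_pow refl]) (auto intro: measurable_component_singleton)

lemma measurable_lebesgue_pow_compose:
  "i < d \<Longrightarrow> \<phi> \<in> measurable borel N \<Longrightarrow> (\<lambda>x. \<phi> (x i)) \<in> measurable (lebesgue_pow d) N"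
  by (rule measurable_compose[OF measurable_component_lebesgue_pow])

lemma measurable_lebesgue_pow_compose2:
  assumes "i < d" "j < d" "case_prod W \<in> measurable (borel \<Otimes>\<^sub>M borel) N"
  shows "(\<lambda>x. W (x i) (x j)) \<in> measurable (lebesgue_pow d) N"
  using measurable_compose[OF measurable_Pair[OF measurable_component_lebesgue_pow[OF assms(1)]
    measurable_component_lebesgue_pow[OF assms(2)]] assms(3)] by simp

text \<open>With coordinate k outermost in Tonelli's theorem, the remaining integrand is a product
  of functions of single coordinates. The dependence of \<open>w\<close> on the k-th coordinate
  leaves room for the constraint that it be the largest.\<close>

lemma nn_integral_lebesgue_pow_split:
  fixes v :: "real \<Rightarrow> ennreal" and w :: "nat \<Rightarrow> real \<Rightarrow> real \<Rightarrow> ennreal"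
  assumes k: "k < d" and v [measurable]: "v \<in> borel_measurable borel"
    and w: "\<And>i. i < d \<Longrightarrow> i \<noteq> k \<Longrightarrow> case_prod (w i) \<in> borel_measurable (borel \<Otimes>\<^sub>M borel)"
  shows "(\<integral>\<^sup>+x. v (x k) * (\<Prod>i\<in>{..<d} - {k}. w i (x k) (x i)) \<partial>lebesgue_pow d)
       = (\<integral>\<^sup>+m. v m * (\<Prod>i\<in>{..<d} - {k}. \<integral>\<^sup>+y. w i m y \<partial>lborel) \<partial>lborel)"
proof -
  define I where "I = {..<d} - {k}"
  have I: "finite I" "k \<notin> I" "insert k I = {..<d}" using k by (auto simp: I_def)
  have comp: "(\<lambda>x. x i) \<in> borel_measurable (PiM {..<d} (\<lambda>_. lborel :: real measure))" if "i < d" for i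
    using measurable_component_lebesgue_pow[OF that] by (simp add: lebesgue_pow_def)
  have meas: "(\<lambda>x. v (x k) * (\<Prod>i\<in>I. w i (x k) (x i))) \<in> borel_measurable (PiM (insert k I) (\<lambda>_. lborel))"
  proof (intro borel_measurable_times_ennreal borel_measurable_prod_ennreal)
    show "(\<lambda>x. v (x k)) \<in> borel_measurable (PiM (insert k I) (\<lambda>_. lborel))"
      unfolding I(3) by (rule measurable_compose[OF comp[OF k] v])
    fix i assume "i \<in> I"
    then have i: "i < d" "i \<noteq> k" by (auto simp: I_def)
    show "(\<lambda>x. w i (x k) (x i)) \<in> borel_measurable (PiM (insert k I) (\<lambda>_. lborel))"
      unfolding I(3) using measurable_compose[OF measurable_Pair[OF comp[OF k] comp[OF i(1)]] w[OF i]] by simp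
  qed
  have "(\<integral>\<^sup>+x. v (x k) * (\<Prod>i\<in>I. w i (x k) (x i)) \<partial>lebesgue_pow d)
      = (\<integral>\<^sup>+m. \<integral>\<^sup>+x. v ((x(k := m)) k) * (\<Prod>i\<in>I. w i ((x(k := m)) k) ((x(k := m)) i)) \<partial>PiM I (\<lambda>_. lborel) \<partial>lborel)"
    unfolding lebesgue_pow_def I(3)[symmetric]
    by (rule lborel_product.product_nn_integral_insert_rev[OF I(1,2) meas])
  also have "\<dots> = (\<integral>\<^sup>+m. v m * (\<Prod>i\<in>I. \<integral>\<^sup>+y. w i m y \<partial>lborel) \<partial>lborel)"
  proof (rule nn_integral_cong)
    fix m
    have wm: "w i m \<in> borel_measurable lborel" if "i \<in> I" for i
      using measurable_Pair2[OF w[of i], of m] that by (simp add: I_def)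
    have "(\<integral>\<^sup>+x. v ((x(k := m)) k) * (\<Prod>i\<in>I. w i ((x(k := m)) k) ((x(k := m)) i)) \<partial>PiM I (\<lambda>_. lborel))
        = (\<integral>\<^sup>+x. v m * (\<Prod>i\<in>I. w i m (x i)) \<partial>PiM I (\<lambda>_. lborel))"
      using I(2) by (intro nn_integral_cong arg_cong2[where f = "(*)"] prod.cong) auto
    also have "\<dots> = v m * (\<integral>\<^sup>+x. (\<Prod>i\<in>I. w i m (x i)) \<partial>PiM I (\<lambda>_. lborel))"
      by (intro nn_integral_cmult borel_measurable_prod_ennreal measurable_compose[OF _ wm] measurable_component_singleton) auto
    also have "(\<integral>\<^sup>+x. (\<Prod>i\<in>I. w i m (x i)) \<partial>PiM I (\<lambda>_. lborel)) = (\<Prod>i\<in>I. \<integral>\<^sup>+y. w i m y \<partial>lborel)"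
      by (rule lborel_product.product_nn_integral_prod[OF I(1) wm])
    finally show "(\<integral>\<^sup>+x. v ((x(k := m)) k) * (\<Prod>i\<in>I. w i ((x(k := m)) k) ((x(k := m)) i)) \<partial>PiM I (\<lambda>_. lborel))
        = v m * (\<Prod>i\<in>I. \<integral>\<^sup>+y. w i m y \<partial>lborel)" .
  qed
  finally show ?thesis by (simp add: I_def)
qed

section \<open>Null sets in R^d\<close>

lemma AE_lebesgue_pow_component:
  assumes "i < d" and "AE y in lborel. P y"
  shows "AE x in lebesgue_pow d. P (x i)"
proof -
  obtain N where N: "N \<in> null_sets lborel" "\<forall>y. y \<notin> N \<longrightarrow> P y"
    by (rule AE_E3[OF assms(2)]) simp
  have [measurable]: "N \<in> sets borel" using N(1) by auto
  have "(\<integral>\<^sup>+x. indicator N (x i) * (\<Prod>j\<in>{..<d} - {i}. 1) \<partial>lebesgue_pow d)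
      = (\<integral>\<^sup>+m. indicator N m * (\<Prod>j\<in>{..<d} - {i}. \<integral>\<^sup>+y. 1 \<partial>(lborel :: real measure)) \<partial>lborel)"
    by (rule nn_integral_lebesgue_pow_split[OF assms(1), of "indicator N" "\<lambda>_ _ _. 1"]) auto
  \<comment> \<open>The other coordinates contribute a power of the infinite length of the line, but
    0 * \<infinity> = 0 makes the integrand vanish off the null set N.\<close>
  also have "\<dots> = 0"
    using AE_not_in[OF N(1)] by (subst nn_integral_0_iff_AE) (auto elim!: eventually_mono)
  finally have "AE x in lebesgue_pow d. indicator N (x i) = (0 :: ennreal)"
    using assms(1) by (subst (asm) nn_integral_0_iff_AE) (auto intro!: measurable_lebesgue_pow_compose)
  then show ?thesis using N(2) by (auto elim!: eventually_mono simp: indicator_def split: if_splits)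
qed

text \<open>Once x i = m is fixed, the slice in coordinate j is the single point m; its zero length
  annihilates the product, although the other factors are infinite.\<close>

lemma AE_lebesgue_pow_neq:
  assumes "i < d" "j < d" "i \<noteq> j"
  shows "AE x in lebesgue_pow d. x i \<noteq> x j"
proof -
  define w where "w n m y = (if n = j then indicator {m} y else 1 :: ennreal)" for n :: nat and m y :: real
  have w_eq: "(\<lambda>x. w n (fst x) (snd x)) = (\<lambda>x. if n = j \<and> fst x \<noteq> snd x then 0 else 1)" for n
    by (auto simp: w_def)
  have w: "case_prod (w n) \<in> borel_measurable (borel \<Otimes>\<^sub>M borel)" for n
    unfolding case_prod_beta w_eq by measurable
  have "(\<integral>\<^sup>+x. 1 * (\<Prod>n\<in>{..<d} - {i}. w n (x i) (x n)) \<partial>lebesgue_pow d)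
      = (\<integral>\<^sup>+m. 1 * (\<Prod>n\<in>{..<d} - {i}. \<integral>\<^sup>+y. w n m y \<partial>lborel) \<partial>lborel)"
    by (rule nn_integral_lebesgue_pow_split[OF assms(1)]) (auto intro: w)
  also have "\<dots> = (\<integral>\<^sup>+m. 0 \<partial>(lborel :: real measure))"
    using assms by (intro nn_integral_cong) (auto simp: w_def intro!: prod_zero bexI[of _ j])
  finally have "(\<integral>\<^sup>+x. (\<Prod>n\<in>{..<d} - {i}. w n (x i) (x n)) \<partial>lebesgue_pow d) = 0" by simp
  moreover have "(\<lambda>x. \<Prod>n\<in>{..<d} - {i}. w n (x i) (x n)) \<in> borel_measurable (lebesgue_pow d)"
    using assms w by (intro borel_measurable_prod_ennreal measurable_lebesgue_pow_compose2) auto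
  ultimately have "AE x in lebesgue_pow d. (\<Prod>n\<in>{..<d} - {i}. w n (x i) (x n)) = 0"
    by (subst (asm) nn_integral_0_iff_AE) auto
  then show ?thesis
  proof eventually_elim
    case (elim x)
    then show ?case by (auto simp: w_def indicator_def split: if_splits)
  qed
qed

lemma indicator_lessThan_measurable [measurable]:
  "(\<lambda>z. indicator {..<fst z} (snd z) :: ennreal) \<in> borel_measurable (borel \<Otimes>\<^sub>M borel :: (real \<times> real) measure)"
proof -
  have "(\<lambda>z. indicator {..<fst z} (snd z) :: ennreal) = indicator {z :: real \<times> real. snd z < fst z}"
    by (auto simp: indicator_def)
  then show ?thesis by simp
qed

text \<open>Tonelli on the half plane y < m. It serves to bring inside whichever integral has a
  known closed form.\<close>

lemma nn_integral_triangle_swap: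
  fixes f g :: "real \<Rightarrow> ennreal"
  assumes [measurable]: "f \<in> borel_measurable borel" "g \<in> borel_measurable borel"
  shows "(\<integral>\<^sup>+m. f m * (\<integral>\<^sup>+y\<in>{..<m}. g y \<partial>lborel) \<partial>lborel) = (\<integral>\<^sup>+y. g y * (\<integral>\<^sup>+m\<in>{y<..}. f m \<partial>lborel) \<partial>lborel)"
proof -
  have "(\<integral>\<^sup>+m. f m * (\<integral>\<^sup>+y\<in>{..<m}. g y \<partial>lborel) \<partial>lborel) = (\<integral>\<^sup>+m. \<integral>\<^sup>+y. f m * (g y * indicator {..<m} y) \<partial>lborel \<partial>lborel)"
    by (subst nn_integral_cmult) auto
  also have "\<dots> = (\<integral>\<^sup>+y. \<integral>\<^sup>+m. f m * (g y * indicator {..<m} y) \<partial>lborel \<partial>lborel)"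
    by (rule lborel_pair.Fubini'[symmetric]) (unfold case_prod_beta, measurable)
  also have "\<dots> = (\<integral>\<^sup>+y. \<integral>\<^sup>+m. g y * (f m * indicator {y<..} m) \<partial>lborel \<partial>lborel)"
    by (intro nn_integral_cong) (auto simp: indicator_def ac_simps)
  also have "\<dots> = (\<integral>\<^sup>+y. g y * (\<integral>\<^sup>+m\<in>{y<..}. f m \<partial>lborel) \<partial>lborel)"
    by (subst nn_integral_cmult) auto
  finally show ?thesis .
qed

section \<open>The pieces of the density and their integrals\<close>

context diagonal_section
begin

text \<open>Nothing is known about h and F outside (0,1). Cutting off there gives Borel functions on
  the line, and \<open>a0\<close> and \<open>b0\<close> built from them confine integrals over R^d
  to the cube.\<close>

definition "E0 \<alpha> \<beta> x = indicator {0<..<1} x * E \<alpha> \<beta> x"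

lemma E0_measurable [measurable]: "E0 \<alpha> \<beta> \<in> borel_measurable borel"
proof -
  have "continuous_on {0<..<1} (E \<alpha> \<beta>)"
    unfolding E_def[abs_def] using h_pos
    by (intro continuous_intros F_continuous continuous_on_subset[OF h_continuous]) (auto simp: less_imp_neq[symmetric])
  from borel_measurable_continuous_on_indicator[OF _ this] show ?thesis by (simp add: E0_def[abs_def])
qed

lemma E0_nonneg: "0 \<le> E0 \<alpha> \<beta> x"
  by (simp add: E0_def E_pos less_imp_le)

definition "a0 x = (real d - g x) / real d * E0 (1 / real d - 1) 1 x"
definition "b0 x = g x / real d * E0 (1 / real d - 1) (1 - real d) x"

lemma a0_measurable [measurable]: "a0 \<in> borel_measurable borel"
  unfolding a0_def[abs_def] by measurable

lemma b0_measurable [measurable]: "b0 \<in> borel_measurable borel"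
  unfolding b0_def[abs_def] by measurable

lemma a0_nonneg: "0 \<le> a0 x" and b0_nonneg: "0 \<le> b0 x"
  using g_nonneg g_le E0_nonneg d_pos by (simp_all add: a0_def b0_def)

lemma a0_eq: "a0 x = indicator {0<..<1} x * a x" and b0_eq: "b0 x = indicator {0<..<1} x * b x"
  by (auto simp: a0_def b0_def a_eq b_eq E0_def indicator_def)

lemma nn_integral_a0:
  assumes t: "0 < t" "t < 1"
  shows "(\<integral>\<^sup>+x\<in>{..<t}. ennreal (a0 x) \<partial>lborel) = ennreal (E (1 / real d) 1 t)"
proof -
  have "(\<integral>\<^sup>+x\<in>{s..t}. ennreal (a0 x) \<partial>lborel) = ennreal (E (1 / real d) 1 t - E (1 / real d) 1 s)"
    if s: "0 < s" "s < t" for s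
  proof -
    obtain L where L: "L-lipschitz_on {s..t} (E (1 / real d) 1)" using E_lipschitz[OF s(1) t(2)] .
    show ?thesis
    proof (rule nn_integral_FTC_lipschitz[OF s(2) L])
      show "AE x in lborel. x \<in> {s<..<t} \<longrightarrow> (E (1 / real d) 1 has_real_derivative a0 x) (at x)"
        using \<delta>_deriv
      proof eventually_elim
        case (elim x)
        show ?case
        proof
          assume x: "x \<in> {s<..<t}"
          then have "(E (1 / real d) 1 has_real_derivative
              (1 / real d * (1 - g x) + 1 * (real d - 1) / real d) * E (1 / real d - 1) 1 x) (at x)"
            using elim s t by (intro E_deriv) auto
          also have "(1 / real d * (1 - g x) + 1 * (real d - 1) / real d) * E (1 / real d - 1) 1 x = a0 x"
            using x s t d_pos by (simp add: a0_def E0_def add_divide_distrib[symmetric])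
          finally show "(E (1 / real d) 1 has_real_derivative a0 x) (at x)" .
        qed
      qed
    qed (auto simp: a0_nonneg)
  qed
  then have "(\<integral>\<^sup>+x\<in>{0<..t}. ennreal (a0 x) \<partial>lborel) = ennreal (E (1 / real d) 1 t - 0)"
    using t d_pos by (intro nn_integral_improper_left E_tendsto_0_left) auto
  also have "(\<integral>\<^sup>+x\<in>{0<..t}. ennreal (a0 x) \<partial>lborel) = (\<integral>\<^sup>+x\<in>{..<t}. ennreal (a0 x) \<partial>lborel)"
    using AE_lborel_singleton[of t]
    by (intro nn_integral_cong_AE) (auto elim!: eventually_mono simp: indicator_def a0_eq)
  finally show ?thesis by simp
qed

lemma b0_E_power: "b0 m * E (1 / real d) 1 m ^ (d - 1) = indicator {0<..<1} m * (g m / real d)"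
proof -
  have "E (1 / real d - 1) (1 - real d) m * E (1 / real d) 1 m ^ (d - 1) = E 0 0 m"
    using d by (simp add: E_power E_mult of_nat_diff diff_divide_distrib)
  also have "\<dots> = 1" by (simp add: E_def)
  finally show ?thesis by (simp add: b0_def E0_def)
qed

text \<open>The exponent d - 2 counts the coordinates that remain when the largest one and one more
  are singled out.\<close>

lemma b0_E_power':
  "b0 m * E (1 / real d) 1 m ^ (d - 2) = g m / real d * E0 (- 1 / real d) (- 1) m"
proof -
  have "E (1 / real d - 1) (1 - real d) m * E (1 / real d) 1 m ^ (d - 2) = E (- 1 / real d) (- 1) m"
    using d by (simp add: E_power E_mult of_nat_diff diff_divide_distrib)
  then show ?thesis by (simp add: b0_def E0_def)
qed

lemma nn_integral_b0_E_power:
  assumes s: "0 < s" "s < 1"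
  shows "(\<integral>\<^sup>+m\<in>{s<..}. ennreal (b0 m * E (1 / real d) 1 m ^ (d - 2)) \<partial>lborel)
       = ennreal (E (1 - 1 / real d) (- 1) s / (real d - 1))"
proof -
  define B where "B m = g m / real d * E0 (- 1 / real d) (- 1) m" for m
  have [measurable]: "B \<in> borel_measurable borel" unfolding B_def[abs_def] by measurable
  have cancel: "- 1 / c * (- c * u) = u" if "c \<noteq> 0" for c u :: real
    using that by simp
  \<comment> \<open>\<open>E (1 - 1 / real d) (- 1)\<close> has derivative -(d - 1) B almost
    everywhere and tends to 0 at 1; hence the sign and the divisor.\<close>
  define K where "K x = - 1 / (real d - 1) * E (1 - 1 / real d) (- 1) x" for x
  have "(\<integral>\<^sup>+x\<in>{s..t}. ennreal (B x) \<partial>lborel) = ennreal (K t - K s)"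
    if t: "s < t" "t < 1" for t
  proof -
    obtain L where L: "L-lipschitz_on {s..t} (E (1 - 1 / real d) (- 1))" using E_lipschitz[OF s(1) t(2)] .
    then have L: "(\<bar>- 1 / (real d - 1)\<bar> * L)-lipschitz_on {s..t} K"
      unfolding K_def by (intro lipschitz_intros)
    show ?thesis
    proof (rule nn_integral_FTC_lipschitz[OF t(1) L])
      show "AE x in lborel. x \<in> {s<..<t} \<longrightarrow> (K has_real_derivative B x) (at x)"
        using \<delta>_deriv
      proof eventually_elim
        case (elim x)
        show ?case
        proof
          assume x: "x \<in> {s<..<t}"
          then have "(E (1 - 1 / real d) (- 1) has_real_derivative
              ((1 - 1 / real d) * (1 - g x) + (- 1) * (real d - 1) / real d) * E (1 - 1 / real d - 1) (- 1) x) (at x)"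
            using elim s t by (intro E_deriv) auto
          then have "(K has_real_derivative - 1 / (real d - 1) *
              (((1 - 1 / real d) * (1 - g x) + (- 1) * (real d - 1) / real d) * E (1 - 1 / real d - 1) (- 1) x)) (at x)"
            unfolding K_def[abs_def] by (rule DERIV_cmult)
          also have "(1 - 1 / real d) * (1 - g x) + (- 1) * (real d - 1) / real d = - (real d - 1) * (g x / real d)"
            using d_pos by (simp add: field_simps)
          also have "- 1 / (real d - 1) * (- (real d - 1) * (g x / real d) * E (1 - 1 / real d - 1) (- 1) x)
              = g x / real d * E (1 - 1 / real d - 1) (- 1) x"
            using cancel[of "real d - 1" "g x / real d * E (1 - 1 / real d - 1) (- 1) x"] d_pos
            unfolding mult.assoc by simp
          also have "\<dots> = B x"
            using x s t by (simp add: B_def E0_def)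
          finally show "(K has_real_derivative B x) (at x)" .
        qed
      qed
      show "0 \<le> B x" for x using g_nonneg E0_nonneg d_pos by (simp add: B_def)
    qed auto
  qed
  moreover have "(K \<longlongrightarrow> - 1 / (real d - 1) * 0) (at_left 1)"
    unfolding K_def using d_pos by (intro tendsto_intros E_tendsto_0_right) auto
  ultimately have "(\<integral>\<^sup>+x\<in>{s..<1}. ennreal (B x) \<partial>lborel) = ennreal (0 - K s)"
    using s by (intro nn_integral_improper_right) auto
  also have "(\<integral>\<^sup>+x\<in>{s..<1}. ennreal (B x) \<partial>lborel) = (\<integral>\<^sup>+x\<in>{s<..}. ennreal (B x) \<partial>lborel)"
    using AE_lborel_singleton[of s]
    by (intro nn_integral_cong_AE) (auto elim!: eventually_mono simp: indicator_def B_def E0_def)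
  finally show ?thesis by (simp add: b0_E_power' B_def K_def)
qed

text \<open>This is c_\<delta> restricted to the points where coordinate k is strictly the largest.
  The constraint is distributed over the factors so that the integral splits; ties form a null set,
  so the sum \<open>dens\<close> over k recovers c_\<delta> almost everywhere.\<close>

definition "dens_at k x = ennreal (b0 (x k)) * (\<Prod>i\<in>{..<d} - {k}. ennreal (a0 (x i)) * indicator {..<x k} (x i))"
definition "dens x = (\<Sum>k<d. dens_at k x)"

lemma dens_at_measurable [measurable]:
  assumes "k < d"
  shows "dens_at k \<in> borel_measurable (lebesgue_pow d)"
  unfolding dens_at_def[abs_def]
proof (rule borel_measurable_times_ennreal[OF _ borel_measurable_prod_ennreal])
  show "(\<lambda>x. ennreal (b0 (x k))) \<in> borel_measurable (lebesgue_pow d)"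
    using assms by (intro measurable_lebesgue_pow_compose) auto
  fix i assume "i \<in> {..<d} - {k}"
  then show "(\<lambda>x. ennreal (a0 (x i)) * indicator {..<x k} (x i)) \<in> borel_measurable (lebesgue_pow d)"
    using assms
    by (intro measurable_lebesgue_pow_compose2[of k d i "\<lambda>m y. ennreal (a0 y) * indicator {..<m} y"])
       (auto simp: case_prod_beta)
qed

lemma dens_measurable [measurable]: "dens \<in> borel_measurable (lebesgue_pow d)"
  unfolding dens_def[abs_def] by measurable

lemma nn_integral_dens_at:
  fixes v :: "real \<Rightarrow> ennreal" and w :: "nat \<Rightarrow> real \<Rightarrow> real \<Rightarrow> ennreal"
  assumes k: "k < d" and v [measurable]: "v \<in> borel_measurable borel"
    and w [measurable]: "\<And>i. i < d \<Longrightarrow> i \<noteq> k \<Longrightarrow> case_prod (w i) \<in> borel_measurable (borel \<Otimes>\<^sub>M borel)"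
  shows "(\<integral>\<^sup>+x. dens_at k x * (v (x k) * (\<Prod>i\<in>{..<d} - {k}. w i (x k) (x i))) \<partial>lebesgue_pow d)
       = (\<integral>\<^sup>+m. ennreal (b0 m) * v m * (\<Prod>i\<in>{..<d} - {k}. \<integral>\<^sup>+y\<in>{..<m}. ennreal (a0 y) * w i m y \<partial>lborel) \<partial>lborel)"
proof -
  have "(\<integral>\<^sup>+x. dens_at k x * (v (x k) * (\<Prod>i\<in>{..<d} - {k}. w i (x k) (x i))) \<partial>lebesgue_pow d)
      = (\<integral>\<^sup>+x. (ennreal (b0 (x k)) * v (x k))
           * (\<Prod>i\<in>{..<d} - {k}. ennreal (a0 (x i)) * w i (x k) (x i) * indicator {..<x k} (x i)) \<partial>lebesgue_pow d)"
    unfolding dens_at_def by (intro nn_integral_cong) (simp add: prod.distrib ac_simps)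
  also have "\<dots> = (\<integral>\<^sup>+m. ennreal (b0 m) * v m * (\<Prod>i\<in>{..<d} - {k}. \<integral>\<^sup>+y\<in>{..<m}. ennreal (a0 y) * w i m y \<partial>lborel) \<partial>lborel)"
  proof (rule nn_integral_lebesgue_pow_split[OF k])
    fix i assume i: "i < d" "i \<noteq> k"
    note [measurable] = w[OF i]
    show "(\<lambda>(m, y). ennreal (a0 y) * w i m y * indicator {..<m} y) \<in> borel_measurable (borel \<Otimes>\<^sub>M borel)"
      unfolding case_prod_beta by measurable
  qed measurable
  finally show ?thesis .
qed

text \<open>Each of the d - 1 smaller coordinates integrates to A(m), and b A^(d-1) = g/d.\<close>

lemma nn_integral_dens_at_max:
  assumes k: "k < d" and [measurable]: "v \<in> borel_measurable borel"
  shows "(\<integral>\<^sup>+x. dens_at k x * v (x k) \<partial>lebesgue_pow d) = (\<integral>\<^sup>+m\<in>{0<..<1}. v m * ennreal (g m / real d) \<partial>lborel)"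
proof -
  have "(\<integral>\<^sup>+x. dens_at k x * v (x k) \<partial>lebesgue_pow d)
      = (\<integral>\<^sup>+m. ennreal (b0 m) * v m * (\<Prod>i\<in>{..<d} - {k}. \<integral>\<^sup>+y\<in>{..<m}. ennreal (a0 y) \<partial>lborel) \<partial>lborel)"
    using nn_integral_dens_at[OF k, of v "\<lambda>_ _ _. 1"] by simp
  also have "\<dots> = (\<integral>\<^sup>+m\<in>{0<..<1}. v m * ennreal (g m / real d) \<partial>lborel)"
  proof (rule nn_integral_cong)
    fix m
    show "ennreal (b0 m) * v m * (\<Prod>i\<in>{..<d} - {k}. \<integral>\<^sup>+y\<in>{..<m}. ennreal (a0 y) \<partial>lborel)
        = v m * ennreal (g m / real d) * indicator {0<..<1} m"
    proof (cases "m \<in> {0<..<1}")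
      case True
      then have "ennreal (b0 m) * (\<Prod>i\<in>{..<d} - {k}. \<integral>\<^sup>+y\<in>{..<m}. ennreal (a0 y) \<partial>lborel)
          = ennreal (b0 m * E (1 / real d) 1 m ^ (d - 1))"
        using k by (simp add: nn_integral_a0 ennreal_mult b0_nonneg ennreal_power E_pos less_imp_le card_Diff_singleton)
      then show ?thesis using True b0_E_power[of m] by (simp add: ac_simps)
    qed (simp add: b0_eq)
  qed
  finally show ?thesis .
qed

text \<open>One coordinate besides the maximum is enough: the margins and the differences F(max) -
  F(x j) involve no more. The other d - 2 coordinates integrate to A(m) each.\<close>

lemma nn_integral_dens_at_other:
  assumes k: "k < d" and j: "j < d" "j \<noteq> k" and W [measurable]: "case_prod W \<in> borel_measurable (borel \<Otimes>\<^sub>M borel)"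
  shows "(\<integral>\<^sup>+x. dens_at k x * W (x k) (x j) \<partial>lebesgue_pow d)
       = (\<integral>\<^sup>+m. ennreal (b0 m * E (1 / real d) 1 m ^ (d - 2)) * (\<integral>\<^sup>+y\<in>{..<m}. ennreal (a0 y) * W m y \<partial>lborel) \<partial>lborel)"
proof -
  define w where "w i = (if i = j then W else (\<lambda>_ _. 1))" for i
  have w: "case_prod (w i) \<in> borel_measurable (borel \<Otimes>\<^sub>M borel)" for i
    by (cases "i = j") (simp_all add: w_def)
  \<comment> \<open>The functional \<open>u\<close> is arbitrary because the same factor is pulled
    out of the product of integrands here and out of the product of integrals below.\<close>
  have w_prod: "(\<Prod>i\<in>{..<d} - {k}. u i (w i)) = u j W * (\<Prod>i\<in>{..<d} - {k} - {j}. u i (\<lambda>_ _. 1))" for u :: "nat \<Rightarrow> _ \<Rightarrow> ennreal"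
    using j by (subst prod.remove[of _ j]) (auto simp: w_def)
  have "(\<integral>\<^sup>+x. dens_at k x * W (x k) (x j) \<partial>lebesgue_pow d)
      = (\<integral>\<^sup>+x. dens_at k x * (1 * (\<Prod>i\<in>{..<d} - {k}. w i (x k) (x i))) \<partial>lebesgue_pow d)"
    by (simp add: w_prod[of "\<lambda>i w. w (_ k) (_ i)"])
  also have "\<dots> = (\<integral>\<^sup>+m. ennreal (b0 m) * 1 * (\<Prod>i\<in>{..<d} - {k}. \<integral>\<^sup>+y\<in>{..<m}. ennreal (a0 y) * w i m y \<partial>lborel) \<partial>lborel)"
    by (rule nn_integral_dens_at[OF k]) (auto intro: w)
  also have "\<dots> = (\<integral>\<^sup>+m. ennreal (b0 m * E (1 / real d) 1 m ^ (d - 2)) * (\<integral>\<^sup>+y\<in>{..<m}. ennreal (a0 y) * W m y \<partial>lborel) \<partial>lborel)"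
  proof (rule nn_integral_cong)
    fix m
    have card: "card ({..<d} - {k} - {j}) = d - 2"
      using k j by (simp add: card_Diff_singleton)
    show "ennreal (b0 m) * 1 * (\<Prod>i\<in>{..<d} - {k}. \<integral>\<^sup>+y\<in>{..<m}. ennreal (a0 y) * w i m y \<partial>lborel)
        = ennreal (b0 m * E (1 / real d) 1 m ^ (d - 2)) * (\<integral>\<^sup>+y\<in>{..<m}. ennreal (a0 y) * W m y \<partial>lborel)"
    proof (cases "m \<in> {0<..<1}")
      case True
      then show ?thesis
        unfolding w_prod[of "\<lambda>i w. \<integral>\<^sup>+y\<in>{..<m}. ennreal (a0 y) * w m y \<partial>lborel"]
        by (simp add: nn_integral_a0 ennreal_mult b0_nonneg ennreal_power E_pos less_imp_le card) (simp add: ac_simps)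
    qed (simp add: b0_eq)
  qed
  finally show ?thesis .
qed

end

subsection \<open>The copula\<close>

text \<open>A half space x i <= c is the union of the lower boxes with bound c in direction i and
  bound n in the other directions, so lower boxes already make all coordinates measurable.\<close>

lemma sets_lebesgue_pow_lower_boxes:
  "sets (lebesgue_pow d) = sigma_sets (extensional {..<d}) (range (\<lambda>u. \<Pi>\<^sub>E i\<in>{..<d}. {..u i}))"
    (is "_ = sigma_sets ?\<Omega> ?E")
proof
  have E: "?E \<subseteq> Pow ?\<Omega>" by (auto simp: PiE_def)
  have *: "sets (sigma ?\<Omega> ?E) = sigma_sets ?\<Omega> ?E" "space (sigma ?\<Omega> ?E) = ?\<Omega>" using E by simp_all
  show "sigma_sets ?\<Omega> ?E \<subseteq> sets (lebesgue_pow d)"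
    unfolding space_lebesgue_pow[symmetric]
    by (rule sets.sigma_sets_subset) (auto simp: lebesgue_pow_def intro!: sets_PiM_I_finite)
  show "sets (lebesgue_pow d) \<subseteq> sigma_sets ?\<Omega> ?E"
    unfolding *(1)[symmetric] lebesgue_pow_def
  proof (rule sets_PiM_in_sets)
    show "space (sigma ?\<Omega> ?E) = (\<Pi>\<^sub>E i\<in>{..<d}. space lborel)" by (simp only: *(2)) (auto simp: PiE_def)
    fix i A assume i: "i \<in> {..<d}" and A: "A \<in> sets (lborel :: real measure)"
    have "(\<lambda>x. x i) \<in> borel_measurable (sigma ?\<Omega> ?E)"
      unfolding borel_measurable_iff_le
    proof
      fix c
      have "{x \<in> space (sigma ?\<Omega> ?E). x i \<le> c} = (\<Union>n. \<Pi>\<^sub>E j\<in>{..<d}. {..(if j = i then c else real n)})" (is "_ = ?R")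
      proof (intro equalityI subsetI)
        fix x assume "x \<in> {x \<in> space (sigma ?\<Omega> ?E). x i \<le> c}"
        then have x: "x \<in> ?\<Omega>" "x i \<le> c" by (simp_all add: *(2))
        obtain n where n: "Max (insert 0 (x ` {..<d})) \<le> real n" using real_arch_simple by blast
        have "x j \<le> real n" if "j < d" for j
          using that by (intro order_trans[OF Max_ge n]) auto
        then have "x \<in> (\<Pi>\<^sub>E j\<in>{..<d}. {..(if j = i then c else real n)})" using x by (auto simp: PiE_def)
        then show "x \<in> ?R" by blast
      next
        fix x assume "x \<in> ?R"
        then obtain n where n: "x \<in> (\<Pi>\<^sub>E j\<in>{..<d}. {..(if j = i then c else real n)})" by blast
        from PiE_mem[OF n i] have "x i \<le> c" by simp
        moreover have "x \<in> ?\<Omega>" using n by (simp add: PiE_def)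
        ultimately show "x \<in> {x \<in> space (sigma ?\<Omega> ?E). x i \<le> c}" unfolding *(2) by simp
      qed
      also have "\<dots> \<in> sets (sigma ?\<Omega> ?E)"
        unfolding *(1) by (rule sigma_sets.Union, rule sigma_sets.Basic, rule range_eqI, rule refl)
      finally show "{x \<in> space (sigma ?\<Omega> ?E). x i \<le> c} \<in> sets (sigma ?\<Omega> ?E)" .
    qed
    then have "(\<lambda>x. x i) -` A \<inter> space (sigma ?\<Omega> ?E) \<in> sets (sigma ?\<Omega> ?E)"
      by (rule measurable_sets) (use A in simp)
    moreover have "(\<lambda>x. x i) -` A \<inter> space (sigma ?\<Omega> ?E) = {x \<in> space (sigma ?\<Omega> ?E). x i \<in> A}"
      by blast
    ultimately show "{x \<in> space (sigma ?\<Omega> ?E). x i \<in> A} \<in> sets (sigma ?\<Omega> ?E)"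
      by (simp only:)
  qed
qed

text \<open>Lower boxes are closed under intersection, generate the sigma-algebra and exhaust the
  space, so a finite law is determined by its distribution function.\<close>

lemma measure_eqI_lebesgue_pow:
  assumes sets: "sets P = sets (lebesgue_pow d)" "sets Q = sets (lebesgue_pow d)"
    and "finite_measure P"
    and eq: "\<And>u. emeasure P (\<Pi>\<^sub>E i\<in>{..<d}. {..u i}) = emeasure Q (\<Pi>\<^sub>E i\<in>{..<d}. {..u i})"
  shows "P = Q"
proof (rule measure_eqI_generator_eq[where \<Omega> = "extensional {..<d}" and E = "range (\<lambda>u. \<Pi>\<^sub>E i\<in>{..<d}. {..u i})"
    and A = "\<lambda>n. \<Pi>\<^sub>E i\<in>{..<d}. {..real n}"])
  show "Int_stable (range (\<lambda>u. \<Pi>\<^sub>E i\<in>{..<d}. {..u i :: real}))"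
  proof (rule Int_stableI, clarify)
    fix u v :: "nat \<Rightarrow> real"
    have "(\<Pi>\<^sub>E i\<in>{..<d}. {..u i}) \<inter> (\<Pi>\<^sub>E i\<in>{..<d}. {..v i}) = (\<Pi>\<^sub>E i\<in>{..<d}. {..min (u i) (v i)})"
      by (auto simp: PiE_def Pi_def)
    then show "(\<Pi>\<^sub>E i\<in>{..<d}. {..u i}) \<inter> (\<Pi>\<^sub>E i\<in>{..<d}. {..v i}) \<in> range (\<lambda>u. \<Pi>\<^sub>E i\<in>{..<d}. {..u i})" by auto
  qed
  show "(\<Union>n. \<Pi>\<^sub>E i\<in>{..<d}. {..real n}) = extensional {..<d}"
  proof (intro equalityI subsetI)
    fix x :: "nat \<Rightarrow> real" assume x: "x \<in> extensional {..<d}"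
    obtain n where n: "Max (insert 0 (x ` {..<d})) \<le> real n" using real_arch_simple by blast
    have "x j \<le> real n" if "j < d" for j
      using that by (intro order_trans[OF Max_ge n]) auto
    then have "x \<in> (\<Pi>\<^sub>E i\<in>{..<d}. {..real n})" using x by (auto simp: PiE_def)
    then show "x \<in> (\<Union>n. \<Pi>\<^sub>E i\<in>{..<d}. {..real n})" by blast
  qed (auto simp: PiE_def)
  show "emeasure P (\<Pi>\<^sub>E i\<in>{..<d}. {..real n}) \<noteq> \<infinity>" for n
    using finite_measure.emeasure_finite[OF \<open>finite_measure P\<close>] by simp
qed (use sets sets_lebesgue_pow_lower_boxes eq in \<open>auto simp: PiE_def\<close>)

lemma represents_copula_measurable:
  assumes "represents_copula d M U C"
  shows "(\<lambda>\<omega>. \<lambda>i\<in>{..<d}. U i \<omega>) \<in> measurable M (lebesgue_pow d)"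
  unfolding lebesgue_pow_def using assms
  by (intro measurable_restrict) (auto simp: represents_copula_def)

text \<open>A copula is specified only on the cube. Uniform margins make a box with a negative bound
  null and allow bounds above 1 to be lowered to 1, so these values fix the law on all of
  R^d.\<close>

lemma represents_copula_emeasure_box:
  assumes "represents_copula d M U C"
  shows "emeasure (distr M (lebesgue_pow d) (\<lambda>\<omega>. \<lambda>i\<in>{..<d}. U i \<omega>)) (\<Pi>\<^sub>E i\<in>{..<d}. {..u i})
     = (if \<exists>i<d. u i < 0 then 0 else ennreal (C (\<lambda>i\<in>{..<d}. min 1 (u i))))"
proof -
  interpret prob_space M using assms by (simp add: represents_copula_def)
  have U [measurable]: "U i \<in> borel_measurable M"
    and unif: "distr M lborel (U i) = uniform_measure lborel {0..1}" if "i < d" for i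
    using assms that by (auto simp: represents_copula_def)
  have AE_unit: "AE \<omega> in M. U i \<omega> \<in> {0..1}" if "i < d" for i
  proof -
    have "AE x in distr M lborel (U i). x \<in> {0..1}"
      unfolding unif[OF that] by (rule AE_uniform_measureI) auto
    then show ?thesis using U[OF that] by (subst (asm) AE_distr_iff) auto
  qed
  have box: "(\<Pi>\<^sub>E i\<in>{..<d}. {..u i}) \<in> sets (lebesgue_pow d)"
    by (auto simp: lebesgue_pow_def intro!: sets_PiM_I_finite)
  have "emeasure (distr M (lebesgue_pow d) (\<lambda>\<omega>. \<lambda>i\<in>{..<d}. U i \<omega>)) (\<Pi>\<^sub>E i\<in>{..<d}. {..u i})
      = emeasure M {\<omega> \<in> space M. \<forall>i<d. U i \<omega> \<le> u i}"
    unfolding emeasure_distr[OF represents_copula_measurable[OF assms] box]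
    by (rule arg_cong[where f = "emeasure M"]) (auto simp: set_eq_iff restrict_PiE_iff Pi_iff)
  also have "\<dots> = (if \<exists>i<d. u i < 0 then 0 else ennreal (C (\<lambda>i\<in>{..<d}. min 1 (u i))))"
  proof (cases "\<exists>i<d. u i < 0")
    case True
    then obtain i where i: "i < d" "u i < 0" by auto
    have "emeasure M {\<omega> \<in> space M. \<forall>i<d. U i \<omega> \<le> u i} = emeasure M {}"
      using AE_unit[OF i(1)] i by (intro emeasure_eq_AE) (auto elim!: eventually_mono)
    then show ?thesis using True by simp
  next
    case False
    have "AE \<omega> in M. \<forall>i\<in>{..<d}. U i \<omega> \<in> {0..1}"
      using AE_unit by (intro AE_finite_allI) auto
    then have "emeasure M {\<omega> \<in> space M. \<forall>i<d. U i \<omega> \<le> u i} = emeasure M {\<omega> \<in> space M. \<forall>i<d. U i \<omega> \<le> (\<lambda>i\<in>{..<d}. min 1 (u i)) i}"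
      by (intro emeasure_eq_AE) (auto elim!: eventually_mono)
    also have "\<dots> = ennreal (C (\<lambda>i\<in>{..<d}. min 1 (u i)))"
    proof -
      have "(\<lambda>i\<in>{..<d}. min 1 (u i)) \<in> unit_cube d"
        using False not_less by (auto simp: unit_cube_def)
      then show ?thesis using assms unfolding represents_copula_def by (simp only: emeasure_eq_measure)
    qed
    finally show ?thesis by (simp only: False if_False)
  qed
  finally show ?thesis .
qed

text \<open>The two representing vectors may live on different spaces, but C determines their common
  law. This is what makes the choice of a density in \<open>copula_info\<close> harmless.\<close>

lemma copula_density_unique:
  assumes "copula_density d C c" "copula_density d C c'"
  shows "AE x in lebesgue_pow d. x \<in> unit_cube d \<longrightarrow> c x = c' x"
proof -
  obtain M :: "(nat \<Rightarrow> real) measure" and U f where 1: "represents_copula d M U C"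
      "distributed M (lebesgue_pow d) (\<lambda>\<omega>. \<lambda>i\<in>{..<d}. U i \<omega>) f"
      "AE x in lebesgue_pow d. x \<in> unit_cube d \<longrightarrow> 0 \<le> c x \<and> f x = ennreal (c x)"
    using assms(1) unfolding copula_density_def by blast
  obtain M' :: "(nat \<Rightarrow> real) measure" and U' f' where 2: "represents_copula d M' U' C"
      "distributed M' (lebesgue_pow d) (\<lambda>\<omega>. \<lambda>i\<in>{..<d}. U' i \<omega>) f'"
      "AE x in lebesgue_pow d. x \<in> unit_cube d \<longrightarrow> 0 \<le> c' x \<and> f' x = ennreal (c' x)"
    using assms(2) unfolding copula_density_def by blast
  interpret M: prob_space M using 1(1) by (simp add: represents_copula_def)
  have "distr M (lebesgue_pow d) (\<lambda>\<omega>. \<lambda>i\<in>{..<d}. U i \<omega>)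
      = distr M' (lebesgue_pow d) (\<lambda>\<omega>. \<lambda>i\<in>{..<d}. U' i \<omega>)"
    by (rule measure_eqI_lebesgue_pow[of _ d])
       (use 1 2 in \<open>auto simp: represents_copula_emeasure_box
         intro!: M.finite_measure_distr represents_copula_measurable\<close>)
  then have "density (lebesgue_pow d) f = density (lebesgue_pow d) f'"
    using 1(2) 2(2) by (simp add: distributed_def)
  moreover have "sigma_finite_measure (lebesgue_pow d)"
    unfolding lebesgue_pow_def by (rule lborel_product.sigma_finite) simp
  ultimately have "AE x in lebesgue_pow d. f x = f' x"
    using 1(2) 2(2) by (intro sigma_finite_measure.density_unique) (auto simp: distributed_def)
  then show ?thesis using 1(3) 2(3) by eventually_elim auto
qed

section \<open>Uniform margins, symmetry and diagonal section\<close>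

context diagonal_section
begin

text \<open>After the swap, the integral over all maxima above y is K(y)/(d - 1), and a(y) K(y) = (d
  - g(y))/d because the exponents of h and of e^F cancel.\<close>

lemma nn_integral_dens_at_component:
  assumes k: "k < d" and j: "j < d" "j \<noteq> k" and [measurable]: "\<phi> \<in> borel_measurable borel"
  shows "(\<integral>\<^sup>+x. dens_at k x * \<phi> (x j) \<partial>lebesgue_pow d)
       = (\<integral>\<^sup>+y\<in>{0<..<1}. \<phi> y * ennreal ((real d - g y) / (real d * (real d - 1))) \<partial>lborel)"
proof -
  define B where "B m = ennreal (b0 m * E (1 / real d) 1 m ^ (d - 2))" for m
  have [measurable]: "B \<in> borel_measurable borel" unfolding B_def[abs_def] b0_E_power' by measurable
  have "(\<integral>\<^sup>+x. dens_at k x * \<phi> (x j) \<partial>lebesgue_pow d)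
      = (\<integral>\<^sup>+m. B m * (\<integral>\<^sup>+y\<in>{..<m}. ennreal (a0 y) * \<phi> y \<partial>lborel) \<partial>lborel)"
    unfolding B_def by (rule nn_integral_dens_at_other[OF k j, of "\<lambda>_. \<phi>"]) (simp add: case_prod_beta)
  also have "\<dots> = (\<integral>\<^sup>+y. ennreal (a0 y) * \<phi> y * (\<integral>\<^sup>+m\<in>{y<..}. B m \<partial>lborel) \<partial>lborel)"
    by (rule nn_integral_triangle_swap) auto
  also have "\<dots> = (\<integral>\<^sup>+y\<in>{0<..<1}. \<phi> y * ennreal ((real d - g y) / (real d * (real d - 1))) \<partial>lborel)"
  proof (rule nn_integral_cong)
    fix y :: real
    show "ennreal (a0 y) * \<phi> y * (\<integral>\<^sup>+m\<in>{y<..}. B m \<partial>lborel) = \<phi> y * ennreal ((real d - g y) / (real d * (real d - 1))) * indicator {0<..<1} y"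
    proof (cases "y \<in> {0<..<1}")
      case True
      have "a0 y * (E (1 - 1 / real d) (- 1) y / (real d - 1))
          = (real d - g y) / (real d * (real d - 1)) * (E (1 / real d - 1) 1 y * E (1 - 1 / real d) (- 1) y)"
        using True by (simp add: a0_def E0_def)
      also have "E (1 / real d - 1) 1 y * E (1 - 1 / real d) (- 1) y = 1"
        by (simp add: E_mult) (simp add: E_def)
      finally have "ennreal (a0 y) * ennreal (E (1 - 1 / real d) (- 1) y / (real d - 1)) = ennreal ((real d - g y) / (real d * (real d - 1)))"
        using d_pos by (simp add: ennreal_mult[symmetric] a0_nonneg E_pos less_imp_le)
      then show ?thesis using True
        by (simp add: B_def nn_integral_b0_E_power mult.assoc mult.left_commute[of _ "\<phi> y"])
    qed (simp add: a0_eq)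
  qed
  finally show ?thesis .
qed

lemma nn_integral_dens_component:
  assumes i: "i < d" and [measurable]: "\<phi> \<in> borel_measurable borel"
  shows "(\<integral>\<^sup>+x. dens x * \<phi> (x i) \<partial>lebesgue_pow d) = (\<integral>\<^sup>+y\<in>{0<..<1}. \<phi> y \<partial>lborel)"
proof -
  have [measurable]: "(\<lambda>x. \<phi> (x i)) \<in> borel_measurable (lebesgue_pow d)"
    using i by (intro measurable_lebesgue_pow_compose) auto
  let ?I = "(\<integral>\<^sup>+y\<in>{0<..<1}. \<phi> y * ennreal ((real d - g y) / (real d * (real d - 1))) \<partial>lborel)"
  have "(\<integral>\<^sup>+x. dens x * \<phi> (x i) \<partial>lebesgue_pow d) = (\<Sum>k<d. \<integral>\<^sup>+x. dens_at k x * \<phi> (x i) \<partial>lebesgue_pow d)"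
    unfolding dens_def sum_distrib_right by (rule nn_integral_sum) measurable
  also have "\<dots> = (\<integral>\<^sup>+x. dens_at i x * \<phi> (x i) \<partial>lebesgue_pow d)
      + (\<Sum>k\<in>{..<d} - {i}. \<integral>\<^sup>+x. dens_at k x * \<phi> (x i) \<partial>lebesgue_pow d)"
    using i by (subst sum.remove[of _ i]) auto
  also have "(\<Sum>k\<in>{..<d} - {i}. \<integral>\<^sup>+x. dens_at k x * \<phi> (x i) \<partial>lebesgue_pow d) = (\<Sum>k\<in>{..<d} - {i}. ?I)"
    using i by (intro sum.cong refl nn_integral_dens_at_component) auto
  also have "\<dots> = (\<integral>\<^sup>+y. of_nat (d - 1) * (\<phi> y * ennreal ((real d - g y) / (real d * (real d - 1))) * indicator {0<..<1} y) \<partial>lborel)"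
    using i by (subst nn_integral_cmult) (auto simp: card_Diff_singleton)
  also have "(\<integral>\<^sup>+x. dens_at i x * \<phi> (x i) \<partial>lebesgue_pow d) = (\<integral>\<^sup>+m\<in>{0<..<1}. \<phi> m * ennreal (g m / real d) \<partial>lborel)"
    by (rule nn_integral_dens_at_max[OF i]) measurable
  also have "(\<integral>\<^sup>+m\<in>{0<..<1}. \<phi> m * ennreal (g m / real d) \<partial>lborel)
      + (\<integral>\<^sup>+y. of_nat (d - 1) * (\<phi> y * ennreal ((real d - g y) / (real d * (real d - 1))) * indicator {0<..<1} y) \<partial>lborel)
      = (\<integral>\<^sup>+y. \<phi> y * ennreal (g y / real d) * indicator {0<..<1} y
          + of_nat (d - 1) * (\<phi> y * ennreal ((real d - g y) / (real d * (real d - 1))) * indicator {0<..<1} y) \<partial>lborel)"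
    by (subst nn_integral_add) auto
  also have "\<dots> = (\<integral>\<^sup>+y\<in>{0<..<1}. \<phi> y \<partial>lborel)"
  proof (rule nn_integral_cong)
    fix y
    define q where "q = (real d - g y) / (real d * (real d - 1))"
    have "0 \<le> q" using g_le[of y] d_pos by (simp add: q_def)
    have "ennreal (g y / real d) + of_nat (d - 1) * ennreal q
        = ennreal (g y / real d) + ennreal (real (d - 1)) * ennreal q"
      by (simp add: ennreal_of_nat_eq_real_of_nat)
    also have "\<dots> = ennreal (g y / real d + real (d - 1) * q)"
      using g_nonneg[of y] \<open>0 \<le> q\<close> by (simp only: ennreal_mult ennreal_plus of_nat_0_le_iff mult_nonneg_nonneg divide_nonneg_nonneg)
    \<comment> \<open>The weight of the case where this coordinate is the largest and the d - 1
      equal weights of the cases where another one is add up to 1.\<close>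
    also have "g y / real d + real (d - 1) * q = 1"
    proof -
      have "real (d - 1) * q = (real d - g y) / real d"
        using d_pos by (simp add: q_def of_nat_diff)
      then show ?thesis using d_pos by (simp add: diff_divide_distrib)
    qed
    finally have *: "ennreal (g y / real d) + of_nat (d - 1) * ennreal ((real d - g y) / (real d * (real d - 1))) = 1"
      by (simp add: q_def)
    show "\<phi> y * ennreal (g y / real d) * indicator {0<..<1} y
          + of_nat (d - 1) * (\<phi> y * ennreal ((real d - g y) / (real d * (real d - 1))) * indicator {0<..<1} y)
        = \<phi> y * indicator {0<..<1} y" (is "?l = _")
    proof -
      have "?l = \<phi> y * indicator {0<..<1} y * (ennreal (g y / real d) + of_nat (d - 1) * ennreal ((real d - g y) / (real d * (real d - 1))))"
        by (simp add: distrib_left ac_simps)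
      then show ?thesis unfolding * by simp
    qed
  qed
  finally show ?thesis .
qed

lemma nn_integral_dens_max:
  assumes [measurable]: "v \<in> borel_measurable borel"
  shows "(\<integral>\<^sup>+x. (\<Sum>k<d. dens_at k x * v (x k)) \<partial>lebesgue_pow d) = (\<integral>\<^sup>+m\<in>{0<..<1}. v m * ennreal (g m) \<partial>lborel)"
proof -
  have "(\<integral>\<^sup>+x. (\<Sum>k<d. dens_at k x * v (x k)) \<partial>lebesgue_pow d) = (\<Sum>k<d. \<integral>\<^sup>+x. dens_at k x * v (x k) \<partial>lebesgue_pow d)"
    by (rule nn_integral_sum) (auto intro!: borel_measurable_times_ennreal measurable_lebesgue_pow_compose)
  also have "\<dots> = (\<Sum>k<d. \<integral>\<^sup>+m\<in>{0<..<1}. v m * ennreal (g m / real d) \<partial>lborel)"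
    by (intro sum.cong refl nn_integral_dens_at_max) auto
  also have "\<dots> = (\<integral>\<^sup>+m. ennreal (real d) * (v m * ennreal (g m / real d) * indicator {0<..<1} m) \<partial>lborel)"
    by (subst nn_integral_cmult) (auto simp: ennreal_of_nat_eq_real_of_nat)
  also have "\<dots> = (\<integral>\<^sup>+m\<in>{0<..<1}. v m * ennreal (g m) \<partial>lborel)"
  proof (rule nn_integral_cong)
    fix m
    have "ennreal (real d) * ennreal (g m / real d) = ennreal (g m)"
      using d_pos g_nonneg by (simp add: ennreal_mult[symmetric])
    then show "ennreal (real d) * (v m * ennreal (g m / real d) * indicator {0<..<1} m) = v m * ennreal (g m) * indicator {0<..<1} m"
      by (metis (no_types, lifting) mult.assoc mult.left_commute)
  qed
  finally show ?thesis .
qed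

definition "dens_measure = density (lebesgue_pow d) dens"

definition "C_copula u = measure dens_measure {x \<in> space dens_measure. \<forall>i<d. x i \<le> u i}"

lemma space_dens_measure [simp]: "space dens_measure = extensional {..<d}"
  and sets_dens_measure [simp, measurable_cong]: "sets dens_measure = sets (lebesgue_pow d)"
  by (simp_all add: dens_measure_def space_lebesgue_pow)

lemma emeasure_dens_measure:
  "A \<in> sets (lebesgue_pow d) \<Longrightarrow> emeasure dens_measure A = (\<integral>\<^sup>+x. dens x * indicator A x \<partial>lebesgue_pow d)"
  by (simp add: dens_measure_def emeasure_density)

lemma prob_space_dens_measure: "prob_space dens_measure"
proof
  have "emeasure dens_measure (space dens_measure) = (\<integral>\<^sup>+x. dens x * 1 \<partial>lebesgue_pow d)"
    using sets.top[of "lebesgue_pow d"] unfolding space_dens_measure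
    by (subst emeasure_dens_measure) (auto simp: space_lebesgue_pow intro!: nn_integral_cong)
  also have "\<dots> = (\<integral>\<^sup>+y\<in>{0<..<1}. 1 \<partial>(lborel :: real measure))"
    using nn_integral_dens_component[of 0 "\<lambda>_. 1"] d by simp
  finally show "emeasure dens_measure (space dens_measure) = 1" by simp
qed

lemma represents_C_copula: "represents_copula d dens_measure (\<lambda>i x. x i) C_copula"
  unfolding represents_copula_def
proof (intro conjI allI impI ballI)
  fix i assume i: "i < d"
  show comp: "(\<lambda>x. x i) \<in> borel_measurable dens_measure"
    using measurable_component_lebesgue_pow[OF i] by simp
  show "distr dens_measure lborel (\<lambda>x. x i) = uniform_measure lborel {0..1}"
  proof (rule measure_eqI)
    fix B assume "B \<in> sets (distr dens_measure lborel (\<lambda>x. x i))"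
    then have [measurable]: "B \<in> sets borel" by simp
    have meas: "{x \<in> extensional {..<d}. x i \<in> B} \<in> sets (lebesgue_pow d)"
      using measurable_sets[OF measurable_component_lebesgue_pow[OF i], of B]
      by (simp add: space_lebesgue_pow vimage_def Int_def conj_commute)
    have "emeasure (distr dens_measure lborel (\<lambda>x. x i)) B = emeasure dens_measure {x \<in> extensional {..<d}. x i \<in> B}"
      using comp by (subst emeasure_distr) (auto simp: vimage_def Int_def conj_commute)
    also have "\<dots> = (\<integral>\<^sup>+x. dens x * indicator B (x i) \<partial>lebesgue_pow d)"
      unfolding emeasure_dens_measure[OF meas]
      by (intro nn_integral_cong) (auto simp: space_lebesgue_pow indicator_def)
    also have "\<dots> = (\<integral>\<^sup>+y\<in>{0<..<1}. indicator B y \<partial>lborel)"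
      by (rule nn_integral_dens_component[OF i]) measurable
    also have "\<dots> = (\<integral>\<^sup>+y. indicator ({0..1} \<inter> B) y \<partial>lborel)"
      using AE_lborel_singleton[of 0] AE_lborel_singleton[of 1]
      by (intro nn_integral_cong_AE, eventually_elim) (auto simp: indicator_def)
    finally show "emeasure (distr dens_measure lborel (\<lambda>x. x i)) B = emeasure (uniform_measure lborel {0..1}) B"
      by (simp add: divide_ennreal_def)
  qed simp
qed (simp_all add: prob_space_dens_measure C_copula_def)

lemma distributed_dens: "distributed dens_measure (lebesgue_pow d) (\<lambda>x. \<lambda>i\<in>{..<d}. x i) dens"
proof -
  have "distr dens_measure (lebesgue_pow d) (\<lambda>x. \<lambda>i\<in>{..<d}. x i) = distr dens_measure (lebesgue_pow d) (\<lambda>x. x)"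
    by (intro distr_cong) (auto intro: extensional_restrict)
  also have "\<dots> = dens_measure" by (rule distr_id2) simp
  finally show ?thesis
    using represents_copula_measurable[OF represents_C_copula]
    by (simp add: distributed_def dens_measure_def)
qed

text \<open>In this form a permutation of the arguments only reindexes a finite sum and finite
  products, so symmetry follows without transforming the measure on R^d.\<close>

lemma C_copula_eq:
  assumes "u \<in> unit_cube d"
  shows "ennreal (C_copula u) = (\<Sum>k<d. \<integral>\<^sup>+m. ennreal (b0 m) * indicator {..u k} m *
      (\<Prod>i\<in>{..<d} - {k}. \<integral>\<^sup>+y\<in>{..<m}. ennreal (a0 y) * indicator {..u i} y \<partial>lborel) \<partial>lborel)"
proof -
  interpret prob_space dens_measure by (rule prob_space_dens_measure)
  have meas: "{x \<in> extensional {..<d}. \<forall>i<d. x i \<le> u i} \<in> sets (lebesgue_pow d)"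
  proof -
    have "{x \<in> extensional {..<d}. \<forall>i<d. x i \<le> u i} = (\<Pi>\<^sub>E i\<in>{..<d}. {..u i})" by (auto simp: PiE_def)
    then show ?thesis by (auto simp: lebesgue_pow_def intro!: sets_PiM_I_finite)
  qed
  have "ennreal (C_copula u) = (\<integral>\<^sup>+x. dens x * indicator {x \<in> extensional {..<d}. \<forall>i<d. x i \<le> u i} x \<partial>lebesgue_pow d)"
    unfolding C_copula_def space_dens_measure emeasure_eq_measure[symmetric] by (rule emeasure_dens_measure[OF meas])
  also have "\<dots> = (\<integral>\<^sup>+x. (\<Sum>k<d. dens_at k x * (indicator {..u k} (x k) * (\<Prod>i\<in>{..<d} - {k}. indicator {..u i} (x i)))) \<partial>lebesgue_pow d)"
  proof (rule nn_integral_cong)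
    fix x assume x: "x \<in> space (lebesgue_pow d)"
    have "indicator {x \<in> extensional {..<d}. \<forall>i<d. x i \<le> u i} x = (\<Prod>i<d. indicator {..u i} (x i) :: ennreal)"
      using x by (auto simp: indicator_def space_lebesgue_pow)
    then have "indicator {x \<in> extensional {..<d}. \<forall>i<d. x i \<le> u i} x
        = indicator {..u k} (x k) * (\<Prod>i\<in>{..<d} - {k}. indicator {..u i} (x i) :: ennreal)" if "k < d" for k
      using that by (simp add: prod.remove[of _ k])
    then show "dens x * indicator {x \<in> extensional {..<d}. \<forall>i<d. x i \<le> u i} x
        = (\<Sum>k<d. dens_at k x * (indicator {..u k} (x k) * (\<Prod>i\<in>{..<d} - {k}. indicator {..u i} (x i))))"
      unfolding dens_def sum_distrib_right by (intro sum.cong) auto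
  qed
  also have "\<dots> = (\<Sum>k<d. \<integral>\<^sup>+x. dens_at k x * (indicator {..u k} (x k) * (\<Prod>i\<in>{..<d} - {k}. indicator {..u i} (x i))) \<partial>lebesgue_pow d)"
    by (rule nn_integral_sum)
       (auto intro!: borel_measurable_times_ennreal borel_measurable_prod_ennreal measurable_lebesgue_pow_compose)
  also have "\<dots> = (\<Sum>k<d. \<integral>\<^sup>+m. ennreal (b0 m) * indicator {..u k} m *
      (\<Prod>i\<in>{..<d} - {k}. \<integral>\<^sup>+y\<in>{..<m}. ennreal (a0 y) * indicator {..u i} y \<partial>lborel) \<partial>lborel)"
    by (intro sum.cong refl nn_integral_dens_at[where w = "\<lambda>i _. indicator {..u i}"]) auto
  finally show ?thesis .
qed

lemma symmetric_C_copula: "symmetric_copula d C_copula"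
  unfolding symmetric_copula_def
proof (intro conjI allI impI ballI)
  show "copula d C_copula" unfolding copula_def using represents_C_copula by blast
  fix \<sigma> u assume \<sigma>: "\<sigma> permutes {..<d}" and u: "u \<in> unit_cube d"
  have u': "u \<circ> \<sigma> \<in> unit_cube d"
  proof -
    have "\<sigma> i < d" if "i < d" for i using permutes_in_image[OF \<sigma>, of i] that by simp
    then show ?thesis using u permutes_not_in[OF \<sigma>] by (auto simp: unit_cube_def PiE_def extensional_def Pi_def)
  qed
  define \<Psi> where "\<Psi> m r = (\<integral>\<^sup>+y\<in>{..<m}. ennreal (a0 y) * indicator {..r} y \<partial>lborel)" for m r :: real
  have prod_eq: "(\<Prod>i\<in>{..<d} - {k}. \<Psi> m (u (\<sigma> i))) = (\<Prod>i\<in>{..<d} - {\<sigma> k}. \<Psi> m (u i))" for k m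
  proof (rule prod.reindex_bij_betw)
    have "bij_betw \<sigma> {..<d} {..<d}" using \<sigma> by (rule permutes_imp_bij)
    then show "bij_betw \<sigma> ({..<d} - {k}) ({..<d} - {\<sigma> k})"
      using permutes_inj[OF \<sigma>] permutes_image[OF \<sigma>]
      by (auto simp: bij_betw_def image_set_diff inj_on_def inj_def)
  qed
  have "ennreal (C_copula (u \<circ> \<sigma>)) = (\<Sum>k<d. \<integral>\<^sup>+m. ennreal (b0 m) * indicator {..u (\<sigma> k)} m *
      (\<Prod>i\<in>{..<d} - {\<sigma> k}. \<Psi> m (u i)) \<partial>lborel)"
    unfolding C_copula_eq[OF u'] prod_eq[symmetric] by (simp add: \<Psi>_def)
  also have "\<dots> = (\<Sum>k<d. \<integral>\<^sup>+m. ennreal (b0 m) * indicator {..u k} m *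
      (\<Prod>i\<in>{..<d} - {k}. \<Psi> m (u i)) \<partial>lborel)"
    unfolding \<Psi>_def by (rule sum.reindex_bij_betw[OF permutes_imp_bij[OF \<sigma>]])
  also have "\<dots> = ennreal (C_copula u)"
    unfolding C_copula_eq[OF u] by (simp add: \<Psi>_def)
  finally show "C_copula (u \<circ> \<sigma>) = C_copula u"
    by (simp add: C_copula_def)
qed

lemma dens_at_eq_0: "i < d \<Longrightarrow> i \<noteq> k \<Longrightarrow> x k \<le> x i \<Longrightarrow> dens_at k x = 0"
  by (auto simp: dens_at_def intro!: prod_zero bexI[of _ i])

lemma diagonal_C_copula: "has_diagonal_section d C_copula \<delta>"
  unfolding has_diagonal_section_def
proof
  fix t :: real assume t: "t \<in> {0..1}"
  interpret prob_space dens_measure by (rule prob_space_dens_measure)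
  have meas: "{x \<in> extensional {..<d}. \<forall>i<d. x i \<le> t} \<in> sets (lebesgue_pow d)"
  proof -
    have "{x \<in> extensional {..<d}. \<forall>i<d. x i \<le> t} = (\<Pi>\<^sub>E i\<in>{..<d}. {..t})" by (auto simp: PiE_def)
    then show ?thesis by (auto simp: lebesgue_pow_def intro!: sets_PiM_I_finite)
  qed
  have "C_copula (diag_point d t) = measure dens_measure {x \<in> extensional {..<d}. \<forall>i<d. x i \<le> t}"
    unfolding C_copula_def diag_point_def space_dens_measure by (rule arg_cong[where f = "measure _"]) auto
  then have "ennreal (C_copula (diag_point d t)) = (\<integral>\<^sup>+x. dens x * indicator {x \<in> extensional {..<d}. \<forall>i<d. x i \<le> t} x \<partial>lebesgue_pow d)"
    by (simp add: emeasure_eq_measure[symmetric] emeasure_dens_measure[OF meas])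
  also have "\<dots> = (\<integral>\<^sup>+x. (\<Sum>k<d. dens_at k x * indicator {..t} (x k)) \<partial>lebesgue_pow d)"
  proof (rule nn_integral_cong)
    fix x assume x: "x \<in> space (lebesgue_pow d)"
    \<comment> \<open>Where \<open>dens_at k x\<close> is nonzero, x k is the maximum, so the event
      that all coordinates are at most t depends on x k alone.\<close>
    have "dens_at k x * indicator {x \<in> extensional {..<d}. \<forall>i<d. x i \<le> t} x = dens_at k x * indicator {..t} (x k)" if "k < d" for k
    proof (cases "\<exists>i<d. i \<noteq> k \<and> x k \<le> x i")
      case True
      then have "dens_at k x = 0" using dens_at_eq_0 by blast
      then show ?thesis by simp
    next
      case False
      then have "x i \<le> x k" if "i < d" for i using that by (cases "i = k") (auto simp: not_le intro: less_imp_le)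
      then have "(\<forall>i<d. x i \<le> t) \<longleftrightarrow> x k \<le> t" using \<open>k < d\<close> by (auto intro: order_trans)
      then show ?thesis using x by (simp add: indicator_def space_lebesgue_pow)
    qed
    then show "dens x * indicator {x \<in> extensional {..<d}. \<forall>i<d. x i \<le> t} x = (\<Sum>k<d. dens_at k x * indicator {..t} (x k))"
      unfolding dens_def sum_distrib_right by (intro sum.cong) auto
  qed
  also have "\<dots> = (\<integral>\<^sup>+m\<in>{0<..<1}. indicator {..t} m * ennreal (g m) \<partial>lborel)"
    by (rule nn_integral_dens_max) measurable
  also have "\<dots> = (\<integral>\<^sup>+m\<in>{0..t}. ennreal (g m) \<partial>lborel)"
  proof (rule nn_integral_cong_AE)
    show "AE m in lborel. indicator {..t} m * ennreal (g m) * indicator {0<..<1} m = ennreal (g m) * indicator {0..t} m"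
      using AE_lborel_singleton[of 0] AE_lborel_singleton[of 1]
      by eventually_elim (use t in \<open>auto simp: indicator_def\<close>)
  qed
  also have "\<dots> = ennreal (\<delta> t)" using t g_integral by simp
  finally show "\<delta> t = C_copula (diag_point d t)"
    using \<delta>_mono[of 0 t] \<delta>_0 t by (simp add: C_copula_def)
qed

end

subsection \<open>Entropy\<close>

text \<open>The inequality ln s <= s - 1, taken at s = t and at s = 1/t, gives -1 <= t ln t <=
  K^2.\<close>

lemma abs_mult_ln_le:
  fixes t K :: real
  assumes "0 \<le> t" "t \<le> K"
  shows "\<bar>t * ln t\<bar> \<le> 1 + K * K"
proof (cases "t = 0")
  case False
  then have t: "t > 0" using assms by simp
  have "t * ln t \<le> t * t" using ln_le_minus_one[OF t] t by (intro mult_left_mono) auto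
  also have "\<dots> \<le> K * K" using assms by (intro mult_mono) auto
  finally have "t * ln t \<le> K * K" .
  moreover have "t * - ln t \<le> t * (1 / t - 1)"
    using ln_le_minus_one[of "1 / t"] t by (intro mult_left_mono) (auto simp: ln_div)
  then have "- 1 \<le> t * ln t" using t by (simp add: right_diff_distrib)
  moreover have "0 \<le> K * K" by simp
  ultimately show ?thesis by linarith
qed simp

lemma integrable_mult_ln:
  fixes f :: "real \<Rightarrow> real"
  assumes [measurable]: "f \<in> borel_measurable borel" and "\<And>x. 0 \<le> f x" "\<And>x. f x \<le> K"
  shows "set_integrable lborel {0..1} (\<lambda>x. f x * ln (f x))"
  unfolding set_integrable_def
proof (rule Bochner_Integration.integrable_bound)
  show "integrable lborel (\<lambda>x. (1 + K * K) * indicator {0..1::real} x :: real)"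
    by (intro integrable_mult_right integrable_real_indicator) auto
  show "AE x in lborel. norm (indicator {0..1} x *\<^sub>R (f x * ln (f x))) \<le> norm ((1 + K * K) * indicator {0..1} x :: real)"
    using abs_mult_ln_le[OF assms(2,3)] by (auto simp: indicator_def)
qed measurable

text \<open>Both parts of f ln f have finite integral, so the difference of extended reals is an
  ordinary integral; this makes \<open>G_fun\<close> a real number.\<close>

lemma info1_bounded:
  fixes f :: "real \<Rightarrow> real"
  assumes "f \<in> borel_measurable borel" and "\<And>x. 0 \<le> f x" "\<And>x. f x \<le> K"
  shows "info1 f = ereal (LINT x:{0..1}|lborel. f x * ln (f x))"
proof -
  let ?u = "\<lambda>x. indicator {0..1} x *\<^sub>R (f x * ln (f x))"
  have int: "integrable lborel ?u" using integrable_mult_ln[OF assms] by (simp add: set_integrable_def)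
  have eq: "ennreal (f x * ln (f x)) * indicator {0..1} x = ennreal (?u x)"
      "ennreal (- (f x * ln (f x))) * indicator {0..1} x = ennreal (- ?u x)" for x
    by (auto simp: indicator_def)
  have fin: "(\<integral>\<^sup>+x. ennreal (?u x) \<partial>lborel) < \<infinity>" "(\<integral>\<^sup>+x. ennreal (- ?u x) \<partial>lborel) < \<infinity>"
    using int unfolding real_integrable_def by (simp_all add: less_top)
  obtain p where p: "(\<integral>\<^sup>+x. ennreal (?u x) \<partial>lborel) = ennreal p" "0 \<le> p"
    using fin(1) by (cases "\<integral>\<^sup>+x. ennreal (?u x) \<partial>lborel") auto
  obtain n where n: "(\<integral>\<^sup>+x. ennreal (- ?u x) \<partial>lborel) = ennreal n" "0 \<le> n"
    using fin(2) by (cases "\<integral>\<^sup>+x. ennreal (- ?u x) \<partial>lborel") auto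
  note pn = p n
  have "(LINT x|lborel. ?u x) = p - n"
    unfolding real_lebesgue_integral_def[OF int] pn using pn by simp
  then show ?thesis
    unfolding info1_def xlogx_integral_def eq pn set_lebesgue_integral_def using pn by simp
qed

text \<open>Division by the upper bound K makes -ln (f/K) nonnegative, so its mean under f can be
  taken in [0,\<infinity>]. It is used with K = d for f = g, of mass 1, and for f = d - g, of mass d
  - 1.\<close>

lemma nn_integral_relative_entropy:
  fixes f :: "real \<Rightarrow> real"
  assumes [measurable]: "f \<in> borel_measurable borel" and f: "\<And>x. 0 \<le> f x" "\<And>x. f x \<le> K" and "0 < K"
    and c: "(\<integral>\<^sup>+x\<in>{0..1}. ennreal (f x) \<partial>lborel) = ennreal c" "0 \<le> c"
  shows "(\<integral>\<^sup>+x\<in>{0<..<1}. ennreal (- ln (f x / K)) * ennreal (f x) \<partial>lborel)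
       = ennreal (c * ln K - (LINT x:{0..1}|lborel. f x * ln (f x)))"
    and "0 \<le> c * ln K - (LINT x:{0..1}|lborel. f x * ln (f x))"
proof -
  have f_int: "set_integrable lborel {0..1} f"
    unfolding set_integrable_def
  proof (rule Bochner_Integration.integrable_bound)
    show "integrable lborel (\<lambda>x. K * indicator {0..1::real} x :: real)"
      by (intro integrable_mult_right integrable_real_indicator) auto
  qed (use f \<open>0 < K\<close> in \<open>auto simp: indicator_def\<close>)
  have "(\<integral>\<^sup>+x. ennreal (indicator {0..1} x * f x) \<partial>lborel) = ennreal c"
    unfolding c(1)[symmetric] by (intro nn_integral_cong) (auto simp: indicator_def)
  then have "(LINT x:{0..1}|lborel. f x) = c"
    using f c(2) unfolding set_lebesgue_integral_def by (subst integral_eq_nn_integral) (auto simp: indicator_def)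
  then have LINT: "(LINT x:{0..1}|lborel. f x * ln K - f x * ln (f x)) = c * ln K - (LINT x:{0..1}|lborel. f x * ln (f x))"
    using f_int integrable_mult_ln[OF _ f] by (subst set_integral_diff(2)) auto
  have int: "set_integrable lborel {0..1} (\<lambda>x. f x * ln K - f x * ln (f x))"
    using f_int integrable_mult_ln[OF _ f] by (intro set_integral_diff(1)) auto
  \<comment> \<open>Where f vanishes, both sides are 0, whatever value ln takes there.\<close>
  have eq: "f x * ln K - f x * ln (f x) = - ln (f x / K) * f x" for x
    using f(1)[of x] \<open>0 < K\<close> by (cases "f x = 0") (auto simp: ln_div algebra_simps)
  have nonneg: "0 \<le> - ln (f x / K)" for x
    using f[of x] \<open>0 < K\<close> by (cases "f x = 0") (auto simp: ln_le_zero_iff)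
  have nonneg': "0 \<le> indicator {0..1} x *\<^sub>R (- ln (f x / K) * f x)" for x
    using nonneg[of x] f(1)[of x] by (intro scaleR_nonneg_nonneg mult_nonneg_nonneg) (auto simp: indicator_def)
  have "(\<integral>\<^sup>+x\<in>{0<..<1}. ennreal (- ln (f x / K)) * ennreal (f x) \<partial>lborel)
      = (\<integral>\<^sup>+x. ennreal (indicator {0..1} x *\<^sub>R (f x * ln K - f x * ln (f x))) \<partial>lborel)"
  proof (rule nn_integral_cong_AE)
    show "AE x in lborel. ennreal (- ln (f x / K)) * ennreal (f x) * indicator {0<..<1} x
        = ennreal (indicator {0..1} x *\<^sub>R (f x * ln K - f x * ln (f x)))"
      using AE_lborel_singleton[of 0] AE_lborel_singleton[of 1] unfolding eq
      by eventually_elim (use nonneg f in \<open>auto simp: indicator_def ennreal_mult'[symmetric]\<close>)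
  qed
  also have "\<dots> = ennreal (LINT x|lborel. indicator {0..1} x *\<^sub>R (f x * ln K - f x * ln (f x)))"
    using int unfolding eq set_integrable_def
    by (rule nn_integral_eq_integral[OF _ AE_I2[OF nonneg']])
  finally show "(\<integral>\<^sup>+x\<in>{0<..<1}. ennreal (- ln (f x / K)) * ennreal (f x) \<partial>lborel)
       = ennreal (c * ln K - (LINT x:{0..1}|lborel. f x * ln (f x)))"
    using LINT by (simp add: set_lebesgue_integral_def)
  have "0 \<le> (LINT x:{0..1}|lborel. f x * ln K - f x * ln (f x))"
    unfolding eq set_lebesgue_integral_def by (rule integral_nonneg_AE[OF AE_I2[OF nonneg']])
  then show "0 \<le> c * ln K - (LINT x:{0..1}|lborel. f x * ln (f x))"
    unfolding LINT .
qed

section \<open>The two parts of the logarithm of the density and their means\<close>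

context diagonal_section
begin

definition "F0 x = indicator {0<..<1} x * F x"
definition "lnh0 x = indicator {0<..<1} x * ln (h x)"

lemma F0_measurable [measurable]: "F0 \<in> borel_measurable borel"
  using borel_measurable_continuous_on_indicator[OF _ F_continuous] by (simp add: F0_def[abs_def])

lemma lnh0_measurable [measurable]: "lnh0 \<in> borel_measurable borel"
proof -
  have "continuous_on {0<..<1} (\<lambda>x. ln (h x))"
    using h_pos by (intro continuous_intros continuous_on_subset[OF h_continuous]) (auto simp: less_imp_neq[symmetric])
  from borel_measurable_continuous_on_indicator[OF _ this] show ?thesis by (simp add: lnh0_def[abs_def])
qed

lemma lnh_nonpos: "0 < x \<Longrightarrow> x < 1 \<Longrightarrow> ln (h x) \<le> 0"
  using h_le[of x] h_pos[of x] by (simp add: ln_le_zero_iff)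

text \<open>On (0,1) the function \<open>E0 (- 1) 0\<close> is 1/h, so the integrand is F'. The
  interval is given by two half lines to match \<open>nn_integral_triangle_swap\<close>.\<close>

lemma F_diff_eq_nn_integral:
  assumes "0 < y" "y < m" "m < 1"
  shows "ennreal (F m - F y) = (\<integral>\<^sup>+s\<in>{y<..}. ennreal ((real d - 1) / real d * E0 (- 1) 0 s) * indicator {..<m} s \<partial>lborel)"
proof -
  have deriv: "(F has_real_derivative (real d - 1) / real d * E0 (- 1) 0 x) (at x)" if "0 < x" "x < 1" for x
    using F_deriv[OF that] that h_pos[OF that] by (simp add: E0_def E_def exp_minus field_simps)
  have "(\<integral>\<^sup>+s. ennreal ((real d - 1) / real d * E0 (- 1) 0 s) * indicator {y..m} s \<partial>lborel) = F m - F y"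
    using assms d_pos by (intro nn_integral_FTC_Icc deriv[THEN DERIV_subset]) (auto simp: E0_nonneg has_real_derivative_iff_has_vector_derivative[symmetric] intro: deriv[THEN DERIV_subset])
  also have "(\<integral>\<^sup>+s. ennreal ((real d - 1) / real d * E0 (- 1) 0 s) * indicator {y..m} s \<partial>lborel)
      = (\<integral>\<^sup>+s\<in>{y<..}. ennreal ((real d - 1) / real d * E0 (- 1) 0 s) * indicator {..<m} s \<partial>lborel)"
  proof (rule nn_integral_cong_AE)
    show "AE s in lborel. ennreal ((real d - 1) / real d * E0 (- 1) 0 s) * indicator {y..m} s
        = ennreal ((real d - 1) / real d * E0 (- 1) 0 s) * indicator {..<m} s * indicator {y<..} s"
      using AE_lborel_singleton[of y] AE_lborel_singleton[of m]
      by eventually_elim (auto simp: indicator_def)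
  qed
  finally show ?thesis by simp
qed

text \<open>Writing \<open>F(m) - F(y)\<close> as an integral of \<open>F'\<close> and exchanging the integrals avoids any
  integrability assumption on \<open>F\<close>, which may fail.\<close>

lemma nn_integral_dens_at_F_diff:
  assumes k: "k < d" and j: "j < d" "j \<noteq> k"
  shows "(\<integral>\<^sup>+x. dens_at k x * ennreal (F0 (x k) - F0 (x j)) \<partial>lebesgue_pow d) = ennreal (1 / real d)"
proof -
  define B where "B m = ennreal (b0 m * E (1 / real d) 1 m ^ (d - 2))" for m
  define \<phi> where "\<phi> s = ennreal ((real d - 1) / real d * E0 (- 1) 0 s)" for s
  define A where "A s = ennreal (E0 (1 / real d) 1 s)" for s
  have B [measurable]: "B \<in> borel_measurable borel" unfolding B_def[abs_def] b0_E_power' by measurable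
  have [measurable]: "\<phi> \<in> borel_measurable borel" "A \<in> borel_measurable borel"
    unfolding \<phi>_def[abs_def] A_def[abs_def] by measurable
  have inner: "(\<integral>\<^sup>+y\<in>{..<m}. ennreal (a0 y) * ennreal (F0 m - F0 y) \<partial>lborel) = (\<integral>\<^sup>+s\<in>{..<m}. \<phi> s * A s \<partial>lborel)"
    if m: "0 < m" "m < 1" for m
  proof -
    have "(\<integral>\<^sup>+y\<in>{..<m}. ennreal (a0 y) * ennreal (F0 m - F0 y) \<partial>lborel)
        = (\<integral>\<^sup>+y. ennreal (a0 y) * (\<integral>\<^sup>+s\<in>{y<..}. \<phi> s * indicator {..<m} s \<partial>lborel) \<partial>lborel)"
    proof (rule nn_integral_cong)
      fix y
      consider "y \<notin> {0<..<1}" | "0 < y" "y < m" | "0 < y" "y < 1" "m \<le> y" using m by force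
      then show "ennreal (a0 y) * ennreal (F0 m - F0 y) * indicator {..<m} y
          = ennreal (a0 y) * (\<integral>\<^sup>+s\<in>{y<..}. \<phi> s * indicator {..<m} s \<partial>lborel)"
      proof cases
        case 1
        then show ?thesis by (simp add: a0_eq)
      next
        case 2
        then show ?thesis using m F_diff_eq_nn_integral[OF 2 m(2)] by (simp add: F0_def \<phi>_def)
      next
        case 3
        then have "(\<integral>\<^sup>+s\<in>{y<..}. \<phi> s * indicator {..<m} s \<partial>lborel) = (\<integral>\<^sup>+s. 0 \<partial>(lborel :: real measure))"
          by (intro nn_integral_cong) (auto simp: indicator_def)
        then show ?thesis using 3 by simp
      qed
    qed
    \<comment> \<open>Exchange over y < s: what remains inside is the integral of a below s, which
      is A(s).\<close>
    also have "\<dots> = (\<integral>\<^sup>+s. (\<phi> s * indicator {..<m} s) * (\<integral>\<^sup>+y\<in>{..<s}. ennreal (a0 y) \<partial>lborel) \<partial>lborel)"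
      by (rule nn_integral_triangle_swap[symmetric]) auto
    also have "\<dots> = (\<integral>\<^sup>+s\<in>{..<m}. \<phi> s * A s \<partial>lborel)"
    proof (rule nn_integral_cong)
      fix s
      show "\<phi> s * indicator {..<m} s * (\<integral>\<^sup>+y\<in>{..<s}. ennreal (a0 y) \<partial>lborel) = \<phi> s * A s * indicator {..<m} s"
        by (cases "s \<in> {0<..<1}") (simp_all add: nn_integral_a0 A_def E0_def \<phi>_def, simp_all add: ac_simps)
    qed
    finally show ?thesis .
  qed
  have "(\<integral>\<^sup>+x. dens_at k x * ennreal (F0 (x k) - F0 (x j)) \<partial>lebesgue_pow d)
      = (\<integral>\<^sup>+m. B m * (\<integral>\<^sup>+y\<in>{..<m}. ennreal (a0 y) * ennreal (F0 m - F0 y) \<partial>lborel) \<partial>lborel)"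
    unfolding B_def by (rule nn_integral_dens_at_other[OF k j, of "\<lambda>m y. ennreal (F0 m - F0 y)"]) (simp add: case_prod_beta)
  also have "\<dots> = (\<integral>\<^sup>+m. B m * (\<integral>\<^sup>+s\<in>{..<m}. \<phi> s * A s \<partial>lborel) \<partial>lborel)"
  proof (rule nn_integral_cong)
    fix m
    show "B m * (\<integral>\<^sup>+y\<in>{..<m}. ennreal (a0 y) * ennreal (F0 m - F0 y) \<partial>lborel) = B m * (\<integral>\<^sup>+s\<in>{..<m}. \<phi> s * A s \<partial>lborel)"
      by (cases "m \<in> {0<..<1}") (auto simp: inner B_def b0_eq)
  qed
  also have "\<dots> = (\<integral>\<^sup>+s. (\<phi> s * A s) * (\<integral>\<^sup>+m\<in>{s<..}. B m \<partial>lborel) \<partial>lborel)"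
    by (rule nn_integral_triangle_swap) auto
  also have "\<dots> = (\<integral>\<^sup>+s. ennreal (1 / real d) * indicator {0<..<1::real} s \<partial>lborel)"
  proof (rule nn_integral_cong)
    fix s
    show "(\<phi> s * A s) * (\<integral>\<^sup>+m\<in>{s<..}. B m \<partial>lborel) = ennreal (1 / real d) * indicator {0<..<1} s"
    proof (cases "s \<in> {0<..<1}")
      case True
      have "(real d - 1) / real d * E (- 1) 0 s * E (1 / real d) 1 s * (E (1 - 1 / real d) (- 1) s / (real d - 1))
          = 1 / real d * (E (- 1) 0 s * E (1 / real d) 1 s * E (1 - 1 / real d) (- 1) s)"
        using d_pos by simp
      \<comment> \<open>This is A K/h = 1, so the integrand is the constant 1/d on (0,1). Over the d
        (d - 1) ordered pairs these constants add up to d - 1.\<close>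
      also have "E (- 1) 0 s * E (1 / real d) 1 s * E (1 - 1 / real d) (- 1) s = 1"
        by (simp add: E_mult) (simp add: E_def)
      finally have "ennreal ((real d - 1) / real d * E (- 1) 0 s * E (1 / real d) 1 s * (E (1 - 1 / real d) (- 1) s / (real d - 1))) = ennreal (1 / real d)"
        by simp
      moreover have "ennreal ((real d - 1) / real d * E (- 1) 0 s * E (1 / real d) 1 s * (E (1 - 1 / real d) (- 1) s / (real d - 1)))
          = ennreal ((real d - 1) / real d * E (- 1) 0 s) * ennreal (E (1 / real d) 1 s) * ennreal (E (1 - 1 / real d) (- 1) s / (real d - 1))"
      proof -
        have "0 \<le> (real d - 1) / real d * E (- 1) 0 s" "0 \<le> E (1 / real d) 1 s" "0 \<le> E (1 - 1 / real d) (- 1) s / (real d - 1)"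
          using d_pos E_pos[THEN less_imp_le] by auto
        then show ?thesis by (simp only: ennreal_mult mult_nonneg_nonneg)
      qed
      ultimately show ?thesis using True
        by (simp add: \<phi>_def A_def B_def E0_def nn_integral_b0_E_power)
    qed (simp add: \<phi>_def E0_def)
  qed
  also have "\<dots> = ennreal (1 / real d)" by (subst nn_integral_cmult) auto
  finally show ?thesis .
qed

lemma J_fun_eq: "J_fun \<delta> = (\<integral>\<^sup>+y\<in>{0<..<1}. ennreal (- lnh0 y) \<partial>lborel)"
  unfolding J_fun_def
proof (rule nn_integral_cong_AE)
  show "AE t in lborel. (if \<delta> t = t then \<infinity> else ennreal \<bar>ln (t - \<delta> t)\<bar>) * indicator {0..1} t
      = ennreal (- lnh0 t) * indicator {0<..<1} t"
    using AE_lborel_singleton[of 0] AE_lborel_singleton[of 1]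
  proof eventually_elim
    case (elim t)
    show ?case
    proof (cases "t \<in> {0<..<1}")
      case True
      then have "\<delta> t \<noteq> t" "ln (t - \<delta> t) \<le> 0" using \<delta>_less[of t] lnh_nonpos[of t] by (auto simp: h_fun_def)
      then show ?thesis using True by (simp add: lnh0_def h_fun_def)
    qed (use elim in \<open>auto simp: indicator_def\<close>)
  qed
qed

text \<open>The part of ln c coming from the powers of h, each coordinate contributing the exponent
  1/d - 1. It is nonnegative because h <= 1 on (0,1), and its mean may be infinite.\<close>

definition "X_part x = (\<Sum>i<d. ennreal ((1 - 1 / real d) * - lnh0 (x i)))"

text \<open>Where coordinate k is the largest and the density is positive, ln c =
  \<open>X_part x - Z_at k x\<close>. The d - 1 copies of F(max) from b are paired with the F(x i)
  from the factors a, which makes every summand nonnegative.\<close>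

definition "Z_at k x = ennreal (- ln (g (x k) / real d)) +
  (\<Sum>i\<in>{..<d} - {k}. ennreal (- ln ((real d - g (x i)) / real d)) + ennreal (F0 (x k) - F0 (x i)))"

lemma X_part_measurable [measurable]: "X_part \<in> borel_measurable (lebesgue_pow d)"
  unfolding X_part_def[abs_def] by (intro borel_measurable_sum measurable_lebesgue_pow_compose) auto

lemma Z_terms_measurable:
  assumes "k < d" "i < d"
  shows "(\<lambda>x. ennreal (- ln (g (x k) / real d))) \<in> borel_measurable (lebesgue_pow d)"
    and "(\<lambda>x. ennreal (- ln ((real d - g (x i)) / real d))) \<in> borel_measurable (lebesgue_pow d)"
    and "(\<lambda>x. ennreal (F0 (x k) - F0 (x i))) \<in> borel_measurable (lebesgue_pow d)"
  using assms
  by (auto intro!: measurable_lebesgue_pow_compose measurable_lebesgue_pow_compose2[where W = "\<lambda>m y. ennreal (F0 m - F0 y)"]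
      simp: case_prod_beta)

lemma Z_at_measurable [measurable]: "k < d \<Longrightarrow> Z_at k \<in> borel_measurable (lebesgue_pow d)"
  unfolding Z_at_def[abs_def] using Z_terms_measurable by (intro borel_measurable_add borel_measurable_sum) auto

text \<open>Each of the d uniform margins contributes (1 - 1/d) J.\<close>

lemma nn_integral_dens_X_part:
  "(\<integral>\<^sup>+x. dens x * X_part x \<partial>lebesgue_pow d) = ennreal (real d - 1) * J_fun \<delta>"
proof -
  have "(\<integral>\<^sup>+x. dens x * X_part x \<partial>lebesgue_pow d) = (\<Sum>i<d. \<integral>\<^sup>+x. dens x * ennreal ((1 - 1 / real d) * - lnh0 (x i)) \<partial>lebesgue_pow d)"
    unfolding X_part_def sum_distrib_left
    by (rule nn_integral_sum) (auto intro!: borel_measurable_times_ennreal measurable_lebesgue_pow_compose)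
  also have "\<dots> = (\<Sum>i<d. \<integral>\<^sup>+y\<in>{0<..<1}. ennreal ((1 - 1 / real d) * - lnh0 y) \<partial>lborel)"
    by (intro sum.cong refl nn_integral_dens_component) auto
  also have "(\<integral>\<^sup>+y\<in>{0<..<1}. ennreal ((1 - 1 / real d) * - lnh0 y) \<partial>lborel)
      = (\<integral>\<^sup>+y. ennreal (1 - 1 / real d) * (ennreal (- lnh0 y) * indicator {0<..<1} y) \<partial>lborel)"
    using d_pos by (intro nn_integral_cong) (auto simp: ennreal_mult'[symmetric] indicator_def)
  also have "\<dots> = ennreal (1 - 1 / real d) * J_fun \<delta>"
    unfolding J_fun_eq by (rule nn_integral_cmult) auto
  also have "(\<Sum>i<d. ennreal (1 - 1 / real d) * J_fun \<delta>) = ennreal (real d * (1 - 1 / real d)) * J_fun \<delta>"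
    using d_pos by (simp add: ennreal_mult ennreal_of_nat_eq_real_of_nat mult.assoc)
  also have "real d * (1 - 1 / real d) = real d - 1" using d_pos by (simp add: field_simps)
  finally show ?thesis .
qed

definition "I1 = (LINT x:{0..1}|lborel. g x * ln (g x))"
definition "I2 = (LINT x:{0..1}|lborel. (real d - g x) * ln (real d - g x))"

lemma nn_integral_g: "(\<integral>\<^sup>+x\<in>{0..1}. ennreal (g x) \<partial>lborel) = ennreal 1"
  using g_integral[of 1] \<delta>_1 by simp

lemma nn_integral_d_minus_g: "(\<integral>\<^sup>+x\<in>{0..1}. ennreal (real d - g x) \<partial>lborel) = ennreal (real d - 1)"
proof -
  have "(\<integral>\<^sup>+x\<in>{0..1}. ennreal (real d - g x) \<partial>lborel) + ennreal 1
      = (\<integral>\<^sup>+x. (ennreal (real d - g x) * indicator {0..1} x + ennreal (g x) * indicator {0..1} x) \<partial>lborel)"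
    unfolding nn_integral_g[symmetric] by (subst nn_integral_add) auto
  also have "\<dots> = (\<integral>\<^sup>+x. ennreal (real d) * indicator {0..1::real} x \<partial>lborel)"
    by (intro nn_integral_cong) (auto simp: indicator_def ennreal_plus[symmetric] g_nonneg g_le simp del: ennreal_plus)
  also have "\<dots> = ennreal (real d)" by (subst nn_integral_cmult) auto
  finally have "(\<integral>\<^sup>+x\<in>{0..1}. ennreal (real d - g x) \<partial>lborel) = ennreal (real d) - ennreal 1"
    by (metis ennreal_add_diff_cancel_right ennreal_neq_top)
  then show ?thesis by (simp add: ennreal_minus[symmetric] del: ennreal_1)
qed

text \<open>The maximum, with density g, yields the entropy of g. The d (d - 1) ordered pairs
  contribute equally and together yield the entropy of d - g and the constant d - 1. All three are
  finite.\<close>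

lemma nn_integral_dens_Z:
  shows "(\<integral>\<^sup>+x. (\<Sum>k<d. dens_at k x * Z_at k x) \<partial>lebesgue_pow d)
      = ennreal ((ln (real d) - I1) + ((real d - 1) * ln (real d) - I2) + (real d - 1))"
    and "0 \<le> (ln (real d) - I1) + ((real d - 1) * ln (real d) - I2) + (real d - 1)"
proof -
  note p = nn_integral_relative_entropy[OF g_measurable g_nonneg g_le d_pos(1) nn_integral_g, folded I1_def]
  have q: "(\<integral>\<^sup>+x\<in>{0<..<1}. ennreal (- ln ((real d - g x) / real d)) * ennreal (real d - g x) \<partial>lborel)
       = ennreal ((real d - 1) * ln (real d) - I2)" "0 \<le> (real d - 1) * ln (real d) - I2"
    unfolding I2_def
    by (rule nn_integral_relative_entropy; use g_nonneg g_le d_pos nn_integral_d_minus_g in simp)+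
  show "0 \<le> (ln (real d) - I1) + ((real d - 1) * ln (real d) - I2) + (real d - 1)"
    using p(2) q(2) d_pos by simp
  let ?p = "\<lambda>y. ennreal (- ln (g y / real d))" and ?q = "\<lambda>y. ennreal (- ln ((real d - g y) / real d))"
  have pair_term: "(\<integral>\<^sup>+x. dens_at k x * (?q (x i) + ennreal (F0 (x k) - F0 (x i))) \<partial>lebesgue_pow d)
      = ennreal (((real d - 1) * ln (real d) - I2 + (real d - 1)) / (real d * (real d - 1)))" if "k < d" "i < d" "i \<noteq> k" for k i
  proof -
    have "(\<integral>\<^sup>+x. dens_at k x * (?q (x i) + ennreal (F0 (x k) - F0 (x i))) \<partial>lebesgue_pow d)
        = (\<integral>\<^sup>+x. dens_at k x * ?q (x i) \<partial>lebesgue_pow d) + (\<integral>\<^sup>+x. dens_at k x * ennreal (F0 (x k) - F0 (x i)) \<partial>lebesgue_pow d)"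
      unfolding distrib_left using that Z_terms_measurable by (intro nn_integral_add) auto
    also have "(\<integral>\<^sup>+x. dens_at k x * ?q (x i) \<partial>lebesgue_pow d)
        = (\<integral>\<^sup>+y\<in>{0<..<1}. ?q y * ennreal ((real d - g y) / (real d * (real d - 1))) \<partial>lborel)"
      using that by (intro nn_integral_dens_at_component) auto
    also have "\<dots> = (\<integral>\<^sup>+y. ennreal (1 / (real d * (real d - 1))) * (?q y * ennreal (real d - g y) * indicator {0<..<1} y) \<partial>lborel)"
    proof (rule nn_integral_cong)
      fix y
      have "ennreal ((real d - g y) / (real d * (real d - 1))) = ennreal (1 / (real d * (real d - 1))) * ennreal (real d - g y)"
        using d_pos g_le by (simp add: ennreal_mult[symmetric])
      then show "?q y * ennreal ((real d - g y) / (real d * (real d - 1))) * indicator {0<..<1} y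
          = ennreal (1 / (real d * (real d - 1))) * (?q y * ennreal (real d - g y) * indicator {0<..<1} y)"
        by (simp add: ac_simps)
    qed
    also have "\<dots> = ennreal (1 / (real d * (real d - 1))) * ennreal ((real d - 1) * ln (real d) - I2)"
      unfolding q(1)[symmetric] by (rule nn_integral_cmult) auto
    also have "\<dots> = ennreal (1 / (real d * (real d - 1)) * ((real d - 1) * ln (real d) - I2))"
      using q(2) d_pos by (intro ennreal_mult[symmetric]) auto
    also have "(\<integral>\<^sup>+x. dens_at k x * ennreal (F0 (x k) - F0 (x i)) \<partial>lebesgue_pow d) = ennreal (1 / real d)"
      using that by (intro nn_integral_dens_at_F_diff) auto
    also have "ennreal (1 / (real d * (real d - 1)) * ((real d - 1) * ln (real d) - I2)) + ennreal (1 / real d)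
        = ennreal (1 / (real d * (real d - 1)) * ((real d - 1) * ln (real d) - I2) + 1 / real d)"
      using q(2) d_pos by (intro ennreal_plus[symmetric] mult_nonneg_nonneg) auto
    also have "1 / (real d * (real d - 1)) * ((real d - 1) * ln (real d) - I2) + 1 / real d
        = ((real d - 1) * ln (real d) - I2 + (real d - 1)) / (real d * (real d - 1))"
      using d_pos by (simp add: add_divide_distrib)
    finally show ?thesis .
  qed
  have "(\<integral>\<^sup>+x. (\<Sum>k<d. dens_at k x * Z_at k x) \<partial>lebesgue_pow d)
      = (\<integral>\<^sup>+x. (\<Sum>k<d. dens_at k x * ?p (x k))
          + (\<Sum>k<d. \<Sum>i\<in>{..<d} - {k}. dens_at k x * (?q (x i) + ennreal (F0 (x k) - F0 (x i)))) \<partial>lebesgue_pow d)"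
    unfolding Z_at_def by (simp add: distrib_left sum.distrib sum_distrib_left)
  also have "\<dots> = (\<integral>\<^sup>+x. (\<Sum>k<d. dens_at k x * ?p (x k)) \<partial>lebesgue_pow d)
      + (\<integral>\<^sup>+x. (\<Sum>k<d. \<Sum>i\<in>{..<d} - {k}. dens_at k x * (?q (x i) + ennreal (F0 (x k) - F0 (x i)))) \<partial>lebesgue_pow d)"
    using Z_terms_measurable
    by (intro nn_integral_add borel_measurable_sum borel_measurable_times_ennreal borel_measurable_add dens_at_measurable) auto
  also have "(\<integral>\<^sup>+x. (\<Sum>k<d. dens_at k x * ?p (x k)) \<partial>lebesgue_pow d) = ennreal (ln (real d) - I1)"
    using nn_integral_dens_max[of ?p] p(1) by simp
  also have "(\<integral>\<^sup>+x. (\<Sum>k<d. \<Sum>i\<in>{..<d} - {k}. dens_at k x * (?q (x i) + ennreal (F0 (x k) - F0 (x i)))) \<partial>lebesgue_pow d)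
      = (\<Sum>k<d. \<Sum>i\<in>{..<d} - {k}. \<integral>\<^sup>+x. dens_at k x * (?q (x i) + ennreal (F0 (x k) - F0 (x i))) \<partial>lebesgue_pow d)"
    using Z_terms_measurable
    by (subst nn_integral_sum, fastforce intro!: borel_measurable_sum borel_measurable_times_ennreal borel_measurable_add dens_at_measurable,
        intro sum.cong refl nn_integral_sum borel_measurable_times_ennreal borel_measurable_add dens_at_measurable) auto
  also have "\<dots> = (\<Sum>k<d. \<Sum>i\<in>{..<d} - {k}. ennreal (((real d - 1) * ln (real d) - I2 + (real d - 1)) / (real d * (real d - 1))))"
    by (intro sum.cong refl pair_term) auto
  also have "\<dots> = ennreal (real d * (real d - 1) * (((real d - 1) * ln (real d) - I2 + (real d - 1)) / (real d * (real d - 1))))"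
    using d_pos q(2) by (simp add: ennreal_of_nat_eq_real_of_nat ennreal_mult[symmetric] of_nat_diff card_Diff_singleton mult.assoc)
  also have "real d * (real d - 1) * (((real d - 1) * ln (real d) - I2 + (real d - 1)) / (real d * (real d - 1))) = (real d - 1) * ln (real d) - I2 + (real d - 1)"
    using d_pos by simp
  also have "ennreal (ln (real d) - I1) + ennreal ((real d - 1) * ln (real d) - I2 + (real d - 1))
      = ennreal ((ln (real d) - I1) + ((real d - 1) * ln (real d) - I2) + (real d - 1))"
    using p(2) q(2) d_pos by (subst ennreal_plus[symmetric]) (auto simp: add.assoc)
  finally show "(\<integral>\<^sup>+x. (\<Sum>k<d. dens_at k x * Z_at k x) \<partial>lebesgue_pow d)
      = ennreal ((ln (real d) - I1) + ((real d - 1) * ln (real d) - I2) + (real d - 1))" .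
qed

end

section \<open>Identification with c_\<delta> and the value of the entropy\<close>

lemma max_coord_eq:
  assumes "k < d" "\<forall>i<d. i \<noteq> k \<longrightarrow> x i < x k"
  shows "max_coord d x = x k"
  unfolding max_coord_def
proof (rule Max_eqI)
  fix y assume "y \<in> x ` {..<d}"
  then obtain i where "i < d" "y = x i" by auto
  then show "y \<le> x k" using assms(2) by (cases "i = k") (auto intro: less_imp_le)
qed (use assms in auto)

lemma AE_lebesgue_pow_unique_max:
  assumes "0 < d"
  shows "AE x in lebesgue_pow d. \<exists>k<d. \<forall>i<d. i \<noteq> k \<longrightarrow> x i < x k"
proof -
  have "AE x in lebesgue_pow d. \<forall>i\<in>{..<d}. \<forall>j\<in>{..<d}. i \<noteq> j \<longrightarrow> x i \<noteq> x j"
    by (intro AE_finite_allI finite_lessThan) (auto intro: AE_lebesgue_pow_neq AE_I2)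
  then show ?thesis
  proof eventually_elim
    case (elim x)
    have "Max (x ` {..<d}) \<in> x ` {..<d}" using assms by (intro Max_in) auto
    then obtain k where k: "k < d" "x k = Max (x ` {..<d})" by auto
    have "x i < x k" if "i < d" "i \<noteq> k" for i
    proof -
      have "x i \<le> x k" using that k by (simp add: Max_ge)
      moreover have "x i \<noteq> x k" using elim that k(1) by auto
      ultimately show ?thesis by simp
    qed
    then show ?case using k(1) by auto
  qed
qed

lemma xlogx_integral_cong_AE:
  assumes "AE x in M. x \<in> A \<longrightarrow> f x = f' x"
  shows "xlogx_integral M A f = xlogx_integral M A f'"
proof -
  have "(\<integral>\<^sup>+x\<in>A. ennreal (f x * ln (f x)) \<partial>M) = (\<integral>\<^sup>+x\<in>A. ennreal (f' x * ln (f' x)) \<partial>M)"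
    using assms by (intro nn_integral_cong_AE) (auto elim!: eventually_mono simp: indicator_def)
  moreover have "(\<integral>\<^sup>+x\<in>A. ennreal (- (f x * ln (f x))) \<partial>M) = (\<integral>\<^sup>+x\<in>A. ennreal (- (f' x * ln (f' x))) \<partial>M)"
    using assms by (intro nn_integral_cong_AE) (auto elim!: eventually_mono simp: indicator_def)
  ultimately show ?thesis by (simp add: xlogx_integral_def)
qed

context diagonal_section
begin

lemma sum_dens_at_unique_max:
  assumes "k < d" "\<forall>i<d. i \<noteq> k \<longrightarrow> x i < x k"
  shows "(\<Sum>n<d. dens_at n x * u n) = dens_at k x * u k"
proof -
  have "dens_at n x = 0" if "n < d" "n \<noteq> k" for n
    using assms that dens_at_eq_0[of k n x] by (auto intro: less_imp_le)
  then show ?thesis using assms(1) by (subst sum.remove[of _ k]) auto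
qed

lemma dens_unique_max:
  assumes "k < d" "\<forall>i<d. i \<noteq> k \<longrightarrow> x i < x k"
  shows "dens x = dens_at k x"
    and "dens x = ennreal (b0 (x k) * (\<Prod>i\<in>{..<d} - {k}. a0 (x i)))"
proof -
  show "dens x = dens_at k x"
    using sum_dens_at_unique_max[OF assms, of "\<lambda>_. 1"] by (simp add: dens_def)
  also have "dens_at k x = ennreal (b0 (x k)) * (\<Prod>i\<in>{..<d} - {k}. ennreal (a0 (x i)))"
    unfolding dens_at_def using assms by (intro arg_cong2[where f = "(*)"] prod.cong) auto
  also have "\<dots> = ennreal (b0 (x k) * (\<Prod>i\<in>{..<d} - {k}. a0 (x i)))"
    by (simp add: prod_ennreal a0_nonneg ennreal_mult b0_nonneg prod_nonneg)
  finally show "dens x = ennreal (b0 (x k) * (\<Prod>i\<in>{..<d} - {k}. a0 (x i)))" .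
qed

text \<open>Off a null set the coordinates of a point of the cube lie in (0,1),
  \<open>deriv \<delta>\<close> equals \<open>g\<close> at each of them, and the maximum is attained
  once; the product in \<open>c_fun\<close> then has exactly d - 1 factors.\<close>

lemma AE_dens_eq_c_fun:
  "AE x in lebesgue_pow d. x \<in> unit_cube d \<longrightarrow> 0 \<le> c_fun d \<delta> x \<and> dens x = ennreal (c_fun d \<delta> x)"
proof -
  have "AE y in lborel. y \<in> {0..1} \<longrightarrow> y \<in> {0<..<1} \<and> deriv \<delta> y = g y"
    using \<delta>_deriv AE_lborel_singleton[of 0] AE_lborel_singleton[of 1]
    by eventually_elim (auto intro: DERIV_imp_deriv)
  then have "AE x in lebesgue_pow d. \<forall>i\<in>{..<d}. x i \<in> {0..1} \<longrightarrow> x i \<in> {0<..<1} \<and> deriv \<delta> (x i) = g (x i)"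
    by (intro AE_finite_allI finite_lessThan) (auto intro: AE_lebesgue_pow_component)
  moreover have "AE x in lebesgue_pow d. \<exists>k<d. \<forall>i<d. i \<noteq> k \<longrightarrow> x i < x k"
    using d by (intro AE_lebesgue_pow_unique_max) auto
  ultimately show ?thesis
  proof eventually_elim
    case (elim x)
    show ?case
    proof
      assume "x \<in> unit_cube d"
      then have x: "x i \<in> {0<..<1}" "deriv \<delta> (x i) = g (x i)" if "i < d" for i
        using elim(1) that by (auto simp: unit_cube_def PiE_def Pi_def)
      obtain k where k: "k < d" "\<forall>i<d. i \<noteq> k \<longrightarrow> x i < x k" using elim(2) by auto
      have "{i. i < d \<and> x i \<noteq> x k} = {..<d} - {k}" using k by force
      moreover have "a_fun d \<delta> (x i) = a0 (x i)" "b_fun d \<delta> (x i) = b0 (x i)" if "i < d" for i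
        using x[OF that] by (simp_all add: a0_eq b0_eq a_def b_def a_fun_def b_fun_def)
      ultimately have "c_fun d \<delta> x = b0 (x k) * (\<Prod>i\<in>{..<d} - {k}. a0 (x i))"
        using k by (simp add: c_fun_def max_coord_eq[OF k])
      then show "0 \<le> c_fun d \<delta> x \<and> dens x = ennreal (c_fun d \<delta> x)"
        using dens_unique_max(2)[OF k] by (simp add: b0_nonneg a0_nonneg prod_nonneg)
    qed
  qed
qed

lemma copula_density_c_fun: "copula_density d C_copula (c_fun d \<delta>)"
  unfolding copula_density_def
  using represents_C_copula distributed_dens AE_dens_eq_c_fun by blast

lemma a0_pos: "0 < a0 x \<Longrightarrow> x \<in> {0<..<1}" and b0_pos: "0 < b0 x \<Longrightarrow> x \<in> {0<..<1}"
  by (rule ccontr, simp add: a0_eq b0_eq)+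

text \<open>Positivity forces x into (0,1) and the factor d - g, or g, to be positive, so the
  logarithm of the product splits without meeting ln 0.\<close>

lemma ln_a0: "0 < a0 x \<Longrightarrow> ln (a0 x) = ln ((real d - g x) / real d) + (1 / real d - 1) * lnh0 x + F0 x"
  and ln_b0: "0 < b0 x \<Longrightarrow> ln (b0 x) = ln (g x / real d) + (1 / real d - 1) * lnh0 x + (1 - real d) * F0 x"
proof -
  assume a: "0 < a0 x"
  then have x: "x \<in> {0<..<1}" by (rule a0_pos)
  then have "(real d - g x) / real d \<noteq> 0" using a d_pos by (auto simp: a0_def)
  moreover have "0 \<le> (real d - g x) / real d" using g_le[of x] d_pos by simp
  ultimately have "0 < (real d - g x) / real d" by linarith
  then have "ln (a0 x) = ln ((real d - g x) / real d) + ln (E (1 / real d - 1) 1 x)"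
    using x ln_mult_pos[OF _ E_pos, of "(real d - g x) / real d" "1 / real d - 1" 1 x]
    by (simp only: a0_def E0_def indicator_simps mult_1)
  then show "ln (a0 x) = ln ((real d - g x) / real d) + (1 / real d - 1) * lnh0 x + F0 x"
    using x by (simp add: E_def lnh0_def F0_def)
next
  assume b: "0 < b0 x"
  then have x: "x \<in> {0<..<1}" by (rule b0_pos)
  then have "g x / real d \<noteq> 0" using b d_pos by (auto simp: b0_def)
  moreover have "0 \<le> g x / real d" using g_nonneg[of x] d_pos by simp
  ultimately have "0 < g x / real d" by linarith
  then have "ln (b0 x) = ln (g x / real d) + ln (E (1 / real d - 1) (1 - real d) x)"
    using x ln_mult_pos[OF _ E_pos, of "g x / real d" "1 / real d - 1" "1 - real d" x]
    by (simp only: b0_def E0_def indicator_simps mult_1)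
  then show "ln (b0 x) = ln (g x / real d) + (1 / real d - 1) * lnh0 x + (1 - real d) * F0 x"
    using x by (simp add: E_def lnh0_def F0_def)
qed

text \<open>The relation c ln c = c X - c Z with each term moved to the side where it is
  nonnegative, so that it can be integrated even if the mean of X is infinite. The second claim will
  bound the negative part by an integrable function.\<close>

lemma xlogx_dens_unique_max:
  assumes k: "k < d" "\<forall>i<d. i \<noteq> k \<longrightarrow> x i < x k"
  defines "c \<equiv> enn2real (dens x)"
  shows "ennreal (c * ln c) + (\<Sum>n<d. dens_at n x * Z_at n x) = dens x * X_part x + ennreal (- (c * ln c))"
    and "ennreal (- (c * ln c)) \<le> (\<Sum>n<d. dens_at n x * Z_at n x)"
proof -
  define I where "I = {..<d} - {k}"
  have I: "finite I" "k \<notin> I" "insert k I = {..<d}" "card I = d - 1" using k by (auto simp: I_def card_Diff_singleton)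
  have c: "c = b0 (x k) * (\<Prod>i\<in>I. a0 (x i))" "0 \<le> c"
    using dens_unique_max(2)[OF k] by (simp_all add: c_def I_def b0_nonneg a0_nonneg prod_nonneg)
  have dens: "dens x = ennreal c"
    using dens_unique_max(2)[OF k] by (simp add: c I_def)
  have sum: "(\<Sum>n<d. dens_at n x * Z_at n x) = ennreal c * Z_at k x"
    using sum_dens_at_unique_max[OF k] dens_unique_max(1)[OF k] dens by simp
  have "(ennreal (c * ln c) + ennreal c * Z_at k x = ennreal c * X_part x + ennreal (- (c * ln c)))
      \<and> ennreal (- (c * ln c)) \<le> ennreal c * Z_at k x"
  proof (cases "c = 0")
    case False
    then have "0 < c" using c(2) by simp
    then have b: "0 < b0 (x k)" and a: "0 < a0 (x i)" if "i \<in> I" for i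
    proof -
      show "0 < b0 (x k)" using False b0_nonneg[of "x k"] by (auto simp: c(1) less_le)
      show "0 < a0 (x i)" using False that a0_nonneg[of "x i"] I(1) by (auto simp: c(1) less_le)
    qed
    \<comment> \<open>Positivity at x k was obtained under the premise that I has a member; d >= 2
      provides one.\<close>
    have "I \<noteq> {}" using I(4) d by auto
    with b have b: "0 < b0 (x k)" by auto
    have xk: "x k \<in> {0<..<1}" using b by (rule b0_pos)
    have xi: "x i \<in> {0<..<1}" if "i \<in> I" for i using a[OF that] by (rule a0_pos)
    define X where "X = (\<Sum>i<d. (1 - 1 / real d) * - lnh0 (x i))"
    define Z where "Z = - ln (g (x k) / real d) + (\<Sum>i\<in>I. - ln ((real d - g (x i)) / real d) + (F0 (x k) - F0 (x i)))"
    have lnh: "0 \<le> - lnh0 y" for y using lnh_nonpos[of y] by (auto simp: lnh0_def indicator_def)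
    have X_term: "0 \<le> (1 - 1 / real d) * - lnh0 y" for y
      using lnh d_pos by (intro mult_nonneg_nonneg) auto
    have X: "X_part x = ennreal X" "0 \<le> X"
      unfolding X_part_def X_def using X_term by (simp_all only: sum_ennreal sum_nonneg)
    have ln_g: "0 \<le> - ln (g y / real d)" for y
      using g_nonneg[of y] g_le[of y] d_pos by (cases "g y = 0") (auto simp: ln_le_zero_iff)
    have ln_dg: "0 \<le> - ln ((real d - g y) / real d)" for y
      using g_nonneg[of y] g_le[of y] d_pos by (cases "g y = real d") (auto simp: ln_le_zero_iff)
    have F_diff: "0 \<le> F0 (x k) - F0 (x i)" if "i \<in> I" for i
      using F_mono[of "x i" "x k"] xk xi[OF that] k(2) that by (auto simp: F0_def I_def)
    have Zi: "0 \<le> - ln ((real d - g (x i)) / real d) + (F0 (x k) - F0 (x i))" if "i \<in> I" for i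
      using ln_dg[of "x i"] F_diff[OF that] by linarith
    have "Z_at k x = ennreal (- ln (g (x k) / real d)) + (\<Sum>i\<in>I. ennreal (- ln ((real d - g (x i)) / real d) + (F0 (x k) - F0 (x i))))"
      unfolding Z_at_def I_def[symmetric] using ln_dg F_diff
      by (intro arg_cong2[where f = "(+)"] refl sum.cong ennreal_plus[symmetric]) auto
    also have "\<dots> = ennreal (- ln (g (x k) / real d)) + ennreal (\<Sum>i\<in>I. - ln ((real d - g (x i)) / real d) + (F0 (x k) - F0 (x i)))"
      using Zi by (subst sum_ennreal) auto
    also have "\<dots> = ennreal Z"
      unfolding Z_def by (rule ennreal_plus[symmetric, OF ln_g sum_nonneg[OF Zi]])
    finally have Z: "Z_at k x = ennreal Z" .
    have "0 \<le> Z" unfolding Z_def by (rule add_nonneg_nonneg[OF ln_g sum_nonneg[OF Zi]])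
    have "ln c = ln (b0 (x k)) + (\<Sum>i\<in>I. ln (a0 (x i)))"
      using b a I(1) by (simp add: c(1) ln_mult_pos prod_pos ln_prod less_imp_neq[symmetric])
    also have "\<dots> = ln (g (x k) / real d) + (1 / real d - 1) * lnh0 (x k) + (1 - real d) * F0 (x k)
        + (\<Sum>i\<in>I. ln ((real d - g (x i)) / real d) + (1 / real d - 1) * lnh0 (x i) + F0 (x i))"
      using b a by (simp add: ln_a0 ln_b0)
    also have "\<dots> = X - Z"
    proof -
      define L where "L = (\<Sum>i\<in>I. ln ((real d - g (x i)) / real d))"
      define H where "H = (\<Sum>i\<in>I. lnh0 (x i))"
      define \<Phi> where "\<Phi> = (\<Sum>i\<in>I. F0 (x i))"
      have "X = (1 - 1 / real d) * - lnh0 (x k) + (\<Sum>i\<in>I. (1 - 1 / real d) * - lnh0 (x i))"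
        unfolding X_def I(3)[symmetric] using I(1,2) by simp
      also have "(\<Sum>i\<in>I. (1 - 1 / real d) * - lnh0 (x i)) = (1 - 1 / real d) * - H"
        unfolding sum_distrib_left[symmetric] sum_negf H_def ..
      finally have X_eq: "X = (1 - 1 / real d) * - lnh0 (x k) + (1 - 1 / real d) * - H" .
      have "(\<Sum>i\<in>I. - ln ((real d - g (x i)) / real d) + (F0 (x k) - F0 (x i))) = - L + ((real d - 1) * F0 (x k) - \<Phi>)"
        using I(4) d by (simp only: sum.distrib sum_subtractf sum_negf sum_constant L_def \<Phi>_def) (simp add: of_nat_diff)
      moreover have "(\<Sum>i\<in>I. ln ((real d - g (x i)) / real d) + (1 / real d - 1) * lnh0 (x i) + F0 (x i))
          = L + (1 / real d - 1) * H + \<Phi>"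
        by (simp only: sum.distrib sum_distrib_left L_def H_def \<Phi>_def)
      ultimately show ?thesis unfolding X_eq Z_def by (simp add: algebra_simps)
    qed
    finally have "c * ln c = c * X - c * Z" by (simp add: right_diff_distrib)
    moreover have "0 \<le> c * X" "0 \<le> c * Z" using c(2) X(2) \<open>0 \<le> Z\<close> by simp_all
    moreover have "ennreal c * ennreal X = ennreal (c * X)" "ennreal c * ennreal Z = ennreal (c * Z)"
      using c(2) X(2) \<open>0 \<le> Z\<close> by (simp_all add: ennreal_mult)
    \<comment> \<open>With u = c X and v = c Z this is (u - v)^+ + v = u + (u - v)^-, where
      \<open>ennreal\<close> takes the positive parts.\<close>
    moreover have "ennreal (u - v) + ennreal v = ennreal u + ennreal (- (u - v)) \<and> ennreal (- (u - v)) \<le> ennreal v"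
      if "0 \<le> u" "0 \<le> v" for u v :: real
      using that by (cases "v \<le> u") (auto simp: ennreal_plus[symmetric] ennreal_neg simp del: ennreal_plus intro: ennreal_leI)
    ultimately show ?thesis unfolding X Z by simp
  qed simp
  then show "ennreal (c * ln c) + (\<Sum>n<d. dens_at n x * Z_at n x) = dens x * X_part x + ennreal (- (c * ln c))"
    and "ennreal (- (c * ln c)) \<le> (\<Sum>n<d. dens_at n x * Z_at n x)"
    unfolding sum dens by auto
qed

lemma dens_outside_cube: "x \<in> space (lebesgue_pow d) \<Longrightarrow> x \<notin> unit_cube d \<Longrightarrow> dens x = 0"
proof -
  assume "x \<in> space (lebesgue_pow d)" "x \<notin> unit_cube d"
  then have "\<not> (\<forall>i<d. x i \<in> {0..1})" by (simp add: space_lebesgue_pow unit_cube_def PiE_iff) auto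
  then obtain i where i: "i < d" "x i \<notin> {0..1}" by blast
  then have 0: "a0 (x i) = 0" "b0 (x i) = 0" by (auto simp: a0_eq b0_eq)
  have "dens_at k x = 0" for k
  proof (cases "k = i")
    case True
    then show ?thesis using 0 by (simp add: dens_at_def)
  next
    case False
    then show ?thesis using i 0 by (auto simp: dens_at_def intro!: prod_zero bexI[of _ i])
  qed
  then show "dens x = 0" by (simp add: dens_def)
qed

text \<open>Integrating the pointwise identity gives P + z = (d - 1) J + N, with P and N the
  integrals of the two parts of c ln c. As N and z are finite, they can be moved across whether or
  not J is.\<close>

lemma info_pow_c_fun:
  "info_pow d (c_fun d \<delta>) = ereal (real d - 1) * enn2ereal (J_fun \<delta>)
     + ereal (I1 + I2 - real d * ln (real d) - (real d - 1))"
proof -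
  define c where "c x = enn2real (dens x)" for x
  have [measurable]: "c \<in> borel_measurable (lebesgue_pow d)" unfolding c_def[abs_def] by measurable
  define P where "P = (\<integral>\<^sup>+x. ennreal (c x * ln (c x)) \<partial>lebesgue_pow d)"
  define N where "N = (\<integral>\<^sup>+x. ennreal (- (c x * ln (c x))) \<partial>lebesgue_pow d)"
  define z where "z = (ln (real d) - I1) + ((real d - 1) * ln (real d) - I2) + (real d - 1)"
  have "info_pow d (c_fun d \<delta>) = xlogx_integral (lebesgue_pow d) (unit_cube d) c"
    unfolding info_pow_def using AE_dens_eq_c_fun
    by (intro xlogx_integral_cong_AE) (auto elim!: eventually_mono simp: c_def)
  also have "\<dots> = enn2ereal P - enn2ereal N"
  proof -
    have c0: "c x = 0" if "x \<in> space (lebesgue_pow d)" "x \<notin> unit_cube d" for x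
      using dens_outside_cube[OF that] by (simp add: c_def)
    have "(\<integral>\<^sup>+x\<in>unit_cube d. ennreal (c x * ln (c x)) \<partial>lebesgue_pow d) = P"
      unfolding P_def by (intro nn_integral_cong) (use c0 in \<open>auto simp: indicator_def\<close>)
    moreover have "(\<integral>\<^sup>+x\<in>unit_cube d. ennreal (- (c x * ln (c x))) \<partial>lebesgue_pow d) = N"
      unfolding N_def by (intro nn_integral_cong) (use c0 in \<open>auto simp: indicator_def\<close>)
    ultimately show ?thesis by (simp add: xlogx_integral_def)
  qed
  finally have info: "info_pow d (c_fun d \<delta>) = enn2ereal P - enn2ereal N" .
  have max: "AE x in lebesgue_pow d. \<exists>k<d. \<forall>i<d. i \<noteq> k \<longrightarrow> x i < x k"
    using d by (intro AE_lebesgue_pow_unique_max) auto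
  have ZM [measurable]: "(\<lambda>x. \<Sum>k<d. dens_at k x * Z_at k x) \<in> borel_measurable (lebesgue_pow d)"
    by (intro borel_measurable_sum borel_measurable_times_ennreal) auto
  note Z = nn_integral_dens_Z[folded z_def]
  have "P + ennreal z = (\<integral>\<^sup>+x. ennreal (c x * ln (c x)) + (\<Sum>k<d. dens_at k x * Z_at k x) \<partial>lebesgue_pow d)"
    unfolding P_def Z(1)[symmetric] by (rule nn_integral_add[symmetric]) measurable
  also have "\<dots> = (\<integral>\<^sup>+x. dens x * X_part x + ennreal (- (c x * ln (c x))) \<partial>lebesgue_pow d)"
    using max by (intro nn_integral_cong_AE) (auto elim!: eventually_mono simp: c_def xlogx_dens_unique_max)
  also have "\<dots> = ennreal (real d - 1) * J_fun \<delta> + N"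
    unfolding N_def nn_integral_dens_X_part[symmetric] by (rule nn_integral_add) measurable
  finally have eq: "P + ennreal z = ennreal (real d - 1) * J_fun \<delta> + N" .
  \<comment> \<open>This excludes \<infinity> - \<infinity> in the definition of the
    entropy.\<close>
  have "N \<le> ennreal z"
    unfolding N_def Z(1)[symmetric]
    using max by (intro nn_integral_mono_AE) (auto elim!: eventually_mono simp: c_def xlogx_dens_unique_max)
  then obtain n where n: "N = ennreal n" "0 \<le> n"
    by (cases N) (auto simp: top_unique)
  have z: "I1 + I2 - real d * ln (real d) - (real d - 1) = - z" by (simp add: z_def algebra_simps)
  show ?thesis
  proof (cases "J_fun \<delta>")
    case (real j)
    then have "P + ennreal z = ennreal ((real d - 1) * j + n)"
      using eq n d_pos by (simp add: ennreal_mult)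
    moreover from this obtain p where p: "P = ennreal p" "0 \<le> p" by (cases P) auto
    ultimately have "p + z = (real d - 1) * j + n"
      using Z(2) real n d_pos by (simp add: ennreal_plus[symmetric] del: ennreal_plus)
    then show ?thesis unfolding info z p n real using p n real by simp
  next
    case top
    have "ennreal (real d - 1) * \<top> = \<top>" using d_pos by (simp add: ennreal_mult_top)
    then have "P = \<top>" using eq n top by (cases P) (auto simp: ennreal_plus[symmetric] simp del: ennreal_plus)
    then show ?thesis unfolding info z n top using n d_pos by (simp add: top_ereal_def enn2ereal_top)
  qed
qed

lemma G_fun_eq: "G_fun d \<delta> = ereal (I1 + I2 - real d * ln (real d) - (real d - 1))"
proof -
  have deriv: "AE x in lborel. x \<in> {0..1} \<longrightarrow> deriv \<delta> x = g x"
    using \<delta>_deriv AE_lborel_singleton[of 0] AE_lborel_singleton[of 1]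
    by eventually_elim (auto intro: DERIV_imp_deriv)
  have "info1 (deriv \<delta>) = info1 g"
    unfolding info1_def by (rule xlogx_integral_cong_AE[OF deriv])
  also have "\<dots> = ereal I1" unfolding I1_def by (rule info1_bounded[OF g_measurable g_nonneg g_le])
  finally have 1: "info1 (deriv \<delta>) = ereal I1" .
  have "info1 (\<lambda>x. real d - deriv \<delta> x) = info1 (\<lambda>x. real d - g x)"
    unfolding info1_def using deriv by (intro xlogx_integral_cong_AE) (auto elim!: eventually_mono)
  also have "\<dots> = ereal I2"
    unfolding I2_def by (rule info1_bounded[where K = "real d"]) (use g_nonneg g_le in auto)
  finally show ?thesis by (simp add: G_fun_def 1)
qed

lemma copula_info_C_copula:
  "copula_info d C_copula = ereal (real d - 1) * enn2ereal (J_fun \<delta>) + G_fun d \<delta>"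
proof -
  have ex: "\<exists>c. copula_density d C_copula c" using copula_density_c_fun by blast
  have "AE x in lebesgue_pow d. x \<in> unit_cube d \<longrightarrow> (SOME c. copula_density d C_copula c) x = c_fun d \<delta> x"
    by (rule copula_density_unique[OF someI_ex[OF ex] copula_density_c_fun])
  then have "info_pow d (SOME c. copula_density d C_copula c) = info_pow d (c_fun d \<delta>)"
    unfolding info_pow_def by (rule xlogx_integral_cong_AE)
  then show ?thesis using ex by (simp add: copula_info_def abs_cont_copula_def info_pow_c_fun G_fun_eq)
qed

end

subsection \<open>Diagonal sections of copulas\<close>

text \<open>Domination by K times Lebesgue measure gives absolute continuity, and a Radon-Nikodym
  derivative can exceed K only on a null set. Truncating it at K makes the bound hold at every
  point.\<close>

lemma density_bounded_by_const:
  assumes N: "sets N = sets borel"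
    and le: "\<And>B. B \<in> sets borel \<Longrightarrow> emeasure N B \<le> ennreal K * emeasure lborel (B :: real set)"
    and "0 \<le> K"
  obtains g :: "real \<Rightarrow> real" where "g \<in> borel_measurable borel" "\<And>x. 0 \<le> g x" "\<And>x. g x \<le> K"
    "N = density lborel (\<lambda>x. ennreal (g x))"
proof -
  have "absolutely_continuous lborel N"
    unfolding absolutely_continuous_def null_sets_def
  proof safe
    fix B :: "real set" assume B: "B \<in> sets lborel" "emeasure lborel B = 0"
    then show "emeasure N B = 0" using le[of B] by simp
  qed (use N in simp)
  then obtain g' where g' [measurable]: "g' \<in> borel_measurable lborel" and dens: "density lborel g' = N"
    using sigma_finite_measure.Radon_Nikodym[OF sigma_finite_lborel, of N] N by auto
  \<comment> \<open>Restriction to [-n,n] keeps the integral of the constant K finite, as the strict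
    comparison of integrals requires.\<close>
  have "AE x in lborel. \<forall>n. g' x * indicator {- real n..real n} x \<le> ennreal K * indicator {- real n..real n} x"
    unfolding AE_all_countable
  proof
    fix n
    define B where "B = {x \<in> {- real n..real n}. ennreal K < g' x}"
    have [measurable]: "B \<in> sets borel" unfolding B_def by measurable
    have "AE x in lborel. g' x * indicator B x \<le> ennreal K * indicator B x"
    proof (rule ccontr)
      assume contr: "\<not> (AE x in lborel. g' x * indicator B x \<le> ennreal K * indicator B x)"
      have "(\<integral>\<^sup>+x. ennreal K * indicator B x \<partial>lborel) < (\<integral>\<^sup>+x. g' x * indicator B x \<partial>lborel)"
      proof (rule nn_integral_less[OF _ _ _ _ contr])
        have "emeasure lborel B \<le> emeasure lborel {- real n..real n}" by (intro emeasure_mono) (auto simp: B_def)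
        then show "(\<integral>\<^sup>+x. ennreal K * indicator B x \<partial>lborel) \<noteq> \<infinity>"
          by (auto simp: nn_integral_cmult ennreal_mult_eq_top_iff top_unique)
        show "AE x in lborel. ennreal K * indicator B x \<le> g' x * indicator B x"
          by (intro AE_I2) (auto simp: B_def indicator_def)
      qed measurable
      moreover have "(\<integral>\<^sup>+x. g' x * indicator B x \<partial>lborel) \<le> (\<integral>\<^sup>+x. ennreal K * indicator B x \<partial>lborel)"
        using le[of B] by (simp add: dens[symmetric] emeasure_density nn_integral_cmult)
      ultimately show False by simp
    qed
    then show "AE x in lborel. g' x * indicator {- real n..real n} x \<le> ennreal K * indicator {- real n..real n} x"
    proof eventually_elim
      case (elim x)
      then show ?case by (cases "x \<in> B") (auto simp: B_def indicator_def not_less)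
    qed
  qed
  then have bound: "AE x in lborel. g' x \<le> ennreal K"
  proof eventually_elim
    case (elim x)
    obtain n where "\<bar>x\<bar> \<le> real n" using real_arch_simple by blast
    then have "x \<in> {- real n..real n}" by auto
    then show ?case using elim[rule_format, of n] by simp
  qed
  define g where "g x = enn2real (min (g' x) (ennreal K))" for x
  have g: "ennreal (g x) = min (g' x) (ennreal K)" for x
    unfolding g_def by (rule ennreal_enn2real) (simp add: min_less_iff_disj)
  have "density lborel g' = density lborel (\<lambda>x. ennreal (g x))"
    using bound by (intro density_cong) (auto elim!: eventually_mono simp: g)
  moreover have "g x \<le> K" for x
    using g[of x] \<open>0 \<le> K\<close> by (metis ennreal_le_iff min.cobounded2)
  moreover have "g \<in> borel_measurable borel" unfolding g_def[abs_def] by measurable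
  ultimately show ?thesis using that[of g] dens by (simp add: g_def)
qed

text \<open>On [0,1], \<delta> is the distribution function of the maximum W of the components. Its
  density supplies \<open>g\<close>, and W >= U 0 gives \<delta> t <= t, which is strict inside by
  the hypothesis on the fixed points.\<close>

lemma D0_diagonal_section:
  assumes d: "d \<ge> 2" and "\<delta> \<in> D0 d" and \<Sigma>: "{t \<in> {0..1}. \<delta> t = t} = {0, 1}"
  shows "\<exists>g. diagonal_section d \<delta> g"
proof -
  obtain C c where C: "copula_density d C c" "has_diagonal_section d C \<delta>"
    using assms(2) by (auto simp: D0_def abs_cont_copula_def)
  obtain M :: "(nat \<Rightarrow> real) measure" and U where rep: "represents_copula d M U C"
    using C(1) unfolding copula_density_def by blast
  interpret prob_space M using rep by (simp add: represents_copula_def)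
  have U [measurable]: "U i \<in> borel_measurable M"
    and unif: "distr M lborel (U i) = uniform_measure lborel {0..1}" if "i < d" for i
    using rep that by (auto simp: represents_copula_def)
  have U_le: "emeasure M (U i -` B \<inter> space M) = emeasure lborel ({0..1} \<inter> B)" if "i < d" "B \<in> sets borel" for i B
    using arg_cong[OF unif[OF that(1)], of "\<lambda>N. emeasure N B"] that U
    by (simp add: emeasure_distr divide_ennreal_def)
  define W where "W \<omega> = Max ((\<lambda>i. U i \<omega>) ` {..<d})" for \<omega>
  have W [measurable]: "W \<in> borel_measurable M"
    unfolding W_def[abs_def] by (rule borel_measurable_Max) auto
  have "0 \<in> {..<d}" using d by simp
  then have nonempty: "{..<d} \<noteq> {}" by blast
  have W_mem: "\<exists>i<d. W \<omega> = U i \<omega>" for \<omega>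
  proof -
    have "W \<omega> \<in> (\<lambda>i. U i \<omega>) ` {..<d}" unfolding W_def using nonempty by (intro Max_in) auto
    then show ?thesis by auto
  qed
  have W_le: "W \<omega> \<le> t \<longleftrightarrow> (\<forall>i<d. U i \<omega> \<le> t)" for \<omega> t
    unfolding W_def using nonempty by (subst Max_le_iff) auto
  define N where "N = distr M borel W"
  interpret N: prob_space N unfolding N_def by (rule prob_space_distr) measurable
  \<comment> \<open>W always equals some U i, so W in B forces U i in B for one of d uniform
    components.\<close>
  have "emeasure N B \<le> ennreal (real d) * emeasure lborel B" if [measurable]: "B \<in> sets borel" for B
  proof -
    have "emeasure N B = emeasure M (W -` B \<inter> space M)" unfolding N_def by (rule emeasure_distr) auto
    also have "\<dots> \<le> emeasure M (\<Union>i<d. U i -` B \<inter> space M)"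
    proof (rule emeasure_mono)
      show "W -` B \<inter> space M \<subseteq> (\<Union>i<d. U i -` B \<inter> space M)"
      proof
        fix \<omega> assume "\<omega> \<in> W -` B \<inter> space M"
        with W_mem[of \<omega>] show "\<omega> \<in> (\<Union>i<d. U i -` B \<inter> space M)" by auto
      qed
      show "(\<Union>i<d. U i -` B \<inter> space M) \<in> events"
        by (intro sets.finite_UN measurable_sets[OF U]) auto
    qed
    also have "\<dots> \<le> (\<Sum>i<d. emeasure M (U i -` B \<inter> space M))"
      by (intro emeasure_subadditive_finite) (auto intro!: measurable_sets[OF U])
    also have "\<dots> \<le> (\<Sum>i<d. emeasure lborel B)"
      by (intro sum_mono) (auto simp: U_le intro!: emeasure_mono)
    finally show ?thesis by (simp add: ennreal_of_nat_eq_real_of_nat)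
  qed
  moreover have "sets N = sets borel" by (simp add: N_def)
  ultimately obtain g where g [measurable]: "g \<in> borel_measurable borel" and g_bounds: "\<And>x. 0 \<le> g x" "\<And>x. g x \<le> real d"
    and N_dens: "N = density lborel (\<lambda>x. ennreal (g x))"
    using density_bounded_by_const[of N "real d"] by (metis of_nat_0_le_iff)
  define G where "G t = measure N {..t}" for t
  have mono: "mono G" unfolding G_def by (intro monoI N.finite_measure_mono) (auto simp: N_def)
  have G: "(\<integral>\<^sup>+x\<in>{s..t}. ennreal (g x) \<partial>lborel) = ennreal (G t - G s)" if "s \<le> t" for s t
  proof -
    have "G t - G s = measure N ({..t} - {..s})"
      unfolding G_def using that by (intro N.finite_measure_Diff[symmetric]) (auto simp: N_def)
    then have "ennreal (G t - G s) = emeasure N ({..t} - {..s})" by (simp add: N.emeasure_eq_measure)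
    also have "\<dots> = (\<integral>\<^sup>+x\<in>{..t} - {..s}. ennreal (g x) \<partial>lborel)"
      unfolding N_dens by (simp add: emeasure_density)
    also have "\<dots> = (\<integral>\<^sup>+x\<in>{s..t}. ennreal (g x) \<partial>lborel)"
    proof (rule nn_integral_cong_AE)
      show "AE x in lborel. ennreal (g x) * indicator ({..t} - {..s}) x = ennreal (g x) * indicator {s..t} x"
        using AE_lborel_singleton[of s] by eventually_elim (auto simp: indicator_def)
    qed
    finally show ?thesis ..
  qed
  have \<delta>_eq: "\<delta> t = G t" if t: "t \<in> {0..1}" for t
  proof -
    have "diag_point d t \<in> unit_cube d" using t by (auto simp: diag_point_def unit_cube_def)
    then have "\<delta> t = measure M {\<omega> \<in> space M. \<forall>i<d. U i \<omega> \<le> diag_point d t i}"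
      using C(2) rep t by (simp add: has_diagonal_section_def represents_copula_def)
    also have "{\<omega> \<in> space M. \<forall>i<d. U i \<omega> \<le> diag_point d t i} = W -` {..t} \<inter> space M"
      by (auto simp: W_le diag_point_def)
    also have "measure M \<dots> = G t" unfolding G_def N_def by (rule measure_distr[symmetric]) auto
    finally show ?thesis .
  qed
  have 01: "\<delta> 0 = 0" "\<delta> 1 = 1" using \<Sigma> by (auto simp: set_eq_iff)
  have lip: "G t - G s \<le> real d * (t - s)" if "s \<le> t" for s t
  proof -
    have "ennreal (G t - G s) \<le> (\<integral>\<^sup>+x. ennreal (real d) * indicator {s..t} x \<partial>lborel)"
      unfolding G[OF that, symmetric] using g_bounds(2)
      by (intro nn_integral_mono) (auto simp: indicator_def intro!: ennreal_leI)
    also have "\<dots> = ennreal (real d * (t - s))" using that by (simp add: nn_integral_cmult ennreal_mult)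
    finally show ?thesis using that by (simp add: ennreal_le_iff)
  qed
  have "diagonal_section d \<delta> g"
  proof
    show "2 \<le> d" "\<delta> 0 = 0" "\<delta> 1 = 1" "g \<in> borel_measurable borel" by fact+
    show "0 \<le> g x" "g x \<le> real d" for x by fact+
    show "\<delta> s \<le> \<delta> t" if "0 \<le> s" "s \<le> t" "t \<le> 1" for s t
      using \<delta>_eq that monoD[OF mono, of s t] by simp
    show "\<delta> t < t" if t: "0 < t" "t < 1" for t
    proof -
      have "emeasure M (W -` {..t} \<inter> space M) \<le> emeasure M (U 0 -` {..t} \<inter> space M)"
        using W_le d by (intro emeasure_mono measurable_sets[OF U]) auto
      also have "\<dots> = emeasure lborel ({0..1} \<inter> {..t})" using U_le[of 0 "{..t}"] d by simp
      also have "{0..1} \<inter> {..t} = {0..t}" using t by auto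
      finally have "ennreal (G t) \<le> ennreal t"
        using t unfolding G_def N_def by (simp add: measure_distr emeasure_eq_measure)
      then have "\<delta> t \<le> t" using t \<delta>_eq by (simp add: ennreal_le_iff)
      moreover have "\<delta> t \<noteq> t"
      proof
        assume "\<delta> t = t"
        then have "t \<in> {t \<in> {0..1}. \<delta> t = t}" using t by simp
        then show False unfolding \<Sigma> using t by simp
      qed
      ultimately show ?thesis by simp
    qed
    show "(real d)-lipschitz_on {0..1} \<delta>"
    proof (rule lipschitz_onI)
      fix s t :: real assume st: "s \<in> {0..1}" "t \<in> {0..1}"
      then show "dist (\<delta> s) (\<delta> t) \<le> real d * dist s t"
        using \<delta>_eq lip[of s t] lip[of t s] monoD[OF mono, of s t] monoD[OF mono, of t s]
        by (cases "s \<le> t") (auto simp: dist_real_def abs_if)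
    qed simp
    show "(\<integral>\<^sup>+x\<in>{0..t}. ennreal (g x) \<partial>lborel) = ennreal (\<delta> t)" if "0 \<le> t" "t \<le> 1" for t
      using G[of 0 t] \<delta>_eq[of 0] \<delta>_eq[of t] 01 that by simp
    have "AE x in lborel. (G has_real_derivative g x) (at x)"
      by (rule AE_has_real_derivative_indefinite_integral[OF g g_bounds mono G])
    then show "AE x in lborel. x \<in> {0<..<1} \<longrightarrow> (\<delta> has_real_derivative g x) (at x)"
    proof eventually_elim
      case (elim x)
      show ?case
      proof
        assume x: "x \<in> {0<..<1}"
        \<comment> \<open>\<delta> agrees with G only on [0,1], so a neighbourhood inside the open
          interval is required to transfer the derivative.\<close>
        then have "eventually (\<lambda>y. y \<in> {0<..<1}) (nhds x)" by (intro eventually_nhds_in_open) auto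
        then have "eventually (\<lambda>y. \<delta> y = G y) (nhds x)" by eventually_elim (auto simp: \<delta>_eq)
        then show "(\<delta> has_real_derivative g x) (at x)" using elim by (subst DERIV_cong_ev) auto
      qed
    qed
  qed
  then show ?thesis by (rule exI[of "diagonal_section d \<delta>" g])
qed

theorem proposition2p1:
  fixes d :: nat and \<delta> :: "real \<Rightarrow> real"
  assumes "d \<ge> 2"
    and "\<delta> \<in> D0 d"
    and "{t \<in> {0..1}. \<delta> t = t} = {0, 1}"
  shows "\<exists>C. copula_density d C (c_fun d \<delta>)
           \<and> symmetric_copula d C
           \<and> has_diagonal_section d C \<delta>
           \<and> copula_info d C = ereal (real d - 1) * enn2ereal (J_fun \<delta>) + G_fun d \<delta>"
proof -
  obtain g where "diagonal_section d \<delta> g" using D0_diagonal_section[OF assms] by auto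
  then interpret diagonal_section d \<delta> g .
  show ?thesis
    using copula_density_c_fun symmetric_C_copula diagonal_C_copula copula_info_C_copula by blast
qed

end
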